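(* Let $d\ge2$, let $\Omega$ be an open subset of $\mathbb{R}^d$, and let $A\in L^1_{\rm loc}(\Omega;\mathbf{Sym}_d)$ take values in the positive semi-definite matrices almost everywhere, and be such that $\mathrm{Div}\,A$ is locally a bounded measure on $\Omega$. Then $(\det A)^{\frac1{d-1}}\in L^1_{\rm loc}(\Omega)$.
   Context: $\mathbf{Sym}_d$ is the space of real symmetric $d\times d$ matrices; $(\mathrm{Div}\,A)_i=\sum_j\partial_ja_{ij}$ in the sense of distributions. *)

theory Defs
  imports "HOL-Analysis.Analysis"
begin

definition partial_deriv :: "('n::finite) \<Rightarrow> (real^'n \<Rightarrow> real) \<Rightarrow> real^'n \<Rightarrow> real" where
  "partial_deriv j f x = frechet_derivative f (at x) (axis j 1)"

fun Ck_fun :: "nat \<Rightarrow> (real^('n::finite) \<Rightarrow> real) set" where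
  "Ck_fun 0 = {f. continuous_on UNIV f}"
| "Ck_fun (Suc k) = {f. (\<forall>x. f differentiable (at x)) \<and>
                        (\<forall>j. partial_deriv j f \<in> Ck_fun k)}"

definition smooth_fun :: "(real^('n::finite) \<Rightarrow> real) \<Rightarrow> bool" where
  "smooth_fun f \<longleftrightarrow> (\<forall>k. f \<in> Ck_fun k)"

definition test_fun_in :: "(real^('n::finite)) set \<Rightarrow> (real^'n \<Rightarrow> real) \<Rightarrow> bool" where
  "test_fun_in K \<phi> \<longleftrightarrow> smooth_fun \<phi> \<and> closure {x. \<phi> x \<noteq> 0} \<subseteq> K"

definition locally_L1 :: "(real^('n::finite) \<Rightarrow> real) \<Rightarrow> (real^'n) set \<Rightarrow> bool" where
  "locally_L1 f \<Omega> \<longleftrightarrow> (\<forall>K. compact K \<and> K \<subseteq> \<Omega> \<longrightarrow> f absolutely_integrable_on K)"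

text \<open>The distributional row-wise divergence Div A (pairing with test function phi is
  -sum_j int a_ij d_j phi) is locally a bounded measure, i.e. a distribution of order 0:
  on each compact K in Omega it is bounded by C times the sup norm of the test function.\<close>
definition div_locally_measure :: "(real^('n::finite) \<Rightarrow> real^'n^'n) \<Rightarrow> (real^'n) set \<Rightarrow> bool" where
  "div_locally_measure A \<Omega> \<longleftrightarrow>
     (\<forall>K. compact K \<and> K \<subseteq> \<Omega> \<longrightarrow> (\<exists>C. \<forall>\<phi> i. test_fun_in K \<phi> \<longrightarrow>
        \<bar>\<Sum>j\<in>UNIV. integral \<Omega> (\<lambda>x. A x $ i $ j * partial_deriv j \<phi> x)\<bar>
          \<le> C * (SUP x. \<bar>\<phi> x\<bar>)))"

end

theory Submission
  imports Defs
begin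

text \<open>If \<open>\<phi>\<close> is smooth and convex with \<open>|\<nabla>\<phi>| \<le> R\<close>, then testing \<open>Div A\<close> against \<open>\<chi> \<nabla>\<phi>\<close> for a cutoff
  \<open>\<chi>\<close> bounds \<open>\<integral> \<chi> tr (A D\<^sup>2\<phi>)\<close> by \<open>C R\<close>, and averaging over translates of \<open>\<phi>\<close> gives the same bound for
  the mollifications \<open>b\<close> of \<open>\<chi> A\<close>. Fill \<open>{det b > 0}\<close> by disjoint ellipsoids \<open>E\<^sub>k\<close> centred at \<open>x\<^sub>k\<close> and of
  shape \<open>L\<^sub>k\<close>, on which \<open>b\<close> is comparable to and at least \<open>A\<^sub>k = L\<^sub>k L\<^sub>k\<^sup>T\<close>. Instead of solving
  the Monge--Ampere equation \<open>det D\<^sup>2\<phi> = (det b)\<^bsup>1/(d-1)\<^esup>\<close>, choose by semi-discrete optimal transport a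
  piecewise affine convex \<open>\<phi>\<close> whose subdifferential at \<open>x\<^sub>k\<close> has volume about \<open>|E\<^sub>k| (det A\<^sub>k)\<^bsup>1/(d-1)\<^esup>\<close> and
  which has slopes in a cube whose volume is the total mass \<open>S\<close>, and smooth it to a log-sum-exp function.
  Such a subdifferential contains two slopes that are far apart in the metric of \<open>A\<^sub>k\<close>, so \<open>\<phi>\<close> has a kink
  at \<open>x\<^sub>k\<close> and \<open>\<integral> tr (A\<^sub>k D\<^sup>2\<phi>)\<close> over \<open>E\<^sub>k\<close> is at least a constant times \<open>|E\<^sub>k| (det A\<^sub>k)\<^bsup>1/(d-1)\<^esup>\<close>. Hence
  \<open>c S \<le> C S\<^bsup>1/d\<^esup>\<close>, which bounds \<open>\<integral> (det b)\<^bsup>1/(d-1)\<^esup>\<close>; conclude with Fatou's lemma.\<close>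

section \<open>Smooth functions and bumps\<close>

text \<open>The exponent is forced by scaling. On an ellipsoid of shape \<open>L\<close> and radius
  \<open>r\<close>, a cell of volume \<open>m\<close> contains slopes whose distance after
  \<open>transpose L\<close> is of order \<open>(\<bar>det L\<bar> * m) powr (1 / d)\<close>, and
  the kink is worth this distance times \<open>\<bar>det L\<bar> * r ^ (d - 1)\<close>. If the gain
  is to be a constant times \<open>m\<close>, then \<open>m\<close> must be of order
  \<open>\<bar>det L\<bar> powr (2 / (d - 1))\<close> times the volume of the ellipsoid, which is
  the power \<open>1 / (d - 1)\<close> of \<open>det (L ** transpose L)\<close>. Ellipsoids are used
  because the linear change of variables by \<open>L\<close> turns the trace into a Laplacian on a
  ball, so that one radial bump gives constants that do not depend on the eccentricity. A solution
  of the Monge--Ampere equation would need regularity theory before it could be tested. Here cells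
  of approximately the right volume suffice, and only two slopes per cell are kept. The relaxation
  of the cells and the smoothing both cost a multiple of a parameter \<open>t\<close> that tends to
  0, which is harmless because the upper bound \<open>C * R\<close> involves neither the inverse
  temperature nor the number of slopes.\<close>

lemma partial_deriv_eq:
  "(f has_derivative f') (at x) \<Longrightarrow> partial_deriv j f x = f' (axis j 1)"
  unfolding partial_deriv_def by (metis frechet_derivative_at)

lemma Ck_fun_SucI:
  assumes "\<And>x. (f has_derivative f' x) (at x)" "\<And>j. (\<lambda>x. f' x (axis j 1)) \<in> Ck_fun k"
  shows "f \<in> Ck_fun (Suc k)"
proof -
  have "partial_deriv j f = (\<lambda>x. f' x (axis j 1))" for j
    using partial_deriv_eq[OF assms(1)] by auto
  then show ?thesis using assms by (auto simp: differentiable_def)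
qed

lemma Ck_fun_SucE:
  assumes "f \<in> Ck_fun (Suc k)"
  shows "(f has_derivative frechet_derivative f (at x)) (at x)" "partial_deriv j f \<in> Ck_fun k"
  using assms by (auto simp: frechet_derivative_works[symmetric])

lemma Ck_fun_Suc_subset: "f \<in> Ck_fun (Suc k) \<Longrightarrow> f \<in> Ck_fun k"
proof (induction k arbitrary: f)
  case 0
  then show ?case
    by (auto intro!: continuous_at_imp_continuous_on differentiable_imp_continuous_within)
next
  case (Suc k)
  have d: "\<forall>x. f differentiable at x" and p: "\<And>j. partial_deriv j f \<in> Ck_fun (Suc k)"
    using Suc.prems unfolding Ck_fun.simps(2)[of "Suc k"] by blast+
  from d Suc.IH[OF p] show ?case by simp
qed

lemma Ck_fun_const: "(\<lambda>x. c) \<in> Ck_fun k"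
proof (induction k arbitrary: c)
  case (Suc k)
  show ?case
    by (rule Ck_fun_SucI[where f' = "\<lambda>x h. 0"]) (auto simp: Suc)
qed auto

lemma Ck_fun_inner: "(\<lambda>x. x \<bullet> y) \<in> Ck_fun k"
proof (cases k)
  case (Suc k')
  have "(\<lambda>x. x \<bullet> y) \<in> Ck_fun (Suc k')"
    by (rule Ck_fun_SucI[where f' = "\<lambda>x h. h \<bullet> y"])
       (auto simp: Ck_fun_const intro!: derivative_eq_intros)
  then show ?thesis by (simp only: Suc)
qed (auto intro!: continuous_intros)

lemma Ck_fun_add: "f \<in> Ck_fun k \<Longrightarrow> g \<in> Ck_fun k \<Longrightarrow> (\<lambda>x. f x + g x) \<in> Ck_fun k"
proof (induction k arbitrary: f g)
  case (Suc k)
  note f = Ck_fun_SucE[OF Suc.prems(1)] and g = Ck_fun_SucE[OF Suc.prems(2)]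
  show ?case
    by (rule Ck_fun_SucI, rule has_derivative_add[OF f(1) g(1)])
       (use Suc.IH[OF f(2) g(2)] in \<open>simp add: partial_deriv_def[abs_def]\<close>)
qed (auto intro!: continuous_intros)

lemma Ck_fun_mult: "f \<in> Ck_fun k \<Longrightarrow> g \<in> Ck_fun k \<Longrightarrow> (\<lambda>x. f x * g x) \<in> Ck_fun k"
proof (induction k arbitrary: f g)
  case (Suc k)
  note f = Ck_fun_SucE[OF Suc.prems(1)] and g = Ck_fun_SucE[OF Suc.prems(2)]
  note f' = Ck_fun_Suc_subset[OF Suc.prems(1)] and g' = Ck_fun_Suc_subset[OF Suc.prems(2)]
  show ?case
    by (rule Ck_fun_SucI, rule has_derivative_mult[OF f(1) g(1)])
       (use Ck_fun_add[OF Suc.IH[OF f' g(2)] Suc.IH[OF f(2) g']] in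
         \<open>simp add: partial_deriv_def[abs_def]\<close>)
qed (auto intro!: continuous_intros)

lemma Ck_fun_sum: "(\<And>i. i \<in> I \<Longrightarrow> f i \<in> Ck_fun k) \<Longrightarrow> (\<lambda>x. \<Sum>i\<in>I. f i x) \<in> Ck_fun k"
  by (induction I rule: infinite_finite_induct) (auto simp: Ck_fun_const intro!: Ck_fun_add)

text \<open>Differentiating \<open>D n (u x)\<close> produces \<open>D (Suc n)\<close>, so the outer
  function comes as its whole sequence of derivatives and the induction leaves \<open>n\<close>
  free. It serves \<open>exp\<close>, with a constant sequence, and \<open>bump\<close>.\<close>

lemma Ck_fun_compose:
  assumes D: "\<And>n t. (D n has_real_derivative D (Suc n) t) (at t)"
  shows "u \<in> Ck_fun k \<Longrightarrow> (\<lambda>x. D n (u x)) \<in> Ck_fun k"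
proof (induction k arbitrary: n u)
  case 0
  have "continuous_on UNIV (D n)"
    using D by (meson DERIV_isCont continuous_at_imp_continuous_on)
  then have "continuous_on UNIV (\<lambda>x. D n (u x))"
    using 0 by (auto intro: continuous_on_compose2)
  then show ?case by simp
next
  case (Suc k)
  note u = Ck_fun_SucE[OF Suc.prems] and u' = Ck_fun_Suc_subset[OF Suc.prems]
  have "((\<lambda>x. D n (u x)) has_derivative (\<lambda>h. D (Suc n) (u x) * frechet_derivative u (at x) h)) (at x)" for x
    using has_derivative_compose[OF u(1), of "D n" "\<lambda>h. D (Suc n) (u x) * h"] D[of n "u x"]
    by (simp add: has_field_derivative_def)
  then show ?case
    by (rule Ck_fun_SucI)
       (use Ck_fun_mult[OF Suc.IH[OF u'] u(2)] in \<open>simp add: partial_deriv_def[abs_def]\<close>)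
qed

text \<open>The derivative of \<open>1/f\<close> is again expressed by \<open>1/f\<close> and the
  derivative of \<open>f\<close>, so the induction on \<open>k\<close> closes by the product
  rule.\<close>

lemma Ck_fun_inverse:
  assumes "\<And>x. f x \<noteq> 0"
  shows "f \<in> Ck_fun k \<Longrightarrow> (\<lambda>x. inverse (f x)) \<in> Ck_fun k"
proof (induction k)
  case 0
  then show ?case using assms by (auto intro!: continuous_intros)
next
  case (Suc k)
  note f = Ck_fun_SucE[OF Suc.prems] and f' = Ck_fun_Suc_subset[OF Suc.prems]
  have *: "(\<lambda>x. -1 * (inverse (f x) * (partial_deriv j f x * inverse (f x)))) \<in> Ck_fun k" for j
    by (intro Ck_fun_mult Ck_fun_const Suc.IH f' f(2))
  show ?case
    by (rule Ck_fun_SucI, rule Deriv.has_derivative_inverse[OF assms f(1)])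
       (use * in \<open>simp add: partial_deriv_def[abs_def] mult.assoc\<close>)
qed

text \<open>The derivatives of \<open>exp (-1/t)\<close> are polynomials in \<open>1/t\<close> times itself.\<close>
definition bump_deriv :: "real poly \<Rightarrow> real \<Rightarrow> real" where
  "bump_deriv p t = (if 0 < t then poly p (inverse t) * exp (- inverse t) else 0)"

lemma tendsto_poly_times_exp_neg:
  fixes p :: "real poly"
  shows "((\<lambda>s. poly p s * exp (- s)) \<longlongrightarrow> 0) at_top"
proof -
  have "((\<lambda>s. \<Sum>i\<le>degree p. coeff p i * (s ^ i / exp s)) \<longlongrightarrow> (\<Sum>i\<le>degree p. coeff p i * 0)) at_top"
    by (intro tendsto_intros tendsto_power_div_exp_0)
  then show ?thesis
    by (simp add: poly_altdef sum_distrib_right exp_minus field_simps sum_divide_distrib)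
qed

text \<open>With \<open>s = 1/t\<close> one has \<open>ds/dt = - s^2\<close>, so the derivative of
  \<open>p(s) exp(-s)\<close> is \<open>s^2 (p(s) - p'(s)) exp(-s)\<close>; the factor
  \<open>[:0,0,1:]\<close> is \<open>s^2\<close>. Iteration from the polynomial 1 gives all
  derivatives of the bump.\<close>

lemma bump_deriv_has_derivative:
  "(bump_deriv p has_real_derivative bump_deriv ([:0,0,1:] * (p - pderiv p)) t) (at t)"
proof (cases t "0::real" rule: linorder_cases)
  case less
  have "((\<lambda>t. 0) has_real_derivative 0) (at t)" by simp
  then show ?thesis
    using less
    by (subst DERIV_cong_ev[OF refl _ refl, of _ "\<lambda>t. 0"])
       (auto simp: bump_deriv_def intro!: eventually_nhds_in_open[of "{..<0}", THEN eventually_mono])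
next
  case greater
  have "((\<lambda>t. poly p (inverse t) * exp (- inverse t)) has_real_derivative
      bump_deriv ([:0,0,1:] * (p - pderiv p)) t) (at t)"
    using greater
    by (auto simp: bump_deriv_def field_simps power2_eq_square intro!: derivative_eq_intros)
  then show ?thesis
    using greater
    by (subst DERIV_cong_ev[OF refl _ refl, of _ "\<lambda>t. poly p (inverse t) * exp (- inverse t)"])
       (auto simp: bump_deriv_def intro!: eventually_nhds_in_open[of "{0<..}", THEN eventually_mono])
next
  case equal
  \<comment> \<open>Dividing by \<open>t\<close> multiplies the polynomial by \<open>s\<close>, so
    the difference quotient at 0 has the same form with \<open>pCons 0 p\<close> and is killed by
    the exponential.\<close>
  have "((\<lambda>t. poly (pCons 0 p) (inverse t) * exp (- inverse t)) \<longlongrightarrow> 0) (at_right 0)"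
    by (rule filterlim_compose[OF tendsto_poly_times_exp_neg filterlim_inverse_at_top_right])
  then have R: "((\<lambda>t. bump_deriv p t / t) \<longlongrightarrow> 0) (at_right 0)"
    by (rule Lim_transform_eventually)
       (auto simp: bump_deriv_def field_simps eventually_at_right_less
             intro!: eventually_at_rightI[of 0 1])
  have L: "((\<lambda>t. bump_deriv p t / t) \<longlongrightarrow> 0) (at_left 0)"
    by (rule Lim_transform_eventually[where f = "\<lambda>_. 0"])
       (auto simp: bump_deriv_def intro!: eventually_at_leftI[of "-1" 0])
  have "((\<lambda>t. bump_deriv p t / t) \<longlongrightarrow> 0) (at 0)"
    using L R by (simp add: filterlim_at_split)
  then show ?thesis using equal by (simp add: DERIV_def bump_deriv_def)
qed

definition bump :: "real \<Rightarrow> real" where "bump = bump_deriv 1"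

lemma Ck_fun_bump: "u \<in> Ck_fun k \<Longrightarrow> (\<lambda>x. bump (u x)) \<in> Ck_fun k"
proof -
  define P :: "nat \<Rightarrow> real poly" where "P n = ((\<lambda>p. [:0,0,1:] * (p - pderiv p)) ^^ n) 1" for n
  have "(bump_deriv (P n) has_real_derivative bump_deriv (P (Suc n)) t) (at t)" for n t
    using bump_deriv_has_derivative[of "P n" t] by (simp add: P_def)
  from Ck_fun_compose[of "\<lambda>n. bump_deriv (P n)", OF this, of u k 0]
  show "u \<in> Ck_fun k \<Longrightarrow> (\<lambda>x. bump (u x)) \<in> Ck_fun k" by (simp add: bump_def P_def)
qed

lemma bump_bounds: "0 \<le> bump t" "bump t \<le> 1" "0 < t \<Longrightarrow> 0 < bump t" "t \<le> 0 \<Longrightarrow> bump t = 0"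
  by (auto simp: bump_def bump_deriv_def)

lemma bump_mono: "s \<le> t \<Longrightarrow> bump s \<le> bump t"
  by (auto simp: bump_def bump_deriv_def)

section \<open>Gibbs averages as gradients of convex functions\<close>

text \<open>The partition function, at inverse temperature \<open>\<beta>\<close>, of the affine
  functions with slopes \<open>y\<close> and intercepts \<open>- c y\<close>. For large
  \<open>\<beta>\<close> the normalised weights concentrate on the slopes that attain the maximum at
  \<open>x\<close>.\<close>

definition gibbs_Z :: "'a::real_inner set \<Rightarrow> real \<Rightarrow> ('a \<Rightarrow> real) \<Rightarrow> 'a \<Rightarrow> real" where
  "gibbs_Z Y \<beta> c x = (\<Sum>y\<in>Y. exp (\<beta> * (x \<bullet> y - c y)))"

definition gibbs :: "'a::real_inner set \<Rightarrow> real \<Rightarrow> ('a \<Rightarrow> real) \<Rightarrow> 'a \<Rightarrow> 'a \<Rightarrow> real" where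
  "gibbs Y \<beta> c x y = exp (\<beta> * (x \<bullet> y - c y)) / gibbs_Z Y \<beta> c x"

definition gibbs_mean :: "'a::real_inner set \<Rightarrow> real \<Rightarrow> ('a \<Rightarrow> real) \<Rightarrow> 'a \<Rightarrow> 'a" where
  "gibbs_mean Y \<beta> c x = (\<Sum>y\<in>Y. gibbs Y \<beta> c x y *\<^sub>R y)"

text \<open>With \<open>\<phi> = ln gibbs_Z / \<beta>\<close>, the vector \<open>gibbs_mean\<close> is \<open>\<nabla>\<phi>\<close> and the following is \<open>tr (M D\<^sup>2\<phi>)\<close>.\<close>
definition gibbs_trace :: "(real^'n) set \<Rightarrow> real \<Rightarrow> (real^'n \<Rightarrow> real) \<Rightarrow> real^'n \<Rightarrow> real^'n^'n \<Rightarrow> real" where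
  "gibbs_trace Y \<beta> c x M = \<beta> * (\<Sum>y\<in>Y. gibbs Y \<beta> c x y *
     ((y - gibbs_mean Y \<beta> c x) \<bullet> (M *v (y - gibbs_mean Y \<beta> c x))))"

lemma gibbs_Z_pos: "finite Y \<Longrightarrow> Y \<noteq> {} \<Longrightarrow> 0 < gibbs_Z Y \<beta> c x"
  unfolding gibbs_Z_def by (intro sum_pos) auto

lemma gibbs_nonneg: "0 \<le> gibbs Y \<beta> c x y"
  unfolding gibbs_def gibbs_Z_def by (intro divide_nonneg_nonneg sum_nonneg) auto

lemma sum_gibbs: "finite Y \<Longrightarrow> Y \<noteq> {} \<Longrightarrow> (\<Sum>y\<in>Y. gibbs Y \<beta> c x y) = 1"
  unfolding gibbs_def
  using gibbs_Z_pos[of Y \<beta> c x]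
  by (simp add: sum_divide_distrib[symmetric]) (simp add: gibbs_Z_def)

lemma sum_gibbs_centered:
  "finite Y \<Longrightarrow> Y \<noteq> {} \<Longrightarrow> (\<Sum>y\<in>Y. gibbs Y \<beta> c x y *\<^sub>R (y - gibbs_mean Y \<beta> c x)) = 0"
  by (simp add: scaleR_diff_right sum_subtractf scaleR_left.sum[symmetric] sum_gibbs gibbs_mean_def[symmetric])

lemma gibbs_mean_component_bound:
  fixes Y :: "(real^'n) set"
  assumes "finite Y" "Y \<noteq> {}" "\<And>y. y \<in> Y \<Longrightarrow> \<bar>y $ i\<bar> \<le> R"
  shows "\<bar>gibbs_mean Y \<beta> c x $ i\<bar> \<le> R"
proof -
  have "\<bar>gibbs_mean Y \<beta> c x $ i\<bar> = \<bar>\<Sum>y\<in>Y. gibbs Y \<beta> c x y * y $ i\<bar>"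
    by (simp add: gibbs_mean_def sum_component)
  also have "\<dots> \<le> (\<Sum>y\<in>Y. gibbs Y \<beta> c x y * R)"
    by (intro order.trans[OF sum_abs] sum_mono)
       (auto simp: abs_mult gibbs_nonneg assms intro!: mult_left_mono)
  also have "\<dots> = R" using assms by (simp add: sum_distrib_right[symmetric] sum_gibbs)
  finally show ?thesis .
qed

lemma gibbs_has_derivative:
  assumes "finite Y" "Y \<noteq> {}"
  shows "((\<lambda>x. gibbs Y \<beta> c x y) has_derivative
     (\<lambda>h. \<beta> * gibbs Y \<beta> c x y * ((y - gibbs_mean Y \<beta> c x) \<bullet> h))) (at x)"
proof -
  let ?E = "\<lambda>x y. exp (\<beta> * (x \<bullet> y - c y))" and ?Z = "gibbs_Z Y \<beta> c"
  have Z: "?Z x \<noteq> 0" using gibbs_Z_pos[OF assms, of \<beta> c x] by simp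
  have E: "((\<lambda>x. ?E x y) has_derivative (\<lambda>h. \<beta> * ?E x y * (y \<bullet> h))) (at x)" for y
    by (auto intro!: derivative_eq_intros simp: inner_commute)
  have "(?Z has_derivative (\<lambda>h. \<Sum>y\<in>Y. \<beta> * ?E x y * (y \<bullet> h))) (at x)"
    unfolding gibbs_Z_def[abs_def] by (intro has_derivative_sum E)
  moreover have "(\<lambda>h. \<Sum>y\<in>Y. \<beta> * ?E x y * (y \<bullet> h)) = (\<lambda>h. \<beta> * ?Z x * (gibbs_mean Y \<beta> c x \<bullet> h))"
  proof
    fix h
    have "(\<Sum>y\<in>Y. ?E x y * (y \<bullet> h)) = (\<Sum>y\<in>Y. ?Z x * (gibbs Y \<beta> c x y * (y \<bullet> h)))"
      using Z by (intro sum.cong) (auto simp: gibbs_def)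
    also have "\<dots> = ?Z x * (gibbs_mean Y \<beta> c x \<bullet> h)"
      by (simp add: gibbs_mean_def inner_sum_left sum_distrib_left)
    finally show "(\<Sum>y\<in>Y. \<beta> * ?E x y * (y \<bullet> h)) = \<beta> * ?Z x * (gibbs_mean Y \<beta> c x \<bullet> h)"
      by (simp add: sum_distrib_left[symmetric] mult.assoc)
  qed
  ultimately have dZ: "(?Z has_derivative (\<lambda>h. \<beta> * ?Z x * (gibbs_mean Y \<beta> c x \<bullet> h))) (at x)" by simp
  show ?thesis
    unfolding gibbs_def[abs_def]
    by (rule has_derivative_eq_rhs[OF has_derivative_divide'[OF E dZ Z]])
       (use Z in \<open>auto simp: fun_eq_iff inner_diff_left field_simps\<close>)
qed

text \<open>The Hessian of the potential is \<open>\<beta>\<close> times the covariance of the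
  slopes under the Gibbs weights. The outer factor may be centred as well because the centred first
  moment vanishes; this exhibits the Hessian as a sum of squares.\<close>

lemma gibbs_mean_has_derivative:
  assumes "finite Y" "Y \<noteq> {}"
  shows "(gibbs_mean Y \<beta> c has_derivative
     (\<lambda>h. \<Sum>y\<in>Y. (\<beta> * gibbs Y \<beta> c x y * ((y - gibbs_mean Y \<beta> c x) \<bullet> h)) *\<^sub>R (y - gibbs_mean Y \<beta> c x))) (at x)"
proof -
  let ?m = "gibbs_mean Y \<beta> c x"
  have "((\<lambda>x. \<Sum>y\<in>Y. gibbs Y \<beta> c x y *\<^sub>R y) has_derivative
     (\<lambda>h. \<Sum>y\<in>Y. (\<beta> * gibbs Y \<beta> c x y * ((y - ?m) \<bullet> h)) *\<^sub>R y)) (at x)"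
    by (intro has_derivative_sum has_derivative_scaleR_left gibbs_has_derivative[OF assms])
  moreover have "gibbs_mean Y \<beta> c = (\<lambda>x. \<Sum>y\<in>Y. gibbs Y \<beta> c x y *\<^sub>R y)"
    by (simp add: fun_eq_iff gibbs_mean_def)
  moreover have "(\<Sum>y\<in>Y. (\<beta> * gibbs Y \<beta> c x y * ((y - ?m) \<bullet> h)) *\<^sub>R ?m) = 0" for h
  proof -
    have "(\<Sum>y\<in>Y. \<beta> * gibbs Y \<beta> c x y * ((y - ?m) \<bullet> h)) =
       \<beta> * ((\<Sum>y\<in>Y. gibbs Y \<beta> c x y *\<^sub>R (y - ?m)) \<bullet> h)"
      by (simp add: inner_sum_left sum_distrib_left mult.assoc)
    then show ?thesis
      by (simp add: scaleR_left.sum[symmetric] sum_gibbs_centered[OF assms])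
  qed
  ultimately show ?thesis by (simp add: scaleR_diff_right sum_subtractf)
qed

lemma gibbs_mean_component_has_derivative:
  fixes Y :: "(real^'n) set"
  assumes "finite Y" "Y \<noteq> {}"
  shows "((\<lambda>x. gibbs_mean Y \<beta> c x $ i) has_derivative
     (\<lambda>h. \<Sum>y\<in>Y. (\<beta> * gibbs Y \<beta> c x y * ((y - gibbs_mean Y \<beta> c x) \<bullet> h)) * (y - gibbs_mean Y \<beta> c x) $ i)) (at x)"
  using bounded_linear.has_derivative[OF bounded_linear_vec_nth gibbs_mean_has_derivative[OF assms]]
  by (simp add: sum_component)

lemma partial_deriv_gibbs_mean:
  fixes Y :: "(real^'n) set"
  assumes "finite Y" "Y \<noteq> {}"
  shows "partial_deriv j (\<lambda>x. gibbs_mean Y \<beta> c x $ i) x =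
     \<beta> * (\<Sum>y\<in>Y. gibbs Y \<beta> c x y * ((y - gibbs_mean Y \<beta> c x) $ i * (y - gibbs_mean Y \<beta> c x) $ j))"
  by (simp add: partial_deriv_eq[OF gibbs_mean_component_has_derivative[OF assms]]
     inner_axis sum_distrib_left mult_ac)

text \<open>This is the form in which the divergence meets the potential: row \<open>i\<close> of
  the matrix is tested against component \<open>i\<close> of the gradient.\<close>

lemma gibbs_trace_eq:
  fixes Y :: "(real^'n) set"
  assumes "finite Y" "Y \<noteq> {}"
  shows "gibbs_trace Y \<beta> c x M =
    (\<Sum>i\<in>UNIV. \<Sum>j\<in>UNIV. M $ i $ j * partial_deriv j (\<lambda>x. gibbs_mean Y \<beta> c x $ i) x)"
proof -
  let ?v = "\<lambda>y. y - gibbs_mean Y \<beta> c x"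
  have "(\<Sum>i\<in>UNIV. \<Sum>j\<in>UNIV. M $ i $ j * partial_deriv j (\<lambda>x. gibbs_mean Y \<beta> c x $ i) x)
    = (\<Sum>i\<in>UNIV. \<Sum>j\<in>UNIV. \<Sum>y\<in>Y. \<beta> * (gibbs Y \<beta> c x y * (?v y $ i * (M $ i $ j * ?v y $ j))))"
    unfolding partial_deriv_gibbs_mean[OF assms] sum_distrib_left by (simp add: mult_ac)
  also have "\<dots> = (\<Sum>i\<in>UNIV. \<Sum>y\<in>Y. \<Sum>j\<in>UNIV. \<beta> * (gibbs Y \<beta> c x y * (?v y $ i * (M $ i $ j * ?v y $ j))))"
    by (intro sum.cong refl sum.swap)
  also have "\<dots> = (\<Sum>y\<in>Y. \<Sum>i\<in>UNIV. \<Sum>j\<in>UNIV. \<beta> * (gibbs Y \<beta> c x y * (?v y $ i * (M $ i $ j * ?v y $ j))))"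
    by (rule sum.swap)
  also have "\<dots> = gibbs_trace Y \<beta> c x M"
    by (simp add: gibbs_trace_def matrix_vector_mult_def inner_vec_def sum_distrib_left)
  finally show ?thesis by simp
qed

lemma gibbs_trace_nonneg:
  assumes "0 \<le> \<beta>" "\<And>v. 0 \<le> v \<bullet> (M *v v)"
  shows "0 \<le> gibbs_trace Y \<beta> c x M"
  unfolding gibbs_trace_def by (intro mult_nonneg_nonneg sum_nonneg assms gibbs_nonneg)

text \<open>The covariance is a nonnegative combination of rank one forms. This is what allows a
  field to be replaced on an ellipsoid by a smaller constant matrix.\<close>

lemma gibbs_trace_mono:
  assumes "0 \<le> \<beta>" "\<And>v. v \<bullet> (M *v v) \<le> v \<bullet> (N *v v)"
  shows "gibbs_trace Y \<beta> c x M \<le> gibbs_trace Y \<beta> c x N"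
  unfolding gibbs_trace_def by (intro mult_left_mono sum_mono assms gibbs_nonneg)

lemma linear_gibbs_trace: "linear (gibbs_trace Y \<beta> c x)"
  unfolding gibbs_trace_def
  by (rule linearI)
     (simp_all add: matrix_vector_mult_add_rdistrib scaleR_matrix_vector_assoc[symmetric] inner_add_right
        distrib_left sum.distrib sum_distrib_left mult_ac)

lemma continuous_on_gibbs_mean:
  assumes "finite Y" "Y \<noteq> {}"
  shows "continuous_on S (gibbs_mean Y \<beta> c)"
  using gibbs_mean_has_derivative[OF assms]
  by (meson continuous_at_imp_continuous_on has_derivative_continuous)

lemma continuous_on_partial_deriv_gibbs_mean:
  fixes Y :: "(real^'n) set"
  assumes "finite Y" "Y \<noteq> {}"
  shows "continuous_on S (partial_deriv j (\<lambda>x. gibbs_mean Y \<beta> c x $ i))"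
proof -
  have "continuous_on S (\<lambda>x. gibbs Y \<beta> c x y)" for y
    using gibbs_has_derivative[OF assms]
    by (meson continuous_at_imp_continuous_on has_derivative_continuous)
  then show ?thesis
    unfolding partial_deriv_gibbs_mean[OF assms, abs_def]
    by (intro continuous_intros continuous_on_gibbs_mean[OF assms])
qed

text \<open>This bound grows with \<open>\<beta>\<close> and is used for integrability only; the
  quantitative estimates retain \<open>R\<close> alone.\<close>

lemma partial_deriv_gibbs_mean_bound:
  fixes Y :: "(real^'n) set"
  assumes "finite Y" "Y \<noteq> {}" "\<And>y i. y \<in> Y \<Longrightarrow> \<bar>y $ i\<bar> \<le> R"
  shows "\<bar>partial_deriv j (\<lambda>x. gibbs_mean Y \<beta> c x $ i) x\<bar> \<le> \<bar>\<beta>\<bar> * (2 * R)\<^sup>2"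
proof -
  let ?v = "\<lambda>y. y - gibbs_mean Y \<beta> c x"
  have v: "\<bar>?v y $ i\<bar> \<le> 2 * R" if "y \<in> Y" for y i
    using assms(3)[OF that, of i] gibbs_mean_component_bound[OF assms(1,2), of i R \<beta> c x] assms(3)
    by auto
  have vv: "\<bar>?v y $ i * ?v y $ j\<bar> \<le> (2 * R) * (2 * R)" if "y \<in> Y" for y
    unfolding abs_mult by (intro mult_mono' v that) auto
  have "\<bar>\<Sum>y\<in>Y. gibbs Y \<beta> c x y * (?v y $ i * ?v y $ j)\<bar> \<le> (\<Sum>y\<in>Y. gibbs Y \<beta> c x y * ((2 * R) * (2 * R)))"
  proof (intro order.trans[OF sum_abs] sum_mono)
    fix y assume "y \<in> Y"
    from mult_left_mono[OF vv[OF this] gibbs_nonneg[of Y \<beta> c x y]]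
    show "\<bar>gibbs Y \<beta> c x y * (?v y $ i * ?v y $ j)\<bar> \<le> gibbs Y \<beta> c x y * ((2 * R) * (2 * R))"
      by (simp only: abs_mult[of "gibbs Y \<beta> c x y"] abs_of_nonneg[OF gibbs_nonneg])
  qed
  also have "\<dots> = (2 * R)\<^sup>2"
    using assms by (simp add: sum_distrib_right[symmetric] sum_gibbs power2_eq_square)
  finally show ?thesis
    unfolding partial_deriv_gibbs_mean[OF assms(1,2)] abs_mult by (intro mult_left_mono) auto
qed

lemma Ck_fun_gibbs_mean:
  fixes Y :: "(real^'n) set"
  assumes "finite Y" "Y \<noteq> {}"
  shows "(\<lambda>x. gibbs_mean Y \<beta> c x $ i) \<in> Ck_fun k"
proof -
  have E: "(\<lambda>x. exp (\<beta> * (x \<bullet> y - c y))) \<in> Ck_fun k" for y :: "real^'n"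
    using Ck_fun_compose[of "\<lambda>n. exp", OF DERIV_exp,
      OF Ck_fun_mult[OF Ck_fun_const[of \<beta>] Ck_fun_add[OF Ck_fun_inner Ck_fun_const[of "- c y"]]]]
    by simp
  have Z: "gibbs_Z Y \<beta> c x \<noteq> 0" for x using gibbs_Z_pos[OF assms, of \<beta> c x] by simp
  have "(\<lambda>x. \<Sum>y\<in>Y. (exp (\<beta> * (x \<bullet> y - c y)) * inverse (gibbs_Z Y \<beta> c x)) * y $ i) \<in> Ck_fun k"
    by (intro Ck_fun_sum Ck_fun_mult E Ck_fun_const Ck_fun_inverse Z)
       (auto simp: gibbs_Z_def[abs_def] intro!: Ck_fun_sum E)
  then show ?thesis
    by (simp add: gibbs_mean_def sum_component gibbs_def divide_inverse)
qed

text \<open>Translating the argument only changes the intercepts, not the slopes. An estimate that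
  is uniform in \<open>c\<close> therefore survives averaging over translates.\<close>

lemma gibbs_translate:
  "gibbs Y \<beta> c (x - z) = gibbs Y \<beta> (\<lambda>y. c y + z \<bullet> y) x"
  "gibbs_mean Y \<beta> c (x - z) = gibbs_mean Y \<beta> (\<lambda>y. c y + z \<bullet> y) x"
proof -
  show *: "gibbs Y \<beta> c (x - z) = gibbs Y \<beta> (\<lambda>y. c y + z \<bullet> y) x"
    by (simp add: fun_eq_iff gibbs_def gibbs_Z_def inner_diff_left algebra_simps)
  show "gibbs_mean Y \<beta> c (x - z) = gibbs_mean Y \<beta> (\<lambda>y. c y + z \<bullet> y) x"
    by (simp add: gibbs_mean_def *)
qed

lemma gibbs_trace_translate:
  "gibbs_trace Y \<beta> c (x - z) M = gibbs_trace Y \<beta> (\<lambda>y. c y + z \<bullet> y) x M"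
  by (simp add: gibbs_trace_def gibbs_translate)

section \<open>The log-sum-exp potential: distance from the maximum, and convexity\<close>

definition soft_max :: "'a::real_inner set \<Rightarrow> real \<Rightarrow> ('a \<Rightarrow> real) \<Rightarrow> 'a \<Rightarrow> real" where
  "soft_max Y \<beta> c x = ln (gibbs_Z Y \<beta> c x) / \<beta>"

lemma soft_max_ge:
  assumes "finite Y" "y \<in> Y" "0 < \<beta>"
  shows "x \<bullet> y - c y \<le> soft_max Y \<beta> c x"
proof -
  have "exp (\<beta> * (x \<bullet> y - c y)) \<le> gibbs_Z Y \<beta> c x"
    unfolding gibbs_Z_def using assms by (intro member_le_sum) auto
  moreover have "0 < gibbs_Z Y \<beta> c x" using assms by (intro gibbs_Z_pos) auto
  ultimately have "\<beta> * (x \<bullet> y - c y) \<le> ln (gibbs_Z Y \<beta> c x)" by (simp add: ln_ge_iff)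
  then show ?thesis using assms by (simp add: soft_max_def field_simps)
qed

text \<open>A sum of \<open>card Y\<close> exponentials is at most \<open>card Y\<close> times the
  largest one. For fixed \<open>Y\<close> the overshoot above the maximum is thus made small by the
  choice of \<open>\<beta>\<close>.\<close>

lemma soft_max_le:
  assumes "finite Y" "Y \<noteq> {}" "0 < \<beta>" "\<And>y. y \<in> Y \<Longrightarrow> x \<bullet> y - c y \<le> m"
  shows "soft_max Y \<beta> c x \<le> m + ln (card Y) / \<beta>"
proof -
  have "gibbs_Z Y \<beta> c x \<le> (\<Sum>y\<in>Y. exp (\<beta> * m))"
    unfolding gibbs_Z_def using assms by (intro sum_mono) auto
  then have "ln (gibbs_Z Y \<beta> c x) \<le> ln (card Y * exp (\<beta> * m))"
    using gibbs_Z_pos[OF assms(1,2), of \<beta> c x] by simp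
  also have "\<dots> = ln (card Y) + \<beta> * m"
    using assms by (simp add: ln_mult card_gt_0_iff)
  finally show ?thesis using assms by (simp add: soft_max_def field_simps)
qed

text \<open>Convexity by Jensen's inequality: the quotient of the partition functions at
  \<open>x'\<close> and \<open>x\<close> is the Gibbs average of
  \<open>exp (\<beta> * ((x' - x) \<bullet> y))\<close>, and the tangent line of \<open>exp\<close>
  at the mean exponent \<open>m\<close> bounds it below by \<open>exp m\<close>.\<close>

lemma soft_max_gradient_ineq:
  assumes "finite Y" "Y \<noteq> {}" "0 < \<beta>"
  shows "soft_max Y \<beta> c x - soft_max Y \<beta> c x' \<le> (x - x') \<bullet> gibbs_mean Y \<beta> c x"
proof -
  let ?Z = "gibbs_Z Y \<beta> c" and ?p = "gibbs Y \<beta> c x"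
  have Z: "0 < ?Z x" "0 < ?Z x'" using gibbs_Z_pos[OF assms(1,2)] by auto
  define m where "m = \<beta> * ((x' - x) \<bullet> gibbs_mean Y \<beta> c x)"
  have "?Z x' = ?Z x * (\<Sum>y\<in>Y. ?p y * exp (\<beta> * ((x' - x) \<bullet> y)))"
    using Z unfolding sum_distrib_left gibbs_def gibbs_Z_def[of Y \<beta> c x']
    by (intro sum.cong) (auto simp: exp_add[symmetric] inner_diff_left algebra_simps)
  moreover have "exp m \<le> (\<Sum>y\<in>Y. ?p y * exp (\<beta> * ((x' - x) \<bullet> y)))"
  proof -
    have "exp m = (\<Sum>y\<in>Y. ?p y * (exp m * (1 + (\<beta> * ((x' - x) \<bullet> y) - m))))"
    proof -
      have "(\<Sum>y\<in>Y. ?p y * (\<beta> * ((x' - x) \<bullet> y))) = m"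
        by (simp add: m_def gibbs_mean_def inner_sum_right sum_distrib_left mult_ac)
      then have "(\<Sum>y\<in>Y. ?p y * (1 + (\<beta> * ((x' - x) \<bullet> y) - m))) = 1"
        by (simp add: distrib_left right_diff_distrib sum.distrib sum_subtractf
            sum_distrib_right[symmetric] sum_gibbs[OF assms(1,2)])
      then have "exp m = exp m * (\<Sum>y\<in>Y. ?p y * (1 + (\<beta> * ((x' - x) \<bullet> y) - m)))" by simp
      then show ?thesis by (simp add: sum_distrib_left mult_ac)
    qed
    also have "\<dots> \<le> (\<Sum>y\<in>Y. ?p y * (exp m * exp (\<beta> * ((x' - x) \<bullet> y) - m)))"
      by (intro sum_mono mult_left_mono gibbs_nonneg exp_ge_add_one_self) auto
    also have "\<dots> = (\<Sum>y\<in>Y. ?p y * exp (\<beta> * ((x' - x) \<bullet> y)))"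
      by (simp add: exp_add[symmetric])
    finally show ?thesis .
  qed
  ultimately have "?Z x * exp m \<le> ?Z x'" using Z by simp
  then have "ln (?Z x * exp m) \<le> ln (?Z x')" using Z by (subst ln_le_cancel_iff) auto
  then have "ln (?Z x) + m \<le> ln (?Z x')" using Z by (simp add: ln_mult)
  then have "(ln (?Z x) - ln (?Z x')) \<le> \<beta> * ((x - x') \<bullet> gibbs_mean Y \<beta> c x)"
    by (simp add: m_def inner_diff_left algebra_simps)
  then show ?thesis using assms(3) by (simp add: soft_max_def field_simps)
qed

section \<open>Localisation\<close>

text \<open>The squared norm keeps the argument of \<open>bump\<close> polynomial, so smoothness
  holds at the centre as well.\<close>

definition cutoff :: "real^'n \<Rightarrow> real \<Rightarrow> real^'n \<Rightarrow> real" where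
  "cutoff x0 r x = bump (r\<^sup>2 - (norm (x - x0))\<^sup>2)"

lemma cutoff_bounds: "0 \<le> cutoff x0 r x" "cutoff x0 r x \<le> 1"
  by (simp_all add: cutoff_def bump_bounds)

lemma cutoff_outside: "0 \<le> r \<Longrightarrow> x \<notin> cball x0 r \<Longrightarrow> cutoff x0 r x = 0"
  unfolding cutoff_def by (rule bump_bounds) (auto simp: dist_norm norm_minus_commute)

lemma Ck_fun_cutoff: "cutoff x0 r \<in> Ck_fun k"
proof -
  have "(\<lambda>x. bump (r\<^sup>2 + (-1) * (\<Sum>i\<in>UNIV. (x \<bullet> axis i 1 + - x0 $ i) * (x \<bullet> axis i 1 + - x0 $ i)))) \<in> Ck_fun k"
    by (intro Ck_fun_bump Ck_fun_add Ck_fun_const Ck_fun_mult Ck_fun_sum Ck_fun_inner)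
  moreover have "(\<Sum>i\<in>UNIV. (x \<bullet> axis i 1 + - x0 $ i) * (x \<bullet> axis i 1 + - x0 $ i)) = (norm (x - x0))\<^sup>2" for x
    unfolding power2_norm_eq_inner by (simp add: inner_vec_def[of "x - x0"] inner_axis)
  ultimately show ?thesis by (simp add: cutoff_def[abs_def])
qed

lemma partial_deriv_zero_off_closed:
  assumes "closed K" "x \<notin> K" "\<And>x. x \<notin> K \<Longrightarrow> f x = 0"
  shows "partial_deriv j f x = 0"
proof -
  have "(f has_derivative (\<lambda>h. 0)) (at x)"
    by (rule has_derivative_transform_within_open[where s = "- K" and f = "\<lambda>_. 0"])
       (use assms in auto)
  then show ?thesis by (simp add: partial_deriv_eq)
qed

lemma bounded_partial_deriv_compact_support:
  assumes "f \<in> Ck_fun (Suc 0)" "compact K" "\<And>x. x \<notin> K \<Longrightarrow> f x = 0"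
  obtains B where "0 \<le> B" "\<And>x j. \<bar>partial_deriv j f x\<bar> \<le> B"
proof -
  have "\<exists>B\<ge>0. \<forall>x. \<bar>partial_deriv j f x\<bar> \<le> B" for j
  proof -
    have "continuous_on K (partial_deriv j f)"
      using assms(1) by (auto intro: continuous_on_subset)
    then have "bounded (partial_deriv j f ` K)"
      using assms(2) compact_continuous_image compact_imp_bounded by blast
    then obtain B where "B > 0" and B: "\<And>x. x \<in> K \<Longrightarrow> \<bar>partial_deriv j f x\<bar> \<le> B"
      by (auto simp: bounded_pos)
    have "\<bar>partial_deriv j f x\<bar> \<le> B" for x
      using B[of x] \<open>B > 0\<close> partial_deriv_zero_off_closed[OF compact_imp_closed[OF assms(2)], of x f j] assms(3)
      by (cases "x \<in> K") auto
    then show ?thesis using \<open>B > 0\<close> by (intro exI[of _ B]) auto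
  qed
  then obtain B where B: "\<And>j. 0 \<le> B j" "\<And>j x. \<bar>partial_deriv j f x\<bar> \<le> B j" by metis
  show ?thesis
  proof (rule that)
    show "0 \<le> (\<Sum>j\<in>UNIV. B j)" by (intro sum_nonneg B)
    have "B j \<le> (\<Sum>j\<in>UNIV. B j)" for j by (rule member_le_sum) (auto simp: B)
    then show "\<bar>partial_deriv j f x\<bar> \<le> (\<Sum>j\<in>UNIV. B j)" for x j
      using B(2)[of j x] order.trans by blast
  qed
qed

lemma integrable_scaleR_bounded:
  fixes f :: "'a \<Rightarrow> 'b::{banach, second_countable_topology}"
  assumes "integrable M f" "g \<in> borel_measurable M" "\<And>x. \<bar>g x\<bar> \<le> B"
  shows "integrable M (\<lambda>x. g x *\<^sub>R f x)" "norm (LINT x|M. g x *\<^sub>R f x) \<le> B * (LINT x|M. norm (f x))"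
proof -
  have B: "norm (g x *\<^sub>R f x) \<le> B * norm (f x)" for x
    using mult_right_mono[OF assms(3)[of x] norm_ge_zero[of "f x"]] by simp
  show 1: "integrable M (\<lambda>x. g x *\<^sub>R f x)"
    by (rule Bochner_Integration.integrable_bound[of _ "\<lambda>x. B * norm (f x)"])
       (use assms in \<open>auto intro!: AE_I2 order.trans[OF B[simplified]]\<close>)
  have "norm (LINT x|M. g x *\<^sub>R f x) \<le> (LINT x|M. norm (g x *\<^sub>R f x))" by (rule integral_norm_bound)
  also have "\<dots> \<le> (LINT x|M. B * norm (f x))"
    by (intro integral_mono integrable_norm 1 integrable_mult_right assms(1) B)
  finally show "norm (LINT x|M. g x *\<^sub>R f x) \<le> B * (LINT x|M. norm (f x))" by simp
qed

lemma integrable_mult_cutoff: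
  assumes "f absolutely_integrable_on (cball x0 r)" "0 \<le> r"
  shows "integrable lebesgue (\<lambda>x. cutoff x0 r x * f x)"
proof -
  have "continuous_on UNIV (cutoff x0 r)" using Ck_fun_cutoff[of x0 r 0] by simp
  then have "cutoff x0 r \<in> borel_measurable lebesgue"
    by (simp add: borel_measurable_continuous_onI measurable_completion)
  from integrable_scaleR_bounded(1)[OF assms(1)[unfolded set_integrable_def] this, of 1]
  have "integrable lebesgue (\<lambda>x. cutoff x0 r x * (indicator (cball x0 r) x * f x))"
    using cutoff_bounds[of x0 r] by (simp add: abs_of_nonneg)
  moreover have "(\<lambda>x. cutoff x0 r x * (indicator (cball x0 r) x * f x)) = (\<lambda>x. cutoff x0 r x * f x)"
  proof
    show "cutoff x0 r x * (indicator (cball x0 r) x * f x) = cutoff x0 r x * f x" for x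
      using cutoff_outside[OF assms(2), of x x0] by (cases "x \<in> cball x0 r") auto
  qed
  ultimately show ?thesis by (simp only:)
qed

text \<open>The test function is \<open>\<chi> \<nabla>\<phi>\<close>; moving the derivative off the cutoff \<open>\<chi>\<close> costs only the \<open>L\<^sup>1\<close> norm of \<open>A\<close>.\<close>
lemma cutoff_trace_bound:
  fixes A :: "real^'n \<Rightarrow> real^'n^'n"
  assumes "\<forall>i j. locally_L1 (\<lambda>x. A x $ i $ j) \<Omega>" "div_locally_measure A \<Omega>"
    and "0 < r" "cball x0 r \<subseteq> \<Omega>"
  obtains C where "0 \<le> C"
    "\<And>Y \<beta> c R. \<lbrakk>finite Y; Y \<noteq> {}; \<And>y i. y \<in> Y \<Longrightarrow> \<bar>y $ i\<bar> \<le> R\<rbrakk> \<Longrightarrow>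
      integrable lebesgue (\<lambda>x. gibbs_trace Y \<beta> c x (cutoff x0 r x *\<^sub>R A x)) \<and>
      (LINT x|lebesgue. gibbs_trace Y \<beta> c x (cutoff x0 r x *\<^sub>R A x)) \<le> C * R"
proof -
  let ?K = "cball x0 r" and ?\<chi> = "cutoff x0 r"
  have AK: "(\<lambda>x. A x $ i $ j) absolutely_integrable_on ?K" for i j
    using assms(1,4) by (auto simp: locally_L1_def)
  obtain C0 where C0: "\<And>\<phi> i. test_fun_in ?K \<phi> \<Longrightarrow>
      \<bar>\<Sum>j\<in>UNIV. integral \<Omega> (\<lambda>x. A x $ i $ j * partial_deriv j \<phi> x)\<bar> \<le> C0 * (SUP x. \<bar>\<phi> x\<bar>)"
    using assms(2,4) unfolding div_locally_measure_def by (meson compact_cball)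
  have \<chi>0: "?\<chi> x = 0" if "x \<notin> ?K" for x using cutoff_outside[OF _ that] assms(3) by simp
  obtain B where B: "0 \<le> B" "\<And>x j. \<bar>partial_deriv j ?\<chi> x\<bar> \<le> B"
    using bounded_partial_deriv_compact_support[OF Ck_fun_cutoff compact_cball \<chi>0] by blast
  let ?a = "\<lambda>i j x. indicator ?K x * A x $ i $ j"
  have a: "integrable lebesgue (?a i j)" for i j
    using AK[of i j] by (simp add: set_integrable_def)
  have mC: "f \<in> borel_measurable lebesgue" if "f \<in> Ck_fun 0" for f :: "real^'n \<Rightarrow> real"
    using that by (simp add: borel_measurable_continuous_onI measurable_completion)
  \<comment> \<open>For each row, \<open>\<bar>C0\<bar>\<close> pays for the divergence and the
    inner sum for the term in which the derivative falls on the cutoff. The absolute value is taken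
    because the sign of \<open>C0\<close> is not known.\<close>
  define C where "C = (\<Sum>i\<in>UNIV. \<bar>C0\<bar> + (\<Sum>j\<in>UNIV. B * (LINT x|lebesgue. \<bar>?a i j x\<bar>)))"
  show ?thesis
  proof (rule that[of C])
    show "0 \<le> C" unfolding C_def
      by (intro sum_nonneg add_nonneg_nonneg mult_nonneg_nonneg B integral_nonneg_AE) auto
    fix Y :: "(real^'n) set" and \<beta> R :: real and c
    assume Y: "finite Y" "Y \<noteq> {}" and R: "\<And>y i. y \<in> Y \<Longrightarrow> \<bar>y $ i\<bar> \<le> R"
    let ?T = "\<lambda>i x. gibbs_mean Y \<beta> c x $ i"
    have R0: "0 \<le> R" using Y R by (metis abs_ge_zero ex_in_conv order.trans)
    have T: "\<bar>?T i x\<bar> \<le> R" for i x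
      by (rule gibbs_mean_component_bound[OF Y R])
    let ?\<phi> = "\<lambda>i x. ?\<chi> x * ?T i x"
    have sm: "smooth_fun (?\<phi> i)" for i
      unfolding smooth_fun_def by (intro allI Ck_fun_mult Ck_fun_cutoff Ck_fun_gibbs_mean Y)
    have sup: "closure {x. ?\<phi> i x \<noteq> 0} \<subseteq> ?K" for i
    proof (rule closure_minimal)
      show "{x. ?\<phi> i x \<noteq> 0} \<subseteq> ?K"
      proof (rule subsetI, rule ccontr)
        fix x assume "x \<in> {x. ?\<phi> i x \<noteq> 0}" "x \<notin> ?K"
        with \<chi>0[OF this(2)] show False by simp
      qed
    qed (rule closed_cball)
    have test: "test_fun_in ?K (?\<phi> i)" for i
      using sm sup by (simp add: test_fun_in_def)
    have \<chi>1: "\<bar>?\<chi> x\<bar> \<le> 1" for x using cutoff_bounds[of x0 r x] by simp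
    \<comment> \<open>The decisive point: the sup norm of the test function is at most
      \<open>R\<close>, whatever \<open>\<beta>\<close>, \<open>c\<close> and the number of slopes
      are.\<close>
    have \<phi>R: "\<bar>?\<phi> i x\<bar> \<le> R" for i x
      using mult_mono[OF \<chi>1[of x] T[of x i]] by (simp add: abs_mult)
    have "C0 * (SUP x. \<bar>?\<phi> i x\<bar>) \<le> \<bar>C0\<bar> * R" for i
    proof -
      have "bdd_above (range (\<lambda>x. \<bar>?\<phi> i x\<bar>))" using \<phi>R by (meson bdd_above.I2)
      then have "0 \<le> (SUP x. \<bar>?\<phi> i x\<bar>)" by (meson UNIV_I abs_ge_zero cSUP_upper2)
      moreover have "(SUP x. \<bar>?\<phi> i x\<bar>) \<le> R" by (rule cSUP_least) (auto simp: \<phi>R)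
      ultimately show ?thesis
        by (meson abs_ge_self abs_ge_zero mult_mono)
    qed
    then have div: "(\<Sum>j\<in>UNIV. integral \<Omega> (\<lambda>x. A x $ i $ j * partial_deriv j (?\<phi> i) x)) \<le> \<bar>C0\<bar> * R" for i
      using C0[OF test[of i], of i] by (meson abs_le_D1 order.trans)
    have p\<phi>: "partial_deriv j (?\<phi> i) x = ?\<chi> x * partial_deriv j (?T i) x + partial_deriv j ?\<chi> x * ?T i x" for i j x
      using partial_deriv_eq[OF has_derivative_mult[OF
          Ck_fun_SucE(1)[OF Ck_fun_cutoff[of x0 r "Suc 0"]] Ck_fun_SucE(1)[OF Ck_fun_gibbs_mean[OF Y, of \<beta> c i "Suc 0"]]], of j x]
      by (simp add: partial_deriv_def)
    have m\<chi>: "?\<chi> \<in> borel_measurable lebesgue" "partial_deriv j ?\<chi> \<in> borel_measurable lebesgue" for j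
      using Ck_fun_cutoff[of x0 r 0] Ck_fun_SucE(2)[OF Ck_fun_cutoff[of x0 r "Suc 0"]] by (blast intro: mC)+
    have mT: "?T i \<in> borel_measurable lebesgue" "partial_deriv j (?T i) \<in> borel_measurable lebesgue" for i j
      using Ck_fun_gibbs_mean[OF Y, of \<beta> c i 0]
        Ck_fun_SucE(2)[OF Ck_fun_gibbs_mean[OF Y, of \<beta> c i "Suc 0"]] by (blast intro: mC)+
    have \<chi>D: "\<bar>?\<chi> x * partial_deriv j (?T i) x\<bar> \<le> \<bar>\<beta>\<bar> * (2 * R)\<^sup>2" for i j x
      using mult_mono[OF \<chi>1[of x] partial_deriv_gibbs_mean_bound[OF Y R, where j = j and \<beta> = \<beta> and c = c and i = i and x = x]]
      by (simp add: abs_mult)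
    have D\<chi>: "\<bar>partial_deriv j ?\<chi> x * ?T i x\<bar> \<le> B * R" for i j x
      using mult_mono[OF B(2)[of j x] T[of x i]] B(1) by (simp add: abs_mult)
    let ?f = "\<lambda>i j x. (?\<chi> x * partial_deriv j (?T i) x) * ?a i j x"
      and ?g = "\<lambda>i j x. (partial_deriv j ?\<chi> x * ?T i x) * ?a i j x"
    have i1: "integrable lebesgue (\<lambda>x. ?f i j x)" for i j
      by (rule integrable_scaleR_bounded(1)[OF a _ \<chi>D, unfolded real_scaleR_def]) (intro borel_measurable_times m\<chi> mT)
    have i2: "integrable lebesgue (\<lambda>x. ?g i j x)"
       "\<bar>LINT x|lebesgue. ?g i j x\<bar> \<le> B * R * (LINT x|lebesgue. \<bar>?a i j x\<bar>)" for i j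
      by (rule integrable_scaleR_bounded[OF a _ D\<chi>, unfolded real_scaleR_def real_norm_def]; intro borel_measurable_times m\<chi> mT)+
    have eq: "integral \<Omega> (\<lambda>x. A x $ i $ j * partial_deriv j (?\<phi> i) x) =
       (LINT x|lebesgue. ?f i j x) +
       (LINT x|lebesgue. ?g i j x)" for i j
    proof -
      \<comment> \<open>Off the ball the derivative of the test function vanishes, so the integral
        over \<open>\<Omega>\<close> sees only the entries truncated to the ball.\<close>
      have pz: "partial_deriv j (?\<phi> i) x = 0" if "x \<notin> ?K" for x
        by (rule partial_deriv_zero_off_closed[OF closed_cball that]) (simp add: \<chi>0)
      have "integral \<Omega> (\<lambda>x. A x $ i $ j * partial_deriv j (?\<phi> i) x)
        = integral UNIV (\<lambda>x. if x \<in> \<Omega> then A x $ i $ j * partial_deriv j (?\<phi> i) x else 0)"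
        by (rule integral_restrict_UNIV[symmetric])
      also have "(\<lambda>x. if x \<in> \<Omega> then A x $ i $ j * partial_deriv j (?\<phi> i) x else 0) =
          (\<lambda>x. ?f i j x + ?g i j x)"
      proof
        fix x
        show "(if x \<in> \<Omega> then A x $ i $ j * partial_deriv j (?\<phi> i) x else 0) =
          ?f i j x + ?g i j x"
          using assms(4) pz[of x] p\<phi>[of j i x] by (cases "x \<in> ?K") (auto simp: algebra_simps)
      qed
      also have "integral UNIV \<dots> = (LINT x|lebesgue. ?f i j x + ?g i j x)"
        by (intro integral_unique has_integral_integral_lebesgue Bochner_Integration.integrable_add i1 i2)
      finally show ?thesis using i1 i2 by simp
    qed
    have tr: "gibbs_trace Y \<beta> c x (?\<chi> x *\<^sub>R A x) =
       (\<Sum>i\<in>UNIV. \<Sum>j\<in>UNIV. ?f i j x)" for x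
      unfolding gibbs_trace_eq[OF Y] using \<chi>0[of x] by (cases "x \<in> ?K") (auto simp: mult_ac)
    have int: "integrable lebesgue (\<lambda>x. gibbs_trace Y \<beta> c x (?\<chi> x *\<^sub>R A x))"
      unfolding tr using i1 by auto
    have "(LINT x|lebesgue. gibbs_trace Y \<beta> c x (?\<chi> x *\<^sub>R A x)) =
       (\<Sum>i\<in>UNIV. \<Sum>j\<in>UNIV. LINT x|lebesgue. ?f i j x)"
      unfolding tr using i1 by (simp add: Bochner_Integration.integral_sum)
    also have "\<dots> = (\<Sum>i\<in>UNIV. \<Sum>j\<in>UNIV. integral \<Omega> (\<lambda>x. A x $ i $ j * partial_deriv j (?\<phi> i) x)
          - (LINT x|lebesgue. ?g i j x))"
      unfolding eq by simp
    also have "\<dots> \<le> (\<Sum>i\<in>UNIV. \<bar>C0\<bar> * R + (\<Sum>j\<in>UNIV. B * R * (LINT x|lebesgue. \<bar>?a i j x\<bar>)))"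
    proof (rule sum_mono)
      fix i
      have "- (LINT x|lebesgue. ?g i j x) \<le> B * R * (LINT x|lebesgue. \<bar>?a i j x\<bar>)" for j
        using i2(2)[of j i] by linarith
      then have "(\<Sum>j\<in>UNIV. - (LINT x|lebesgue. ?g i j x)) \<le>
          (\<Sum>j\<in>UNIV. B * R * (LINT x|lebesgue. \<bar>?a i j x\<bar>))" by (intro sum_mono)
      then show "(\<Sum>j\<in>UNIV. integral \<Omega> (\<lambda>x. A x $ i $ j * partial_deriv j (?\<phi> i) x)
          - (LINT x|lebesgue. ?g i j x)) \<le>
          \<bar>C0\<bar> * R + (\<Sum>j\<in>UNIV. B * R * (LINT x|lebesgue. \<bar>?a i j x\<bar>))"
        using div[of i] by (simp only: sum_subtractf sum_negf)
    qed
    also have "\<dots> = C * R"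
      by (simp add: C_def sum_distrib_left sum_distrib_right distrib_left mult_ac)
    finally show "integrable lebesgue (\<lambda>x. gibbs_trace Y \<beta> c x (?\<chi> x *\<^sub>R A x)) \<and>
      (LINT x|lebesgue. gibbs_trace Y \<beta> c x (?\<chi> x *\<^sub>R A x)) \<le> C * R" using int by simp
  qed
qed

text \<open>The outcome of localisation as a property of the field alone. Uniformity in
  \<open>c\<close> yields invariance under translation, and uniformity in \<open>\<beta>\<close>
  permits arbitrarily sharp kinks. The integral is extended-real valued, which spares integrability
  conditions.\<close>

definition trace_bounded :: "(real^'n \<Rightarrow> real^'n^'n) \<Rightarrow> real \<Rightarrow> bool" where
  "trace_bounded a C \<longleftrightarrow> (\<forall>Y \<beta> c R. finite Y \<and> Y \<noteq> {} \<and> 0 < \<beta> \<and> (\<forall>y\<in>Y. \<forall>i. \<bar>y $ i\<bar> \<le> R) \<longrightarrow>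
     (\<integral>\<^sup>+x. ennreal (gibbs_trace Y \<beta> c x (a x)) \<partial>lborel) \<le> ennreal (C * R))"

lemma integrable_vec:
  fixes f :: "'a \<Rightarrow> 'b::euclidean_space^'m"
  assumes "\<And>i. integrable M (\<lambda>x. f x $ i)"
  shows "integrable M f"
proof -
  have "linear (axis i :: 'b \<Rightarrow> 'b^'m)" for i
    by (rule linearI) (simp_all add: axis_def vec_eq_iff)
  then have "integrable M (\<lambda>x. \<Sum>i\<in>UNIV. axis i (f x $ i) :: 'b^'m)"
    by (intro Bochner_Integration.integrable_sum integrable_bounded_linear[OF _ assms])
       (simp add: linear_conv_bounded_linear)
  moreover have "(\<Sum>i\<in>UNIV. axis i (f x $ i)) = f x" for x
    by (simp add: vec_eq_iff sum_component axis_def)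
  ultimately show ?thesis by simp
qed

text \<open>The hypotheses hold almost everywhere and for Lebesgue measurable entries, while
  translations and Fubini are carried out for Borel functions. Replacing the localised field by 0 on
  a Borel null set that contains all bad points makes it Borel, and symmetric and positive
  semi-definite everywhere.\<close>

lemma cutoff_borel_representative:
  fixes A :: "real^'n \<Rightarrow> real^'n^'n"
  assumes sym: "AE x in lebesgue. x \<in> \<Omega> \<longrightarrow> transpose (A x) = A x"
    and L1: "\<forall>i j. locally_L1 (\<lambda>x. A x $ i $ j) \<Omega>"
    and psd: "AE x in lebesgue. x \<in> \<Omega> \<longrightarrow> (\<forall>v. 0 \<le> v \<bullet> (A x *v v))"
    and "div_locally_measure A \<Omega>" "0 < r" "cball x0 r \<subseteq> \<Omega>"
  obtains a :: "real^'n \<Rightarrow> real^'n^'n" and C where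
    "integrable lborel a" "\<And>x. transpose (a x) = a x" "\<And>x v. 0 \<le> v \<bullet> (a x *v v)"
    "AE x in lborel. a x = cutoff x0 r x *\<^sub>R A x" "0 \<le> C" "trace_bounded a C"
proof (rule cutoff_trace_bound[OF L1 assms(4-6)])
  let ?\<chi> = "cutoff x0 r"
  fix C assume C: "0 \<le> C" "\<And>Y \<beta> c R. \<lbrakk>finite Y; Y \<noteq> {}; \<And>y i. y \<in> Y \<Longrightarrow> \<bar>y $ i\<bar> \<le> R\<rbrakk> \<Longrightarrow>
      integrable lebesgue (\<lambda>x. gibbs_trace Y \<beta> c x (cutoff x0 r x *\<^sub>R A x)) \<and>
      (LINT x|lebesgue. gibbs_trace Y \<beta> c x (cutoff x0 r x *\<^sub>R A x)) \<le> C * R"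
  have \<chi>0: "?\<chi> x = 0" if "x \<notin> cball x0 r" for x using cutoff_outside[OF _ that] assms(5) by simp
  have int: "integrable lebesgue (\<lambda>x. ?\<chi> x * A x $ i $ j)" for i j
    by (rule integrable_mult_cutoff) (use L1 assms(5,6) in \<open>auto simp: locally_L1_def\<close>)
  have ex: "\<exists>g. g \<in> borel_measurable lborel \<and> (AE x in lborel. ?\<chi> x * A x $ i $ j = g x)" for i j
    using completion_ex_borel_measurable_real[OF borel_measurable_integrable[OF int[of i j]]] by auto
  define g where "g i j = (SOME g. g \<in> borel_measurable lborel \<and> (AE x in lborel. ?\<chi> x * A x $ i $ j = g x))" for i j
  have g: "g i j \<in> borel_measurable lborel" "AE x in lborel. ?\<chi> x * A x $ i $ j = g i j x" for i j
    using someI_ex[OF ex[of i j]] by (auto simp: g_def)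
  define good where "good x \<longleftrightarrow> (x \<in> \<Omega> \<longrightarrow> transpose (A x) = A x) \<and>
     (x \<in> \<Omega> \<longrightarrow> (\<forall>v. 0 \<le> v \<bullet> (A x *v v))) \<and> (\<forall>i j. ?\<chi> x * A x $ i $ j = g i j x)" for x
  have "AE x in lborel. \<forall>i j. ?\<chi> x * A x $ i $ j = g i j x"
    by (intro eventually_all_finite g(2))
  then have "AE x in lborel. good x"
    using sym psd unfolding AE_completion_iff good_def by eventually_elim blast
  then obtain N where "{x \<in> space lborel. \<not> good x} \<subseteq> N" and N: "N \<in> null_sets lborel"
    unfolding eventually_ae_filter by (rule bexE)
  then have goodN: "\<And>x. x \<in> space lborel - N \<Longrightarrow> good x" by auto
  have good: "(x \<in> \<Omega> \<longrightarrow> transpose (A x) = A x) \<and> (x \<in> \<Omega> \<longrightarrow> (\<forall>v. 0 \<le> v \<bullet> (A x *v v))) \<and>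
     (\<forall>i j. ?\<chi> x * A x $ i $ j = g i j x)" if "x \<notin> N" for x
    using goodN[of x] that by (simp add: good_def)
  define a where "a x = (if x \<in> N then 0 else ?\<chi> x *\<^sub>R A x)" for x
  have a_g: "a x $ i $ j = indicator (- N) x * g i j x" for x i j
    using good[of x] by (auto simp: a_def)
  have AEa: "AE x in lborel. a x = ?\<chi> x *\<^sub>R A x"
    using AE_not_in[OF N] by eventually_elim (simp add: a_def)
  have ma: "(\<lambda>x. a x $ i $ j) \<in> borel_measurable lborel" for i j
    unfolding a_g using N g(1)[of i j] by auto
  show ?thesis
  proof (rule that[of a C])
    show "integrable lborel a"
    proof (intro integrable_vec)
      fix i j
      have "integrable lebesgue (\<lambda>x. a x $ i $ j)"
        by (rule Bochner_Integration.integrable_cong_AE_imp[OF int[of i j]])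
           (use ma[of i j] AEa in \<open>auto simp: AE_completion_iff intro: measurable_completion\<close>)
      then show "integrable lborel (\<lambda>x. a x $ i $ j)" using ma[of i j] by (simp add: integrable_completion)
    qed
    \<comment> \<open>Symmetry and positivity of \<open>A\<close> are available inside
      \<open>\<Omega>\<close> only; elsewhere the cutoff vanishes.\<close>
    have *: "x \<in> \<Omega> \<or> ?\<chi> x = 0" for x using \<chi>0[of x] assms(6) by blast
    show "transpose (a x) = a x" for x
    proof -
      have "transpose (a x) = (if x \<in> N then 0 else ?\<chi> x *\<^sub>R transpose (A x))"
        by (simp add: a_def transpose_def vec_eq_iff)
      then show ?thesis using good[of x] *[of x] by (auto simp: a_def)
    qed
    show "0 \<le> v \<bullet> (a x *v v)" for x v
      using good[of x] *[of x] cutoff_bounds(1)[of x0 r x]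
      by (auto simp: a_def scaleR_matrix_vector_assoc[symmetric])
    then have nn: "0 \<le> gibbs_trace Y \<beta> c x (a x)" if "0 < \<beta>" for Y \<beta> c x
      using that by (intro gibbs_trace_nonneg) auto
    have "(\<integral>\<^sup>+x. ennreal (gibbs_trace Y \<beta> c x (a x)) \<partial>lborel) \<le> ennreal (C * R)"
      if Y: "finite Y" "Y \<noteq> {}" and \<beta>: "0 < \<beta>" and R: "\<And>y i. y \<in> Y \<Longrightarrow> \<bar>y $ i\<bar> \<le> R" for Y \<beta> c R
    proof -
      have AEt: "AE x in lebesgue. gibbs_trace Y \<beta> c x (?\<chi> x *\<^sub>R A x) = gibbs_trace Y \<beta> c x (a x)"
        using AEa by (auto simp: AE_completion_iff)
      have nnl: "AE x in lebesgue. 0 \<le> gibbs_trace Y \<beta> c x (?\<chi> x *\<^sub>R A x)"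
        using AEt by eventually_elim (simp add: nn[OF \<beta>])
      have "(\<integral>\<^sup>+x. ennreal (gibbs_trace Y \<beta> c x (a x)) \<partial>lborel) =
         (\<integral>\<^sup>+x. ennreal (gibbs_trace Y \<beta> c x (a x)) \<partial>lebesgue)" by (simp add: nn_integral_completion)
      also have "\<dots> = (\<integral>\<^sup>+x. ennreal (gibbs_trace Y \<beta> c x (?\<chi> x *\<^sub>R A x)) \<partial>lebesgue)"
        by (rule nn_integral_cong_AE) (use AEt in eventually_elim, simp)
      also have "\<dots> = ennreal (LINT x|lebesgue. gibbs_trace Y \<beta> c x (?\<chi> x *\<^sub>R A x))"
        using C(2)[OF Y R] nnl by (intro nn_integral_eq_integral) auto
      also have "\<dots> \<le> ennreal (C * R)" using C(2)[OF Y R] by (intro ennreal_leI) auto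
      finally show ?thesis .
    qed
    then show "trace_bounded a C" by (simp add: trace_bounded_def)
  qed (use C(1) AEa in auto)
qed

section \<open>Continuity of translations and mollification\<close>

lemma nn_integral_lborel_translate:
  fixes f :: "'a::euclidean_space \<Rightarrow> ennreal"
  assumes [measurable]: "f \<in> borel_measurable borel"
  shows "(\<integral>\<^sup>+x. f (x + z) \<partial>lborel) = (\<integral>\<^sup>+x. f x \<partial>lborel)"
  by (subst (2) lborel_distr_plus[of z, symmetric]) (simp add: nn_integral_distr add.commute)

lemma integral_lborel_translate:
  fixes f :: "'a::euclidean_space \<Rightarrow> 'b::{banach, second_countable_topology}"
  assumes [measurable]: "f \<in> borel_measurable borel"
  shows "(LINT x|lborel. f (x + z)) = (LINT x|lborel. f x)"
  by (subst (2) lborel_distr_plus[of z, symmetric]) (simp add: integral_distr add.commute)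

lemma integrable_lborel_translate:
  fixes f :: "'a::euclidean_space \<Rightarrow> 'b::{banach, second_countable_topology}"
  assumes "integrable lborel f"
  shows "integrable lborel (\<lambda>x. f (x + z))"
proof -
  have [measurable]: "f \<in> borel_measurable borel" using assms by auto
  have "integrable (distr lborel borel ((+) z)) f" using assms by (simp add: lborel_distr_plus)
  then show ?thesis by (subst (asm) integrable_distr_eq) (auto simp: add.commute)
qed

text \<open>With \<open>A \<subseteq> U\<close> open and \<open>U - A\<close> small, a short translation changes membership only on \<open>U - A\<close> and near
  the complement of \<open>U\<close>.\<close>
lemma indicator_translate_L1:
  fixes A :: "'a::euclidean_space set"
  assumes A: "A \<in> sets lborel" "emeasure lborel A < \<infinity>" and "0 < (e::real)"
  shows "\<exists>\<delta>>0. \<forall>z. norm z < \<delta> \<longrightarrow> (\<integral>\<^sup>+x. ennreal \<bar>indicator A (x + z) - indicator A x\<bar> \<partial>lborel) \<le> ennreal e"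
proof -
  have "\<exists>U. open U \<and> A \<subseteq> U \<and> emeasure lebesgue (U - A) < ennreal (e/4)"
  proof (rule sets_lebesgue_outer_open[OF sets_completionI_sets[OF A(1)], of "e/4"])
    show "0 < e/4" using \<open>0 < e\<close> by simp
  qed blast
  then obtain U where U: "open U" "A \<subseteq> U" "emeasure lebesgue (U - A) < ennreal (e/4)" by blast
  have [measurable]: "A \<in> sets borel" "U \<in> sets borel" using A(1) U(1) by auto
  have UA: "emeasure lborel (U - A) < ennreal (e/4)"
    using U(3) by (simp add: emeasure_completion)
  \<comment> \<open>The neighbourhoods of the complement of \<open>U\<close> of radius
    \<open>1 / (n + 1)\<close>. As \<open>U\<close> is open and contains \<open>A\<close>, their
    traces on \<open>A\<close> shrink to the empty set, hence to measure 0.\<close>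
  define W where "W n = (\<Union>y\<in>- U. ball y (1 / real (Suc n)))" for n
  have "open (W n)" for n by (auto simp: W_def)
  then have [measurable]: "W n \<in> sets borel" for n by auto
  have "decseq (\<lambda>n. A \<inter> W n)"
  proof (rule decseq_SucI)
    fix n
    have "1 / real (Suc (Suc n)) \<le> 1 / real (Suc n)" by (simp add: field_simps)
    then have "ball y (1 / real (Suc (Suc n))) \<subseteq> ball y (1 / real (Suc n))" for y :: 'a
      by (rule subset_ball)
    then show "A \<inter> W (Suc n) \<subseteq> A \<inter> W n" unfolding W_def by blast
  qed
  moreover have "(\<Inter>n. A \<inter> W n) = {}"
  proof (rule ccontr)
    assume "(\<Inter>n. A \<inter> W n) \<noteq> {}"
    then obtain x where x: "x \<in> A" "\<And>n. x \<in> W n" by auto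
    then obtain r where "0 < r" "ball x r \<subseteq> U" using U by (meson openE subsetD)
    moreover obtain n where "1 / real (Suc n) < r" using \<open>0 < r\<close> nat_approx_posE by blast
    moreover obtain y where "y \<notin> U" "dist y x < 1 / real (Suc n)" using x(2)[of n] by (auto simp: W_def)
    ultimately show False by (auto simp: dist_commute subset_iff)
  qed
  moreover have "emeasure lborel (A \<inter> W n) \<noteq> \<infinity>" for n
  proof -
    have "emeasure lborel (A \<inter> W n) \<le> emeasure lborel A" by (rule emeasure_mono) auto
    then show ?thesis using A(2) by (auto simp: top_unique)
  qed
  ultimately have "(\<lambda>n. emeasure lborel (A \<inter> W n)) \<longlonglongrightarrow> 0"
    using Lim_emeasure_decseq[of "\<lambda>n. A \<inter> W n" lborel] by (auto simp: image_subset_iff)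
  then have "eventually (\<lambda>n. emeasure lborel (A \<inter> W n) < ennreal (e/4)) sequentially"
    using \<open>0 < e\<close> by (intro order_tendstoD) auto
  then obtain n where n: "emeasure lborel (A \<inter> W n) < ennreal (e/4)"
    by (auto simp: eventually_sequentially)
  show ?thesis
  proof (intro exI[of _ "1 / real (Suc n)"] conjI allI impI)
    fix z :: 'a assume z: "norm z < 1 / real (Suc n)"
    \<comment> \<open>Two error sets are counted at \<open>x\<close> and again at
      \<open>x + z\<close>, which accounts for the four quarters of \<open>e\<close>.\<close>
    let ?f = "\<lambda>x. ennreal (indicator (U - A) x) + ennreal (indicator (A \<inter> W n) x)"
    have WI: "x \<in> W n" "x + z \<in> W n" if "x \<notin> U \<or> x + z \<notin> U" for x
      using that z unfolding W_def by (auto simp: dist_norm intro: bexI[of _ x] bexI[of _ "x + z"])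
    have "ennreal \<bar>indicator A (x + z) - indicator A x\<bar> \<le> ?f x + ?f (x + z)" for x
    proof -
      have "\<bar>indicator A (x + z) - indicator A x\<bar> \<le> indicator (U - A) x + indicator (A \<inter> W n) x +
          (indicator (U - A) (x + z) + indicator (A \<inter> W n) (x + z) :: real)"
        using WI[of x] U(2) by (auto simp: indicator_def)
      then show ?thesis
        by (simp add: ennreal_plus[symmetric] del: ennreal_plus)
    qed
    then have "(\<integral>\<^sup>+x. ennreal \<bar>indicator A (x + z) - indicator A x\<bar> \<partial>lborel) \<le> (\<integral>\<^sup>+x. ?f x + ?f (x + z) \<partial>lborel)"
      by (intro nn_integral_mono)
    also have "\<dots> = (\<integral>\<^sup>+x. ?f x \<partial>lborel) + (\<integral>\<^sup>+x. ?f (x + z) \<partial>lborel)"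
      by (rule nn_integral_add) measurable
    also have "(\<integral>\<^sup>+x. ?f (x + z) \<partial>lborel) = (\<integral>\<^sup>+x. ?f x \<partial>lborel)"
      by (rule nn_integral_lborel_translate) measurable
    also have "(\<integral>\<^sup>+x. ?f x \<partial>lborel) = emeasure lborel (U - A) + emeasure lborel (A \<inter> W n)"
      by (subst nn_integral_add) (auto simp: ennreal_indicator)
    also have "\<dots> + \<dots> \<le> (ennreal (e/4) + ennreal (e/4)) + (ennreal (e/4) + ennreal (e/4))"
      using UA n by (intro add_mono) auto
    also have "\<dots> = ennreal e" using \<open>0 < e\<close> by (simp add: ennreal_plus[symmetric] del: ennreal_plus)
    finally show "(\<integral>\<^sup>+x. ennreal \<bar>indicator A (x + z) - indicator A x\<bar> \<partial>lborel) \<le> ennreal e" .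
  qed simp
qed

definition shift_L1 :: "('a::euclidean_space \<Rightarrow> 'b::{banach, second_countable_topology}) \<Rightarrow> 'a \<Rightarrow> ennreal" where
  "shift_L1 f z = (\<integral>\<^sup>+x. norm (f (x + z) - f x) \<partial>lborel)"

text \<open>Density argument: scaled indicators first, then sums, and limits in mean by splitting
  \<open>e\<close> in three, since a translation does not change the distance between
  \<open>f\<close> and its approximation.\<close>

lemma translate_continuous_L1:
  fixes f :: "'a::euclidean_space \<Rightarrow> 'b::{banach, second_countable_topology}"
  assumes "integrable lborel f" "0 < (e::real)"
  shows "\<exists>\<delta>>0. \<forall>z. norm z < \<delta> \<longrightarrow> shift_L1 f z \<le> ennreal e"
  using assms
proof (induction f arbitrary: e rule: integrable_induct)
  case (base A c)
  have "0 < e / (norm c + 1)" using base by (simp add: add_nonneg_pos)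
  from indicator_translate_L1[OF base(1,2) this] obtain \<delta> where \<delta>: "\<delta> > 0"
    "\<And>z. norm z < \<delta> \<Longrightarrow> (\<integral>\<^sup>+x. ennreal \<bar>indicator A (x + z) - indicator A x\<bar> \<partial>lborel) \<le> ennreal (e / (norm c + 1))"
    by blast
  have [measurable]: "A \<in> sets borel" using base by auto
  have "shift_L1 (\<lambda>x. indicator A x *\<^sub>R c) z \<le> ennreal e" if "norm z < \<delta>" for z
  proof -
    have "shift_L1 (\<lambda>x. indicator A x *\<^sub>R c) z =
      (\<integral>\<^sup>+x. ennreal (norm c) * ennreal \<bar>indicator A (x + z) - indicator A x\<bar> \<partial>lborel)"
      unfolding shift_L1_def
      by (intro nn_integral_cong) (simp add: ennreal_mult[symmetric] scaleR_diff_left[symmetric] mult.commute)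
    also have "\<dots> = ennreal (norm c) * (\<integral>\<^sup>+x. ennreal \<bar>indicator A (x + z) - indicator A x\<bar> \<partial>lborel)"
      by (rule nn_integral_cmult) measurable
    also have "\<dots> \<le> ennreal (norm c) * ennreal (e / (norm c + 1))"
      by (intro mult_left_mono \<delta> that) auto
    also have "\<dots> \<le> ennreal e"
      using base by (simp add: ennreal_mult[symmetric] pos_divide_le_eq add_nonneg_pos add_pos_nonneg algebra_simps)
    finally show ?thesis .
  qed
  then show ?case using \<delta>(1) by blast
next
  case (add f g)
  have [measurable]: "f \<in> borel_measurable borel" "g \<in> borel_measurable borel" using add by auto
  have e2: "0 < e/2" using add by simp
  obtain d1 where d1: "d1 > 0" "\<And>z. norm z < d1 \<Longrightarrow> shift_L1 f z \<le> ennreal (e/2)"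
    using add.IH(1)[OF e2] by blast
  obtain d2 where d2: "d2 > 0" "\<And>z. norm z < d2 \<Longrightarrow> shift_L1 g z \<le> ennreal (e/2)"
    using add.IH(2)[OF e2] by blast
  have "shift_L1 (\<lambda>x. f x + g x) z \<le> ennreal e" if "norm z < min d1 d2" for z
  proof -
    have "shift_L1 (\<lambda>x. f x + g x) z \<le>
      (\<integral>\<^sup>+x. ennreal (norm (f (x + z) - f x)) + ennreal (norm (g (x + z) - g x)) \<partial>lborel)"
      unfolding shift_L1_def
      by (intro nn_integral_mono)
         (simp add: ennreal_plus[symmetric] norm_diff_triangle_ineq ennreal_leI del: ennreal_plus)
    also have "\<dots> = shift_L1 f z + shift_L1 g z"
      unfolding shift_L1_def by (rule nn_integral_add) measurable
    also have "\<dots> \<le> ennreal (e/2) + ennreal (e/2)" using that d1 d2 by (intro add_mono) auto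
    also have "\<dots> = ennreal e" using add by (simp add: ennreal_plus[symmetric] del: ennreal_plus)
    finally show ?thesis .
  qed
  then show ?case using d1 d2 by (intro exI[of _ "min d1 d2"]) auto
next
  case (lim f s)
  have [measurable]: "f \<in> borel_measurable borel" "s i \<in> borel_measurable borel" for i using lim by auto
  let ?r = "\<lambda>i x. ennreal (norm (f x - s i x))"
  have "(\<lambda>i. (\<integral>\<^sup>+x. ?r i x \<partial>lborel)) \<longlonglongrightarrow> 0"
  proof (rule nn_integral_dominated_convergence_norm)
    show "(\<integral>\<^sup>+x. ennreal (2 * norm (f x)) \<partial>lborel) < \<infinity>"
      using lim(4) by (simp add: integrable_iff_bounded nn_integral_cmult ennreal_mult ennreal_mult_less_top)
  qed (use lim in auto)
  then have "eventually (\<lambda>i. (\<integral>\<^sup>+x. ?r i x \<partial>lborel) < ennreal (e/3)) sequentially"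
    using lim by (intro order_tendstoD) auto
  then obtain i where i: "(\<integral>\<^sup>+x. ?r i x \<partial>lborel) < ennreal (e/3)"
    by (auto simp: eventually_sequentially)
  obtain d where d: "d > 0" "\<And>z. norm z < d \<Longrightarrow> shift_L1 (s i) z \<le> ennreal (e/3)"
    using lim.IH[of "e/3" i] lim.prems by auto
  have "shift_L1 f z \<le> ennreal e" if "norm z < d" for z
  proof -
    have "norm (f (x + z) - f x) \<le> norm (f (x + z) - s i (x + z)) + (norm (s i (x + z) - s i x) + norm (f x - s i x))" for x
      using norm_triangle_ineq[of "f (x + z) - s i (x + z)" "(s i (x + z) - s i x) - (f x - s i x)"]
        norm_triangle_ineq4[of "s i (x + z) - s i x" "f x - s i x"] by simp
    then have "shift_L1 f z \<le> (\<integral>\<^sup>+x. ?r i (x + z) + (norm (s i (x + z) - s i x) + ?r i x) \<partial>lborel)"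
      unfolding shift_L1_def
      by (intro nn_integral_mono) (simp add: ennreal_plus[symmetric] ennreal_leI del: ennreal_plus)
    also have "\<dots> = (\<integral>\<^sup>+x. ?r i (x + z) \<partial>lborel) + (shift_L1 (s i) z + (\<integral>\<^sup>+x. ?r i x \<partial>lborel))"
      unfolding shift_L1_def by (subst nn_integral_add, measurable, subst nn_integral_add) auto
    also have "(\<integral>\<^sup>+x. ?r i (x + z) \<partial>lborel) = (\<integral>\<^sup>+x. ?r i x \<partial>lborel)"
      by (rule nn_integral_lborel_translate[of "?r i"]) measurable
    also have "(\<integral>\<^sup>+x. ?r i x \<partial>lborel) + (shift_L1 (s i) z + (\<integral>\<^sup>+x. ?r i x \<partial>lborel))
       \<le> ennreal (e/3) + (ennreal (e/3) + ennreal (e/3))"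
      using i d(2)[OF that] by (intro add_mono) auto
    also have "\<dots> = ennreal e" using lim by (simp add: ennreal_plus[symmetric] del: ennreal_plus)
    finally show ?thesis .
  qed
  then show ?case using d(1) by blast
qed

section \<open>Mollification with a Lipschitz kernel\<close>

definition tent_mass :: "'a::euclidean_space itself \<Rightarrow> real \<Rightarrow> real" where
  "tent_mass _ r = (LINT z::'a|lborel. max 0 (r - norm z))"

text \<open>A Lipschitz kernel is enough, because only continuity of the mollified field is used and
  never its derivatives.\<close>

definition tent :: "real \<Rightarrow> 'a::euclidean_space \<Rightarrow> real" where
  "tent r z = max 0 (r - norm z) / tent_mass TYPE('a) r"

lemma integrable_tent_raw:
  "integrable lborel (\<lambda>z::'a::euclidean_space. max 0 (r - norm z))"
proof -
  have "integrable lborel (\<lambda>z::'a. indicator (cball 0 r) z *\<^sub>R max 0 (r - norm z))"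
    by (intro borel_integrable_compact continuous_intros) auto
  moreover have "(\<lambda>z::'a. indicator (cball 0 r) z *\<^sub>R max 0 (r - norm z)) = (\<lambda>z. max 0 (r - norm z))"
    by (auto simp: indicator_def fun_eq_iff)
  ultimately show ?thesis by simp
qed

lemma tent_mass_pos:
  assumes "0 < r" shows "0 < tent_mass TYPE('a::euclidean_space) r"
proof -
  have "(LINT z::'a|lborel. indicator (cball 0 (r/2)) z * (r/2)) \<le> tent_mass TYPE('a) r"
    unfolding tent_mass_def
  proof (intro integral_mono integrable_tent_raw integrable_mult_left integrable_real_indicator)
    show "indicator (cball 0 (r/2)) z * (r/2) \<le> max 0 (r - norm z)" for z :: 'a
      by (cases "z \<in> cball 0 (r/2)") (auto simp: max_def)
  qed (use emeasure_bounded_finite[OF bounded_cball] in auto)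
  moreover have "0 < measure lborel (cball (0::'a) (r/2)) * (r/2)"
    using content_cball_pos[of "r/2" "0::'a"] assms by simp
  ultimately show ?thesis by simp
qed

lemma tent_nonneg: "0 < r \<Longrightarrow> 0 \<le> tent r z"
  using tent_mass_pos[of r, where 'a = 'a] by (simp add: tent_def)

lemma tent_support: "r \<le> norm z \<Longrightarrow> tent r z = 0"
  by (simp add: tent_def)

lemma integrable_tent: "integrable lborel (tent r)"
  unfolding tent_def[abs_def] by (intro integrable_divide integrable_tent_raw)

lemma integral_tent: "0 < r \<Longrightarrow> (LINT z|lborel. tent r (z::'a::euclidean_space)) = 1"
proof -
  assume "0 < r"
  moreover have "(LINT z|lborel. max 0 (r - norm (z::'a))) = tent_mass TYPE('a) r"
    by (simp add: tent_mass_def)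
  ultimately show ?thesis
    using tent_mass_pos[of r, where 'a = 'a] by (simp add: tent_def)
qed

lemma nn_integral_tent: "0 < r \<Longrightarrow> (\<integral>\<^sup>+z. ennreal (tent r (z::'a::euclidean_space)) \<partial>lborel) = 1"
  by (subst nn_integral_eq_integral) (auto simp: integrable_tent integral_tent tent_nonneg)

lemma tent_bound: "0 < r \<Longrightarrow> \<bar>tent r (z::'a::euclidean_space)\<bar> \<le> r / tent_mass TYPE('a) r"
  using tent_mass_pos[of r, where 'a = 'a] by (simp add: tent_def divide_right_mono)

lemma tent_lipschitz:
  fixes z w :: "'a::euclidean_space"
  assumes "0 < r"
  shows "\<bar>tent r z - tent r w\<bar> \<le> norm (z - w) / tent_mass TYPE('a) r"
proof -
  have "\<bar>max 0 (r - norm z) - max 0 (r - norm w)\<bar> \<le> norm (z - w)"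
    using norm_triangle_ineq3[of z w] by (auto simp: max_def)
  then show ?thesis
    using tent_mass_pos[OF assms, where 'a = 'a] by (simp add: tent_def diff_divide_distrib[symmetric] divide_right_mono)
qed

lemma borel_measurable_tent[measurable]: "tent r \<in> borel_measurable borel"
  unfolding tent_def[abs_def] by measurable

text \<open>The kernel is even, so this is the usual convolution; in this form it is visibly an
  average of translates of \<open>f\<close>.\<close>

definition mollify :: "real \<Rightarrow> ('a::euclidean_space \<Rightarrow> 'b::{banach, second_countable_topology}) \<Rightarrow> 'a \<Rightarrow> 'b" where
  "mollify r f y = (LINT z|lborel. tent r z *\<^sub>R f (y + z))"

lemma integrable_mollify:
  fixes f :: "'a::euclidean_space \<Rightarrow> 'b::{banach, second_countable_topology}"
  assumes "integrable lborel f" "0 < r"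
  shows "integrable lborel (\<lambda>z. tent r z *\<^sub>R f (y + z))"
proof -
  have "integrable lborel (\<lambda>z. tent r z *\<^sub>R f (z + y))"
    by (rule integrable_scaleR_bounded(1)[OF integrable_lborel_translate[OF assms(1)] _ tent_bound[OF assms(2)]]) measurable
  then show ?thesis by (simp add: add.commute)
qed

text \<open>After a substitution the variable sits in the kernel alone, so the Lipschitz constant of
  the kernel times the integral of \<open>norm f\<close> is a Lipschitz constant for the
  result.\<close>

lemma continuous_mollify:
  fixes f :: "'a::euclidean_space \<Rightarrow> 'b::{banach, second_countable_topology}"
  assumes f: "integrable lborel f" "0 < r"
  shows "continuous_on UNIV (mollify r f)"
proof -
  have [measurable]: "f \<in> borel_measurable borel" using f by auto
  let ?m = "tent_mass TYPE('a) r" and ?N = "LINT x|lborel. norm (f x)"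
  have eq: "mollify r f y = (LINT x|lborel. tent r (x - y) *\<^sub>R f x)" for y
    unfolding mollify_def
    using integral_lborel_translate[of "\<lambda>x. tent r (x - y) *\<^sub>R f x" y] by (simp add: add.commute)
  have int: "integrable lborel (\<lambda>x. tent r (x - y) *\<^sub>R f x)" for y
    by (rule integrable_scaleR_bounded(1)[OF f(1) _ tent_bound[OF f(2)]]) measurable
  have lip: "norm (mollify r f y - mollify r f y') \<le> norm (y - y') / ?m * ?N" for y y'
  proof -
    have b: "\<bar>tent r (x - y) - tent r (x - y')\<bar> \<le> norm (y - y') / ?m" for x
      using tent_lipschitz[OF f(2), of "x - y" "x - y'"] by (simp add: norm_minus_commute)
    have "mollify r f y - mollify r f y' = (LINT x|lborel. (tent r (x - y) - tent r (x - y')) *\<^sub>R f x)"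
      unfolding eq scaleR_diff_left by (rule Bochner_Integration.integral_diff[symmetric, OF int int])
    then show ?thesis using integrable_scaleR_bounded(2)[OF f(1) _ b] by simp
  qed
  have "(?N / ?m)-lipschitz_on UNIV (mollify r f)"
  proof (rule lipschitz_onI)
    show "dist (mollify r f x) (mollify r f y) \<le> ?N / ?m * dist x y" for x y
      using lip[of x y] by (simp add: dist_norm mult.commute)
    show "0 \<le> ?N / ?m" using tent_mass_pos[OF f(2), where 'a = 'a] by simp
  qed
  then show ?thesis by (rule lipschitz_on_continuous_on)
qed

text \<open>By Fubini the error is at most the average of \<open>shift_L1 f z\<close> over the
  support of the kernel, on which \<open>shift_L1 f z\<close> is at most \<open>e\<close> once
  \<open>r\<close> is small.\<close>

lemma mollify_L1:
  fixes f :: "'a::euclidean_space \<Rightarrow> 'b::{banach, second_countable_topology}"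
  assumes f: "integrable lborel f" and "0 < (e::real)"
  obtains r where "0 < r" "(\<integral>\<^sup>+y. norm (mollify r f y - f y) \<partial>lborel) \<le> ennreal e"
proof -
  have [measurable]: "f \<in> borel_measurable borel" using f by auto
  obtain r where r: "r > 0" "\<And>z. norm z < r \<Longrightarrow> shift_L1 f z \<le> ennreal e"
    using translate_continuous_L1[OF assms] by blast
  let ?g = "\<lambda>y z. ennreal (tent r z) * ennreal (norm (f (y + z) - f y))"
  have "ennreal (norm (mollify r f y - f y)) \<le> (\<integral>\<^sup>+z. ?g y z \<partial>lborel)" for y
  proof -
    have i: "integrable lborel (\<lambda>z. tent r z *\<^sub>R (f (y + z) - f y))"
      unfolding scaleR_diff_right
      by (intro Bochner_Integration.integrable_diff integrable_scaleR_left integrable_mollify[OF f r(1)] integrable_tent)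
    have "mollify r f y - f y = (LINT z|lborel. tent r z *\<^sub>R (f (y + z) - f y))"
      unfolding scaleR_diff_right
      by (subst Bochner_Integration.integral_diff[OF integrable_mollify[OF f r(1)] integrable_scaleR_left[OF integrable_tent]])
         (simp add: mollify_def integral_scaleR_left[OF integrable_tent] integral_tent[OF r(1)])
    also have "norm \<dots> \<le> (LINT z|lborel. norm (tent r z *\<^sub>R (f (y + z) - f y)))" by (rule integral_norm_bound)
    finally have "ennreal (norm (mollify r f y - f y)) \<le> ennreal (LINT z|lborel. norm (tent r z *\<^sub>R (f (y + z) - f y)))"
      by (rule ennreal_leI)
    also have "\<dots> = (\<integral>\<^sup>+z. norm (tent r z *\<^sub>R (f (y + z) - f y)) \<partial>lborel)"
      by (intro nn_integral_eq_integral[symmetric] integrable_norm i AE_I2) simp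
    also have "\<dots> = (\<integral>\<^sup>+z. ?g y z \<partial>lborel)"
      by (intro nn_integral_cong) (simp add: ennreal_mult tent_nonneg[OF r(1)])
    finally show ?thesis .
  qed
  then have "(\<integral>\<^sup>+y. norm (mollify r f y - f y) \<partial>lborel) \<le> (\<integral>\<^sup>+y. (\<integral>\<^sup>+z. ?g y z \<partial>lborel) \<partial>lborel)"
    by (intro nn_integral_mono)
  also have "\<dots> = (\<integral>\<^sup>+z. (\<integral>\<^sup>+y. ?g y z \<partial>lborel) \<partial>lborel)"
    by (rule lborel_pair.Fubini') measurable
  also have "\<dots> \<le> (\<integral>\<^sup>+z. ennreal (tent r (z::'a)) * ennreal e \<partial>lborel)"
  proof (intro nn_integral_mono)
    fix z :: 'a
    have "(\<integral>\<^sup>+y. ?g y z \<partial>lborel) = ennreal (tent r z) * shift_L1 f z"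
      unfolding shift_L1_def by (rule nn_integral_cmult) measurable
    also have "\<dots> \<le> ennreal (tent r z) * ennreal e"
      using r(2)[of z] tent_support[of r z] by (cases "norm z < r") (auto intro!: mult_left_mono)
    finally show "(\<integral>\<^sup>+y. ?g y z \<partial>lborel) \<le> ennreal (tent r z) * ennreal e" .
  qed
  also have "\<dots> = ennreal e" by (subst nn_integral_multc) (auto simp: nn_integral_tent[OF r(1)])
  finally show ?thesis using that r(1) by blast
qed

lemma linear_mollify:
  fixes T :: "'b::euclidean_space \<Rightarrow> 'c::euclidean_space"
  assumes "linear T" "integrable lborel f" "0 < r"
  shows "integrable lborel (\<lambda>z. tent r z *\<^sub>R T (f (y + z)))"
    "T (mollify r f y) = (LINT z|lborel. tent r z *\<^sub>R T (f (y + z)))"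
  using integrable_bounded_linear[OF linear_conv_bounded_linear[THEN iffD1] integrable_mollify, OF assms, of y]
    integral_bounded_linear[OF linear_conv_bounded_linear[THEN iffD1] integrable_mollify, OF assms, of y]
  by (simp_all add: mollify_def linear_scale[OF assms(1)])

lemma quadratic_form_eq: "v \<bullet> (M *v v) = (\<Sum>i\<in>UNIV. \<Sum>j\<in>UNIV. M $ i $ j * (v $ i * v $ j))"
  for M :: "real^'n^'n"
  unfolding inner_vec_def matrix_vector_mult_def by (simp add: sum_distrib_left mult.left_commute)

lemma mollify_psd:
  fixes a :: "real^'n \<Rightarrow> real^'n^'n"
  assumes "integrable lborel a" "0 < r" "\<And>x v. 0 \<le> v \<bullet> (a x *v v)"
  shows "0 \<le> v \<bullet> (mollify r a y *v v)"
proof -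
  have "linear (\<lambda>M. v \<bullet> (M *v v))"
    by (rule linearI) (simp_all add: matrix_vector_mult_add_rdistrib scaleR_matrix_vector_assoc[symmetric] inner_add_right)
  from linear_mollify(2)[OF this assms(1,2)] show ?thesis
    by (auto intro!: integral_nonneg_AE AE_I2 mult_nonneg_nonneg tent_nonneg assms(2,3))
qed

lemma mollify_symmetric:
  fixes a :: "real^'n \<Rightarrow> real^'n^'n"
  assumes "integrable lborel a" "0 < r" "\<And>x. transpose (a x) = a x"
  shows "transpose (mollify r a y) = mollify r a y"
proof -
  have "linear (transpose :: real^'n^'n \<Rightarrow> real^'n^'n)"
    by (rule linearI) (simp_all add: transpose_def vec_eq_iff)
  from linear_mollify(2)[OF this assms(1,2)] show ?thesis by (simp add: assms(3) mollify_def)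
qed

text \<open>Mollifying \<open>a\<close> amounts to averaging the bound over translates of the convex function.\<close>
lemma mollify_trace_bounded:
  fixes a :: "real^'n \<Rightarrow> real^'n^'n"
  assumes a: "integrable lborel a" and r: "0 < r" and psd: "\<And>x v. 0 \<le> v \<bullet> (a x *v v)"
    and bound: "trace_bounded a C"
  shows "trace_bounded (mollify r a) C"
  unfolding trace_bounded_def
proof (intro allI impI, elim conjE)
  fix Y :: "(real^'n) set" and \<beta> R :: real and c
  assume Y: "finite Y" "Y \<noteq> {}" and \<beta>: "0 < \<beta>" and R: "\<forall>y\<in>Y. \<forall>i. \<bar>y $ i\<bar> \<le> R"
  let ?g = "gibbs_trace Y \<beta>"
  have [measurable]: "a \<in> borel_measurable borel" using a by auto
  have [measurable]: "(\<lambda>x. a x $ i $ j) \<in> borel_measurable borel" for i j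
    by (rule measurable_compose[where g = "\<lambda>M. M $ i $ j", OF _ borel_measurable_continuous_onI])
       (auto intro!: continuous_intros)
  have [measurable]: "partial_deriv j (\<lambda>x. gibbs_mean Y \<beta> c x $ i) \<in> borel_measurable borel" for i j c
    by (intro borel_measurable_continuous_onI continuous_on_partial_deriv_gibbs_mean Y)
  have nn: "0 \<le> ?g c y (a x)" for c x y
    using \<beta> psd by (intro gibbs_trace_nonneg) auto
  have "ennreal (?g c y (mollify r a y)) = (\<integral>\<^sup>+z. ennreal (tent r z) * ennreal (?g c y (a (y + z))) \<partial>lborel)" for y
  proof -
    have "ennreal (?g c y (mollify r a y)) = ennreal (LINT z|lborel. tent r z * ?g c y (a (y + z)))"
      using linear_mollify(2)[OF linear_gibbs_trace a r, of Y \<beta> c y y] by simp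
    also have "\<dots> = (\<integral>\<^sup>+z. ennreal (tent r z * ?g c y (a (y + z))) \<partial>lborel)"
      using linear_mollify(1)[OF linear_gibbs_trace a r, of Y \<beta> c y y]
      by (intro nn_integral_eq_integral[symmetric] AE_I2 mult_nonneg_nonneg nn tent_nonneg r) simp
    finally show ?thesis by (simp add: ennreal_mult nn tent_nonneg[OF r])
  qed
  then have "(\<integral>\<^sup>+y. ennreal (?g c y (mollify r a y)) \<partial>lborel) =
     (\<integral>\<^sup>+y. (\<integral>\<^sup>+z. ennreal (tent r z) * ennreal (?g c y (a (y + z))) \<partial>lborel) \<partial>lborel)"
    by simp
  also have "\<dots> = (\<integral>\<^sup>+z. (\<integral>\<^sup>+y. ennreal (tent r z) * ennreal (?g c y (a (y + z))) \<partial>lborel) \<partial>lborel)"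
    unfolding gibbs_trace_eq[OF Y] by (rule lborel_pair.Fubini') measurable
  also have "\<dots> \<le> (\<integral>\<^sup>+z. ennreal (tent r (z::real^'n)) * ennreal (C * R) \<partial>lborel)"
  proof (intro nn_integral_mono)
    fix z :: "real^'n"
    \<comment> \<open>With these intercepts the trace at \<open>y + z\<close> equals the original
      one at \<open>y\<close>. After substitution the bound for \<open>a\<close> applies with the
      same slopes, hence the same \<open>R\<close>.\<close>
    let ?c = "\<lambda>y. c y + z \<bullet> y"
    have "(\<integral>\<^sup>+y. ennreal (tent r z) * ennreal (?g c y (a (y + z))) \<partial>lborel) =
       ennreal (tent r z) * (\<integral>\<^sup>+y. ennreal (?g c y (a (y + z))) \<partial>lborel)"
      unfolding gibbs_trace_eq[OF Y] by (rule nn_integral_cmult) measurable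
    also have "(\<integral>\<^sup>+y. ennreal (?g c y (a (y + z))) \<partial>lborel) = (\<integral>\<^sup>+y. ennreal (?g ?c (y + z) (a (y + z))) \<partial>lborel)"
      by (simp add: gibbs_trace_translate[symmetric])
    also have "\<dots> = (\<integral>\<^sup>+x. ennreal (?g ?c x (a x)) \<partial>lborel)"
      by (rule nn_integral_lborel_translate[of "\<lambda>x. ennreal (?g ?c x (a x))"])
         (unfold gibbs_trace_eq[OF Y], measurable)
    also have "\<dots> \<le> ennreal (C * R)" using bound Y \<beta> R by (simp add: trace_bounded_def)
    finally show "(\<integral>\<^sup>+y. ennreal (tent r z) * ennreal (?g c y (a (y + z))) \<partial>lborel)
       \<le> ennreal (tent r z) * ennreal (C * R)" by (simp add: mult_left_mono)
  qed
  also have "\<dots> = ennreal (C * R)" by (subst nn_integral_multc) (auto simp: nn_integral_tent[OF r])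
  finally show "(\<integral>\<^sup>+y. ennreal (?g c y (mollify r a y)) \<partial>lborel) \<le> ennreal (C * R)" .
qed

section \<open>Semi-discrete transport cells\<close>

lemma continuous_on_Max_image:
  fixes f :: "'k \<Rightarrow> 'a::topological_space \<Rightarrow> real"
  assumes "finite K" "K \<noteq> {}" "\<And>k. k \<in> K \<Longrightarrow> continuous_on S (f k)"
  shows "continuous_on S (\<lambda>x. Max ((\<lambda>k. f k x) ` K))"
  using assms
proof (induction K rule: finite_ne_induct)
  case (insert k K)
  then have "continuous_on S (\<lambda>x. max (f k x) (Max ((\<lambda>k. f k x) ` K)))"
    by (intro continuous_on_max) auto
  with insert show ?case by simp
qed simp

text \<open>The dual functional of semi-discrete optimal transport is bounded below because the maximum
  dominates the \<open>m\<close>-average; a near-minimiser \<open>w\<close> already has cells of almost the right volume, so no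
  compactness argument is needed.\<close>
lemma relaxed_cells:
  fixes x :: "'k \<Rightarrow> 'a::euclidean_space" and m :: "'k \<Rightarrow> real"
  assumes K: "finite K" "K \<noteq> {}" and m: "\<And>k. k \<in> K \<Longrightarrow> 0 < m k"
    and Q: "measure lborel (cbox a b) = (\<Sum>k\<in>K. m k)" and "0 < (t::real)"
  obtains w where "\<And>k. k \<in> K \<Longrightarrow>
     m k - t \<le> measure lborel {y \<in> cbox a b. \<forall>l\<in>K. x l \<bullet> y - w l \<le> x k \<bullet> y - w k + t}"
proof -
  let ?Q = "cbox a b" and ?M = "\<Sum>k\<in>K. m k"
  have M: "0 < ?M" using K m by (intro sum_pos) auto
  define \<psi> where "\<psi> w y = Max ((\<lambda>k. x k \<bullet> y - w k) ` K)" for w y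
  define G where "G w = (LINT y|lborel. indicator ?Q y * \<psi> w y) + (\<Sum>k\<in>K. m k * w k)" for w
  have cont: "continuous_on ?Q (\<psi> w)" for w
    unfolding \<psi>_def by (intro continuous_on_Max_image K continuous_intros)
  have int\<psi>: "integrable lborel (\<lambda>y. indicator ?Q y * \<psi> w y)" for w
    using borel_integrable_compact[OF compact_cbox cont, of w] by simp
  have intx: "integrable lborel (\<lambda>y. indicator ?Q y * (x k \<bullet> y))" for k
    using borel_integrable_compact[OF compact_cbox, of a b "\<lambda>y. x k \<bullet> y"]
    by (simp add: continuous_intros)
  have intQ: "integrable lborel (indicator ?Q :: 'a \<Rightarrow> real)"
    by (rule integrable_real_indicator) (use emeasure_lborel_cbox_finite[of a b] in auto)
  have \<psi>_ge: "x k \<bullet> y - w k \<le> \<psi> w y" if "k \<in> K" for k w y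
    unfolding \<psi>_def using that K by (intro Max_ge) auto
  \<comment> \<open>Bounding the maximum below by its average with weights \<open>m k\<close>
    cancels every \<open>w k\<close>, because the volume of the box is the sum of the
    \<open>m k\<close>. What remains is independent of \<open>w\<close>.\<close>
  define c0 where "c0 = (\<Sum>k\<in>K. m k * (LINT y|lborel. indicator ?Q y * (x k \<bullet> y))) / ?M"
  have lower: "c0 \<le> G w" for w
  proof -
    have "(\<Sum>k\<in>K. m k * (x k \<bullet> y - w k)) \<le> (\<Sum>k\<in>K. m k * \<psi> w y)" for y
      using m \<psi>_ge by (intro sum_mono mult_left_mono) (auto intro: less_imp_le)
    then have "(\<Sum>k\<in>K. m k * (x k \<bullet> y - w k)) \<le> ?M * \<psi> w y" for y
      by (simp add: sum_distrib_right)
    then have "(LINT y|lborel. (\<Sum>k\<in>K. m k * (indicator ?Q y * (x k \<bullet> y) - w k * indicator ?Q y))) \<le>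
        (LINT y|lborel. ?M * (indicator ?Q y * \<psi> w y))"
    proof (intro integral_mono Bochner_Integration.integrable_sum integrable_mult_right Bochner_Integration.integrable_diff int\<psi> intx intQ)
      fix y
      show "(\<Sum>k\<in>K. m k * (indicator ?Q y * (x k \<bullet> y) - w k * indicator ?Q y)) \<le> ?M * (indicator ?Q y * \<psi> w y)"
        using \<open>(\<Sum>k\<in>K. m k * (x k \<bullet> y - w k)) \<le> ?M * \<psi> w y\<close> by (cases "y \<in> ?Q") auto
    qed
    also have "(LINT y|lborel. (\<Sum>k\<in>K. m k * (indicator ?Q y * (x k \<bullet> y) - w k * indicator ?Q y))) =
        (\<Sum>k\<in>K. m k * ((LINT y|lborel. indicator ?Q y * (x k \<bullet> y)) - w k * measure lborel ?Q))"
    proof -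
      have i: "integrable lborel (\<lambda>y. indicator ?Q y * (x k \<bullet> y) - w k * indicator ?Q y)" for k
        by (intro Bochner_Integration.integrable_diff intx integrable_mult_right intQ)
      have "(LINT y|lborel. indicator ?Q y * (x k \<bullet> y) - w k * indicator ?Q y) =
          (LINT y|lborel. indicator ?Q y * (x k \<bullet> y)) - w k * measure lborel ?Q" for k
        by (subst Bochner_Integration.integral_diff[OF intx integrable_mult_right[OF intQ]]) simp
      then show ?thesis
        by (subst Bochner_Integration.integral_sum[OF integrable_mult_right[OF i]]) simp
    qed
    also have "\<dots> = c0 * ?M - ?M * (\<Sum>k\<in>K. m k * w k)"
    proof -
      have "c0 * ?M = (\<Sum>k\<in>K. m k * (LINT y|lborel. indicator ?Q y * (x k \<bullet> y)))"
        using M by (simp add: c0_def)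
      then show ?thesis unfolding Q
        by (simp add: right_diff_distrib sum_subtractf sum_distrib_left mult_ac)
    qed
    also have "(LINT y|lborel. ?M * (indicator ?Q y * \<psi> w y)) = ?M * (LINT y|lborel. indicator ?Q y * \<psi> w y)"
      by simp
    finally have "?M * c0 \<le> ?M * G w" unfolding G_def by (simp add: algebra_simps)
    then show ?thesis using M by simp
  qed
  \<comment> \<open>The slack is \<open>t^2\<close> because it is divided below by the step length
    \<open>t\<close>.\<close>
  have "\<exists>w. G w < Inf (range G) + t\<^sup>2"
    using cInf_lessD[of "range G" "Inf (range G) + t\<^sup>2"] \<open>0 < t\<close> by auto
  then obtain w where w: "G w < Inf (range G) + t\<^sup>2" by blast
  have "bdd_below (range G)" by (rule bdd_belowI[of _ c0]) (use lower in blast)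
  then have near: "G w \<le> G w' + t\<^sup>2" for w'
    using w cInf_lower[of "G w'" "range G"] by fastforce
  show ?thesis
  proof (rule that[of w])
    fix k assume k: "k \<in> K"
    let ?V = "{y \<in> ?Q. \<forall>l\<in>K. x l \<bullet> y - w l \<le> x k \<bullet> y - w k + t}"
    have "?V = ?Q \<inter> (\<Inter>l\<in>K. {y. x l \<bullet> y - w l \<le> x k \<bullet> y - w k + t})" by auto
    moreover have "closed (?Q \<inter> (\<Inter>l\<in>K. {y. x l \<bullet> y - w l \<le> x k \<bullet> y - w k + t}))"
      by (intro closed_Int closed_cbox closed_INT ballI closed_Collect_le continuous_intros)
    ultimately have "closed ?V" by (simp only:)
    then have Vm[measurable]: "?V \<in> sets borel" by auto
    have Vf: "emeasure lborel ?V < \<infinity>"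
      by (intro emeasure_bounded_finite bounded_subset[OF bounded_cbox[of a b]]) auto
    \<comment> \<open>Lowering \<open>w k\<close> by \<open>t\<close> lifts the affine function of
      \<open>k\<close> by \<open>t\<close>. The maximum then grows by at most \<open>t\<close>, and
      only on the relaxed cell \<open>?V\<close>, while the linear term drops by
      \<open>t * m k\<close>; near-minimality compares the two.\<close>
    define w' where "w' = w(k := w k - t)"
    have step: "\<psi> w' y \<le> \<psi> w y + t * indicator ?V y" if yQ: "y \<in> ?Q" for y
      unfolding \<psi>_def[of w']
    proof (subst Max_le_iff)
      show "\<forall>u\<in>(\<lambda>k. x k \<bullet> y - w' k) ` K. u \<le> \<psi> w y + t * indicator ?V y"
      proof (safe)
        fix l assume l: "l \<in> K"
        show "x l \<bullet> y - w' l \<le> \<psi> w y + t * indicator ?V y"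
        proof (cases "l = k \<and> y \<notin> ?V")
          case True
          then obtain l' where "l' \<in> K" "x l' \<bullet> y - w l' > x k \<bullet> y - w k + t" using yQ by auto
          then show ?thesis using True \<psi>_ge[of l' y w] by (auto simp: w'_def)
        next
          case False
          then show ?thesis using \<psi>_ge[OF l, of y w] \<open>0 < t\<close> by (cases "l = k") (auto simp: w'_def indicator_def)
        qed
      qed
    qed (use K in auto)
    have "(LINT y|lborel. indicator ?Q y * \<psi> w' y) \<le> (LINT y|lborel. indicator ?Q y * \<psi> w y + t * indicator ?V y)"
      using int\<psi> Vf step
      by (intro integral_mono Bochner_Integration.integrable_add integrable_mult_right integrable_real_indicator)
         (auto simp: indicator_def)
    also have "\<dots> = (LINT y|lborel. indicator ?Q y * \<psi> w y) + t * measure lborel ?V"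
      using Vf by (subst Bochner_Integration.integral_add[OF int\<psi>]) auto
    finally have 1: "(LINT y|lborel. indicator ?Q y * \<psi> w' y) \<le> (LINT y|lborel. indicator ?Q y * \<psi> w y) + t * measure lborel ?V" .
    have "(\<Sum>k\<in>K. m k * w' k) = (\<Sum>k\<in>K. m k * w k) - m k * t"
      using K k by (simp add: w'_def sum.remove[of K k] algebra_simps)
    then have "G w' \<le> G w + t * measure lborel ?V - m k * t" using 1 by (simp add: G_def)
    then have "t * m k \<le> t * (measure lborel ?V + t)"
      using near[of w'] by (simp add: power2_eq_square algebra_simps)
    then show "m k - t \<le> measure lborel ?V" using \<open>0 < t\<close> by simp
  qed
qed

text \<open>A set of diameter at most \<open>s\<close> lies in a cube of side \<open>2 * s\<close>
  around any of its points. The factor 2 in front leaves room, so no extremal pair has to exist: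
  \<open>s\<close> is chosen so that this cube has only half of the required volume.\<close>

lemma measure_le_diameter_power:
  fixes S :: "(real^'n) set"
  assumes S: "S \<in> lmeasurable" and pos: "0 < measure lebesgue S"
  obtains p q where "p \<in> S" "q \<in> S" "measure lebesgue S \<le> 2 * (2 * norm (p - q)) ^ CARD('n)"
proof (rule ccontr)
  assume neg: "\<not> thesis"
  note thesisI = that
  let ?v = "measure lebesgue S" and ?d = "CARD('n)"
  define s where "s = root ?d (?v / 2) / 2"
  have s: "(2 * s) ^ ?d = ?v / 2" "0 < s" using pos by (auto simp: s_def real_root_pow_pos2)
  have close: "norm (p - q) \<le> s" if "p \<in> S" "q \<in> S" for p q
  proof (rule ccontr)
    assume "\<not> ?thesis"
    then have "(2 * s) ^ ?d \<le> (2 * norm (p - q)) ^ ?d" using s by (intro power_mono) auto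
    then have "?v \<le> 2 * (2 * norm (p - q)) ^ ?d" using s(1) by linarith
    with neg thesisI[of p q] \<open>p \<in> S\<close> \<open>q \<in> S\<close> show False by blast
  qed
  have "S \<noteq> {}" using pos by auto
  then obtain p where p: "p \<in> S" by blast
  let ?C = "cbox (p - (\<chi> i. s)) (p + (\<chi> i. s))"
  have "S \<subseteq> ?C"
  proof
    fix q assume "q \<in> S"
    then have "\<bar>(p - q) $ i\<bar> \<le> s" for i using close[OF p] component_le_norm_cart[of "p - q" i] by fastforce
    then show "q \<in> ?C" by (simp add: mem_box_cart abs_le_iff) (smt (verit))
  qed
  then have "?v \<le> measure lebesgue ?C" by (rule measure_mono_fmeasurable) (use S in auto)
  also have "\<dots> = (2 * s) ^ ?d"
  proof -
    have "?C \<noteq> {}" using s by (auto simp: interval_ne_empty_cart)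
    then have "measure lborel ?C = (2 * s) ^ ?d"
      by (subst content_cbox_cart) (auto simp: algebra_simps)
    then show ?thesis by (simp add: measure_completion)
  qed
  finally show False using s pos by simp
qed

section \<open>Ellipsoidal bumps\<close>

text \<open>The library's \<open>measure_linear_image\<close> requires the index type to be in \<open>wellorder\<close>.\<close>
lemma matrix_image_measure:
  fixes A :: "real^'n^'n" and S :: "(real^'n) set"
  assumes "S \<in> lmeasurable"
  shows "(*v) A ` S \<in> lmeasurable" "measure lebesgue ((*v) A ` S) = \<bar>det A\<bar> * measure lebesgue S"
proof -
  let ?P = "\<lambda>A::real^'n^'n. \<forall>S. S \<in> lmeasurable \<longrightarrow>
     (*v) A ` S \<in> lmeasurable \<and> measure lebesgue ((*v) A ` S) = \<bar>det A\<bar> * measure lebesgue S"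
  \<comment> \<open>For swaps and shears, whose determinant has absolute value 1, it suffices to
    examine boxes.\<close>
  have suff: "?P A" if A: "\<And>a b. measure lebesgue ((*v) A ` cbox a b) = measure lebesgue (cbox a b)" "\<bar>det A\<bar> = 1" for A
  proof (intro allI impI)
    fix S :: "(real^'n) set" assume "S \<in> lmeasurable"
    then have "(*v) A ` S \<in> lmeasurable \<and> 1 * measure lebesgue S = measure lebesgue ((*v) A ` S)"
      by (rule measure_linear_sufficient[OF matrix_vector_mul_linear]) (simp only: A(1) mult_1)
    then show "(*v) A ` S \<in> lmeasurable \<and> measure lebesgue ((*v) A ` S) = \<bar>det A\<bar> * measure lebesgue S"
      by (simp only: A(2))
  qed
  have "?P A"
  proof (rule induct_matrix_elementary_alt[of ?P])
    fix A B :: "real^'n^'n" assume A: "?P A" and B: "?P B"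
    have "(*v) (A ** B) ` S = (*v) A ` ((*v) B ` S)" for S
      by (simp add: image_image matrix_vector_mul_assoc)
    then show "?P (A ** B)" using A B by (simp add: det_mul abs_mult)
  next
    fix A :: "real^'n^'n" and i assume i: "row i A = 0"
    have "A $ i = 0" using i by (simp add: row_def vec_eq_iff)
    then have "(*v) A ` S \<subseteq> {x. x $ i = 0}" for S
      by (auto simp: matrix_vector_mul_component)
    then have "negligible ((*v) A ` S)" for S
      using negligible_subset[OF negligible_standard_hyperplane_cart] by blast
    then show "?P A" using det_zero_row(1)[OF i] by (simp add: negligible_iff_measure)
  next
    fix A :: "real^'n^'n" assume A: "\<And>i j. i \<noteq> j \<Longrightarrow> A $ i $ j = 0"
    have "(\<Sum>j\<in>UNIV. A $ i $ j * x $ j) = A $ i $ i * x $ i" for i x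
      by (subst sum.remove[of UNIV i]) (auto simp: A intro!: sum.neutral)
    then have "(*v) A = (\<lambda>x. \<chi> i. A $ i $ i * x $ i)"
      by (simp add: matrix_vector_mult_def fun_eq_iff)
    then show "?P A" using A by (simp add: measurable_stretch measure_stretch det_diagonal)
  next
    fix m n :: 'n assume mn: "m \<noteq> n"
    let ?t = "Transposition.transpose m n"
    let ?A = "(\<chi> i j. mat 1 $ i $ ?t j) :: real^'n^'n"
    let ?h = "\<lambda>x::real^'n. \<chi> i. x $ ?t i"
    have h: "(*v) ?A = ?h"
    proof
      fix x :: "real^'n"
      have "(\<Sum>j\<in>UNIV. mat 1 $ i $ ?t j * x $ j) = x $ ?t i" for i
      proof -
        have "(\<Sum>j\<in>UNIV. mat 1 $ i $ ?t j * x $ j) =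
          (\<Sum>j\<in>UNIV. if j = ?t i then x $ j else 0)"
          by (intro sum.cong) (auto simp: mat_def)
        then show ?thesis by simp
      qed
      then show "?A *v x = ?h x" by (simp add: matrix_vector_mult_def)
    qed
    show "?P ?A"
    proof (rule suff)
      show "measure lebesgue ((*v) ?A ` cbox a b) = measure lebesgue (cbox a b)" for a b
      proof (cases "cbox a b = {}")
        case False
        have inv: "?h (?h x) = x" for x by (simp add: vec_eq_iff)
        have box: "?h x \<in> cbox (?h c) (?h d)" if "x \<in> cbox c d" for x c d
          using that by (simp add: mem_box_cart)
        have im: "?h ` cbox a b = cbox (?h a) (?h b)"
        proof (intro equalityI subsetI)
          fix y assume "y \<in> cbox (?h a) (?h b)"
          from box[OF this] have "?h y \<in> cbox a b" by (simp only: inv)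
          then show "y \<in> ?h ` cbox a b" by (rule rev_image_eqI[where f = ?h]) (rule inv[symmetric])
        qed (use box in auto)
        moreover have "cbox (?h a) (?h b) \<noteq> {}" using False im by auto
        moreover have "(\<Prod>i\<in>UNIV. b $ ?t i - a $ ?t i) = (\<Prod>i\<in>UNIV. b $ i - a $ i)"
          by (rule prod.reindex_bij_betw) (rule bij_transpose)
        ultimately show ?thesis using False by (simp add: h content_cbox_cart)
      qed simp
      show "\<bar>det ?A\<bar> = 1"
        by (subst det_permute_columns[OF permutes_swap_id]) (simp_all add: sign_swap_id mn)
    qed
  next
    fix m n :: 'n assume mn: "m \<noteq> n"
    let ?A = "(\<chi> i j. of_bool (i = m \<and> j = n \<or> i = j)) :: real^'n^'n"
    let ?h = "\<lambda>x::real^'n. \<chi> i. if i = m then x $ m + x $ n else x $ i"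
    have h: "(*v) ?A = ?h"
    proof
      fix x :: "real^'n"
      have "(\<Sum>j\<in>UNIV. of_bool (i = m \<and> j = n \<or> i = j) * x $ j) = (if i = m then x $ m + x $ n else x $ i)" for i
      proof -
        have "(\<Sum>j\<in>UNIV. of_bool (i = m \<and> j = n \<or> i = j) * x $ j) =
           (\<Sum>j\<in>UNIV. (if j = i then x $ j else 0) + (if j = n then (if i = m then x $ j else 0) else 0))"
          using mn by (intro sum.cong) auto
        then show ?thesis by (simp add: sum.distrib)
      qed
      then show "?A *v x = ?h x" by (simp add: matrix_vector_mult_def)
    qed
    show "?P ?A"
    proof (rule suff)
      show "measure lebesgue ((*v) ?A ` cbox a b) = measure lebesgue (cbox a b)" for a b
      proof (cases "cbox a b = {}")
        case False
        \<comment> \<open>The formula for a sheared box asks for a nonnegative lower end in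
          direction \<open>n\<close>; this translation moves that end to 0.\<close>
        define v :: "real^'n" where "v = axis n (- a $ n)"
        have tr: "measure lebesgue (f ` (+) v ` cbox a b) = measure lebesgue (f ` cbox a b)"
          if "linear f" for f :: "real^'n \<Rightarrow> real^'n"
        proof -
          have "f ` (+) v ` cbox a b = (+) (f v) ` f ` cbox a b"
            using linear_add[OF that] by (simp add: image_image)
          then show ?thesis by (simp only: measure_translation)
        qed
        have bx: "(+) v ` cbox a b = cbox (v + a) (v + b)" by (rule cbox_translation[symmetric])
        have "measure lebesgue ((*v) ?A ` cbox a b) = measure lebesgue ((*v) ?A ` cbox (v + a) (v + b))"
          using tr[OF matrix_vector_mul_linear[of ?A]] bx by (simp only:)
        also have "\<dots> = measure lebesgue (cbox (v + a) (v + b))"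
          unfolding h using False mn bx by (intro measure_shear_interval) (auto simp: v_def axis_def)
        also have "\<dots> = measure lebesgue (cbox a b)"
          using bx measure_translation[of v "cbox a b"] by (simp only:)
        finally show ?thesis .
      qed simp
      have "det ?A = det (\<chi> k. if k = m then row m (mat 1) + 1 *s row n (mat 1) else row k (mat 1 :: real^'n^'n))"
        using mn by (intro arg_cong[where f = det]) (auto simp: vec_eq_iff row_def mat_def)
      also have "\<dots> = 1" by (subst det_row_operation[OF mn]) simp
      finally show "\<bar>det ?A\<bar> = 1" by simp
    qed
  qed
  then show "(*v) A ` S \<in> lmeasurable" "measure lebesgue ((*v) A ` S) = \<bar>det A\<bar> * measure lebesgue S"
    using assms by blast+
qed

text \<open>Translation invariance gives every difference quotient of \<open>u\<close> integral 0.
  The mean value theorem bounds the quotients by \<open>B\<close>, and steps of length at most 1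
  keep their supports in one ball, so dominated convergence passes to the derivative.\<close>

lemma integral_partial_derivative_zero:
  fixes u :: "'a::euclidean_space \<Rightarrow> real"
  assumes u: "\<And>x. (u has_derivative u' x) (at x)"
    and K: "bounded K" "\<And>x. x \<notin> K \<Longrightarrow> u x = 0"
    and B: "\<And>x. \<bar>u' x v\<bar> \<le> B" and meas: "(\<lambda>x. u' x v) \<in> borel_measurable borel"
  shows "(LINT x|lborel. u' x v) = 0"
proof -
  have cont: "continuous_on S u" for S
    using u by (meson continuous_at_imp_continuous_on has_derivative_continuous)
  then have [measurable]: "u \<in> borel_measurable borel" by (intro borel_measurable_continuous_onI)
  obtain r where r: "0 < r" "K \<subseteq> cball 0 r" 
    using bounded_subset_ballD[OF K(1), of 0] ball_subset_cball by blast
  have u0: "u x = 0" if "x \<notin> cball 0 r" for x using K(2) r that by blast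
  have intu: "integrable lborel u"
  proof -
    have "integrable lborel (\<lambda>x. indicator (cball 0 r) x *\<^sub>R u x)"
      by (intro borel_integrable_compact compact_cball cont)
    moreover have "(\<lambda>x. indicator (cball 0 r) x *\<^sub>R u x) = u"
      using u0 by (auto simp: fun_eq_iff indicator_def)
    ultimately show ?thesis by simp
  qed
  have line: "((\<lambda>t. u (x + t *\<^sub>R v)) has_real_derivative u' (x + t *\<^sub>R v) v) (at t)" for x t
  proof -
    have "((\<lambda>t. u (x + t *\<^sub>R v)) has_derivative (\<lambda>h. u' (x + t *\<^sub>R v) (h *\<^sub>R v))) (at t)"
      by (rule has_derivative_compose[OF _ u, of "\<lambda>t. x + t *\<^sub>R v", simplified])
         (auto intro!: derivative_eq_intros)
    then show ?thesis
      using linear_scale[OF has_derivative_linear[OF u]]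
      by (simp add: has_field_derivative_def mult.commute[of _ "u' (x + t *\<^sub>R v) v"])
  qed
  define h where "h n = 1 / real (Suc n)" for n
  define D where "D n x = (u (x + h n *\<^sub>R v) - u x) / h n" for n x
  have h: "0 < h n" "h n \<le> 1" for n by (auto simp: h_def)
  have Db: "\<bar>D n x\<bar> \<le> B" for n x
  proof -
    have "\<exists>z>0. z < h n \<and> u (x + h n *\<^sub>R v) - u (x + 0 *\<^sub>R v) = (h n - 0) * u' (x + z *\<^sub>R v) v"
      by (rule MVT2[OF h(1)]) (rule line)
    then obtain z where "u (x + h n *\<^sub>R v) - u (x + 0 *\<^sub>R v) = (h n - 0) * u' (x + z *\<^sub>R v) v"
      by blast
    then show ?thesis using B h[of n] by (simp add: D_def)
  qed
  have D0: "D n x = 0" if "x \<notin> cball 0 (r + norm v)" for n x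
  proof -
    have "norm (h n *\<^sub>R v) \<le> norm v" using h[of n] by (simp add: mult_left_le_one_le)
    then have "x + h n *\<^sub>R v \<notin> cball 0 r" "x \<notin> cball 0 r"
      using that norm_diff_ineq[of x "h n *\<^sub>R v"] norm_ge_zero[of v] by (auto simp: not_le simp del: norm_ge_zero)
    then show ?thesis by (simp add: D_def u0)
  qed
  have "0 \<le> B" using B[of undefined] by linarith
  have "(\<lambda>n. LINT x|lborel. D n x) \<longlonglongrightarrow> (LINT x|lborel. u' x v)"
  proof (rule integral_dominated_convergence[where w = "\<lambda>x. B * indicator (cball 0 (r + norm v)) x"])
    show "integrable lborel (\<lambda>x. B * indicator (cball 0 (r + norm v)) x)"
      by (intro integrable_mult_right integrable_real_indicator)
         (use emeasure_bounded_finite[OF bounded_cball] in auto)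
    show "AE x in lborel. (\<lambda>n. D n x) \<longlonglongrightarrow> u' x v"
    proof (rule AE_I2)
      fix x
      have "((\<lambda>t. (u (x + t *\<^sub>R v) - u x) / t) \<longlongrightarrow> u' x v) (at 0)"
        using line[of x 0] by (simp add: DERIV_def)
      moreover have "h \<longlonglongrightarrow> 0"
        using LIMSEQ_inverse_real_of_nat by (simp add: h_def[abs_def] inverse_eq_divide)
      then have "filterlim h (at 0) sequentially"
        using less_imp_neq[OF h(1)] by (auto simp: filterlim_at intro!: always_eventually)
      ultimately show "(\<lambda>n. D n x) \<longlonglongrightarrow> u' x v"
        unfolding D_def by (rule filterlim_compose)
    qed
    show "AE x in lborel. norm (D n x) \<le> B * indicator (cball 0 (r + norm v)) x" for n
      using Db D0 by (intro AE_I2) (auto simp: indicator_def)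
  qed (use meas in \<open>auto simp: D_def\<close>)
  moreover have "(LINT x|lborel. D n x) = 0" for n
  proof -
    have "(LINT x|lborel. D n x) = ((LINT x|lborel. u (x + h n *\<^sub>R v)) - (LINT x|lborel. u x)) / h n"
      unfolding D_def by (simp add: Bochner_Integration.integral_diff[OF integrable_lborel_translate[OF intu] intu])
    also have "\<dots> = 0" by (simp add: integral_lborel_translate)
    finally show ?thesis .
  qed
  ultimately have "(\<lambda>n. 0) \<longlonglongrightarrow> (LINT x|lborel. u' x v)" by simp
  then show ?thesis by (simp add: LIMSEQ_const_iff)
qed

section \<open>Radial bumps on ellipsoids and the gain at a kink\<close>

definition ell_dist :: "real^'n^'n \<Rightarrow> real^'n \<Rightarrow> real \<Rightarrow> real^'n \<Rightarrow> real" where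
  "ell_dist M x0 r x = (norm (M *v (x - x0)))\<^sup>2 / r\<^sup>2"

text \<open>Squaring the positive part makes the bump continuously differentiable across the
  boundary of the ellipsoid, which is all that a single integration by parts requires.\<close>

definition ell_bump :: "real^'n^'n \<Rightarrow> real^'n \<Rightarrow> real \<Rightarrow> real^'n \<Rightarrow> real" where
  "ell_bump M x0 r x = (max 0 (1 - ell_dist M x0 r x))\<^sup>2"

text \<open>The scalar factor in minus the gradient of \<open>ell_bump\<close>: one factor 2 comes
  from the outer square and one from the quadratic form \<open>ell_dist\<close>.\<close>

definition ell_weight :: "real^'n^'n \<Rightarrow> real^'n \<Rightarrow> real \<Rightarrow> real^'n \<Rightarrow> real" where
  "ell_weight M x0 r x = 4 / r\<^sup>2 * max 0 (1 - ell_dist M x0 r x)"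

lemma square_pos_part_derivative:
  "((\<lambda>t. (max 0 t)\<^sup>2) has_real_derivative 2 * max 0 t) (at (t::real))"
proof (cases t "0::real" rule: linorder_cases)
  case less
  have "((\<lambda>t. 0) has_real_derivative 2 * max 0 t) (at t)" using less by simp
  then show ?thesis
    by (subst DERIV_cong_ev[OF refl _ refl, of _ "\<lambda>t. 0"])
       (use less in \<open>auto intro!: eventually_nhds_in_open[of "{..<0}", THEN eventually_mono]\<close>)
next
  case greater
  have "((\<lambda>t. t\<^sup>2) has_real_derivative 2 * max 0 t) (at t)"
    using greater by (auto intro!: derivative_eq_intros)
  then show ?thesis
    by (subst DERIV_cong_ev[OF refl _ refl, of _ "\<lambda>t. t\<^sup>2"])
       (use greater in \<open>auto intro!: eventually_nhds_in_open[of "{0<..}", THEN eventually_mono]\<close>)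
next
  case equal
  have "((\<lambda>h. (max 0 h)\<^sup>2 / h) \<longlongrightarrow> 0) (at (0::real))"
  proof (rule Lim_null_comparison)
    show "\<forall>\<^sub>F h in at 0. norm ((max 0 h)\<^sup>2 / h) \<le> \<bar>h::real\<bar>"
      by (auto simp: max_def power2_eq_square intro!: always_eventually)
  qed (auto intro!: tendsto_eq_intros)
  then show ?thesis using equal by (simp add: DERIV_def)
qed

lemma ell_bump_has_derivative:
  "(ell_bump M x0 r has_derivative (\<lambda>h. - ell_weight M x0 r x * ((M *v (x - x0)) \<bullet> (M *v h)))) (at x)"
proof -
  have "((\<lambda>x. M *v (x - x0)) has_derivative (\<lambda>h. M *v h)) (at x)"
    by (rule has_derivative_compose[of "\<lambda>x. x - x0" "\<lambda>h. h", unfolded o_def])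
       (auto intro!: derivative_eq_intros bounded_linear_imp_has_derivative matrix_vector_mul_bounded_linear)
  then have "((\<lambda>x. 1 - ((M *v (x - x0)) \<bullet> (M *v (x - x0))) * k) has_derivative
      (\<lambda>h. - (2 * ((M *v (x - x0)) \<bullet> (M *v h)) * k))) (at x)" for k
    by (auto intro!: derivative_eq_intros simp: inner_commute)
  from this[of "inverse (r\<^sup>2)"]
  have "((\<lambda>x. 1 - ell_dist M x0 r x) has_derivative (\<lambda>h. - (2 * ((M *v (x - x0)) \<bullet> (M *v h)) / r\<^sup>2))) (at x)"
    unfolding ell_dist_def power2_norm_eq_inner divide_inverse .
  from has_derivative_compose[OF this square_pos_part_derivative[unfolded has_field_derivative_def]]
  show ?thesis
    unfolding ell_bump_def ell_weight_def
    by (rule has_derivative_eq_rhs) (simp add: fun_eq_iff)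
qed

lemma ell_weight_nonneg: "0 \<le> ell_weight M x0 r x"
  by (simp add: ell_weight_def)

lemma continuous_ell:
  "continuous_on S (ell_bump M x0 r)" "continuous_on S (ell_weight M x0 r)"
proof -
  have "continuous_on S (\<lambda>x. M *v (x - x0))"
    by (intro continuous_on_compose2[OF matrix_vector_mult_linear_continuous_on] continuous_intros) auto
  then have "continuous_on S (ell_dist M x0 r)"
    unfolding ell_dist_def divide_inverse by (intro continuous_intros)
  then show "continuous_on S (ell_bump M x0 r)" "continuous_on S (ell_weight M x0 r)"
    unfolding ell_bump_def[abs_def] ell_weight_def[abs_def] by (intro continuous_intros; assumption)+
qed

text \<open>In the coordinates \<open>M *v (x - x0)\<close> the ellipsoid \<open>E\<close> is a ball
  of radius \<open>r\<close>, and the constant matrix \<open>L ** transpose L\<close> becomes the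
  identity.\<close>

locale ellipsoid =
  fixes L M :: "real^'n^'n" and x0 :: "real^'n" and r :: real
  assumes L_M: "L ** M = mat 1" and M_L: "M ** L = mat 1" and r: "0 < r"
begin

abbreviation "E \<equiv> (\<lambda>z. x0 + L *v z) ` ball 0 r"
abbreviation "E' \<equiv> (\<lambda>z. x0 + L *v z) ` cball 0 r"

lemma E_iff: "x \<in> E \<longleftrightarrow> norm (M *v (x - x0)) < r" and E'_iff: "x \<in> E' \<longleftrightarrow> norm (M *v (x - x0)) \<le> r"
proof -
  have 1: "x = x0 + L *v (M *v (x - x0))" by (simp add: matrix_vector_mul_assoc L_M)
  have 2: "M *v (x0 + L *v z - x0) = z" for z by (simp add: matrix_vector_mul_assoc M_L)
  show "x \<in> E \<longleftrightarrow> norm (M *v (x - x0)) < r" "x \<in> E' \<longleftrightarrow> norm (M *v (x - x0)) \<le> r"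
    using 1 2 by (auto simp: image_iff intro!: bexI[of _ "M *v (x - x0)"])
qed

lemma compact_E': "compact E'"
  by (intro compact_continuous_image compact_cball continuous_intros
      continuous_on_compose2[OF matrix_vector_mult_linear_continuous_on]) auto

lemma bump_outside: "x \<notin> E \<Longrightarrow> ell_bump M x0 r x = 0"
  and weight_outside: "x \<notin> E \<Longrightarrow> ell_weight M x0 r x = 0"
proof -
  assume "x \<notin> E"
  then have "r\<^sup>2 \<le> (norm (M *v (x - x0)))\<^sup>2" using r by (intro power_mono) (auto simp: E_iff)
  then have "1 \<le> ell_dist M x0 r x" using r by (simp add: ell_dist_def)
  then show "ell_bump M x0 r x = 0" "ell_weight M x0 r x = 0" by (simp_all add: ell_bump_def ell_weight_def)
qed

lemma E_subset_E': "E \<subseteq> E'" by auto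

lemma bump_le_1: "ell_bump M x0 r x \<le> 1"
  unfolding ell_bump_def by (rule power_le_one) (auto simp: ell_dist_def)

lemma integrable_compact_support:
  fixes f :: "real^'n \<Rightarrow> real"
  assumes "continuous_on UNIV f" "\<And>x. x \<notin> E \<Longrightarrow> f x = 0"
  shows "integrable lborel f"
proof -
  have "integrable lborel (\<lambda>x. indicator E' x *\<^sub>R f x)"
    by (intro borel_integrable_compact compact_E' continuous_on_subset[OF assms(1)]) auto
  moreover have "(\<lambda>x. indicator E' x *\<^sub>R f x) = f"
    using assms(2) E_subset_E' by (fastforce simp: fun_eq_iff indicator_def)
  ultimately show ?thesis by simp
qed

text \<open>\<open>M\<close> is inverse to \<open>L\<close>, so \<open>L ** transpose L\<close> is
  inverse to \<open>transpose M ** M\<close>, the matrix that occurs in the gradient of the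
  bump.\<close>

lemma shape_cancel: "(\<Sum>j\<in>UNIV. (L ** transpose L) $ i $ j * ((M *v y) \<bullet> (M *v axis j 1))) = y $ i"
proof -
  have adj: "(M *v y) \<bullet> (M *v axis j 1) = (transpose M *v (M *v y)) $ j" for j
    by (simp only: dot_lmul_matrix[symmetric] transpose_matrix_vector inner_axis) simp
  have "(\<Sum>j\<in>UNIV. (L ** transpose L) $ i $ j * ((M *v y) \<bullet> (M *v axis j 1))) =
     ((L ** transpose L) *v (transpose M *v (M *v y))) $ i"
    unfolding adj matrix_vector_mult_def[of "L ** transpose L"] by (simp only: vec_lambda_beta)
  also have "(L ** transpose L) *v (transpose M *v (M *v y)) = L *v ((transpose L ** transpose M) *v (M *v y))"
    by (simp only: matrix_vector_mul_assoc matrix_mul_assoc)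
  also have "transpose L ** transpose M = mat 1"
    by (simp only: matrix_transpose_mul[symmetric] M_L transpose_mat)
  also have "L *v (mat 1 *v (M *v y)) = y"
    by (simp add: matrix_vector_mul_assoc L_M)
  finally show ?thesis .
qed

text \<open>The gradient of the bump is radial after multiplication by \<open>L L\<^sup>T\<close>.\<close>
lemma integral_by_parts:
  fixes T :: "real^'n \<Rightarrow> real^'n" and T' :: "'n \<Rightarrow> real^'n \<Rightarrow> real^'n \<Rightarrow> real"
  assumes T: "\<And>i x. ((\<lambda>x. T x $ i) has_derivative T' i x) (at x)"
    and T': "\<And>i j. continuous_on UNIV (\<lambda>x. T' i x (axis j 1))"
  shows "(LINT x|lborel. ell_bump M x0 r x * (\<Sum>i\<in>UNIV. \<Sum>j\<in>UNIV. (L ** transpose L) $ i $ j * T' i x (axis j 1)))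
     = (LINT x|lborel. ell_weight M x0 r x * ((x - x0) \<bullet> T x))"
proof -
  let ?\<eta> = "ell_bump M x0 r" and ?w = "ell_weight M x0 r" and ?A = "L ** transpose L"
  have Tc: "continuous_on UNIV (\<lambda>x. T x $ i)" for i
    using T by (meson continuous_at_imp_continuous_on has_derivative_continuous)
  \<comment> \<open>The \<open>j\<close>-th partial derivative of the bump times component
    \<open>i\<close> of \<open>T\<close>; being continuous with compact support, it integrates to
    0.\<close>
  let ?D = "\<lambda>i j x. ?\<eta> x * T' i x (axis j 1) + (- ?w x * ((M *v (x - x0)) \<bullet> (M *v axis j 1))) * T x $ i"
  have MC: "continuous_on UNIV (\<lambda>x. M *v (x - x0))"
    by (intro continuous_on_compose2[OF matrix_vector_mult_linear_continuous_on] continuous_intros) auto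
  have Dc: "continuous_on UNIV (?D i j)" for i j
    by (intro continuous_intros continuous_ell T' Tc MC)
  have D0: "?D i j x = 0" if "x \<notin> E" for i j x
    using bump_outside[OF that] weight_outside[OF that] by simp
  have Dint: "integrable lborel (?D i j)" for i j
    by (rule integrable_compact_support[OF Dc D0])
  have zero: "(LINT x|lborel. ?D i j x) = 0" for i j
  proof -
    have "bounded (?D i j ` E')"
      by (intro compact_imp_bounded compact_continuous_image compact_E' continuous_on_subset[OF Dc]) auto
    then obtain B where B0: "0 < B" "\<forall>y\<in>?D i j ` E'. norm y \<le> B" unfolding bounded_pos by blast
    have B: "0 < B" "\<bar>?D i j x\<bar> \<le> B" if "x \<in> E'" for x
      using B0 imageI[OF that, of "?D i j"] by (simp_all only: real_norm_def)
    show ?thesis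
    proof (rule integral_partial_derivative_zero[where u = "\<lambda>x. ?\<eta> x * T x $ i" and K = E and B = B and v = "axis j 1"
        and u' = "\<lambda>x h. ?\<eta> x * T' i x h + (- ?w x * ((M *v (x - x0)) \<bullet> (M *v h))) * T x $ i"])
      show "((\<lambda>x. ?\<eta> x * T x $ i) has_derivative (\<lambda>h. ?\<eta> x * T' i x h + (- ?w x * ((M *v (x - x0)) \<bullet> (M *v h))) * T x $ i)) (at x)" for x
        by (rule has_derivative_mult[OF ell_bump_has_derivative T])
      show "bounded E" using bounded_subset[OF compact_imp_bounded[OF compact_E'] E_subset_E'] .
      show "\<bar>?D i j x\<bar> \<le> B" for x
      proof (cases "x \<in> E'")
        case False
        then have "x \<notin> E" using E_subset_E' by blast
        from D0[OF this, of i j] B0(1) show ?thesis by simp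
      qed (rule B(2))
      show "?D i j \<in> borel_measurable borel" by (rule borel_measurable_continuous_onI[OF Dc])
      show "?\<eta> x * T x $ i = 0" if "x \<notin> E" for x using bump_outside[OF that] by simp
    qed
  qed
  have 1: "(\<Sum>i\<in>UNIV. \<Sum>j\<in>UNIV. ?A $ i $ j * ?D i j x) =
     ?\<eta> x * (\<Sum>i\<in>UNIV. \<Sum>j\<in>UNIV. ?A $ i $ j * T' i x (axis j 1)) - ?w x * ((x - x0) \<bullet> T x)" for x
  proof -
    have "(\<Sum>i\<in>UNIV. \<Sum>j\<in>UNIV. ?A $ i $ j * ((- ?w x * ((M *v (x - x0)) \<bullet> (M *v axis j 1))) * T x $ i)) =
       - ?w x * (\<Sum>i\<in>UNIV. (\<Sum>j\<in>UNIV. ?A $ i $ j * ((M *v (x - x0)) \<bullet> (M *v axis j 1))) * T x $ i)"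
      by (simp add: sum_distrib_left sum_distrib_right mult_ac)
    also have "\<dots> = - ?w x * ((x - x0) \<bullet> T x)" unfolding shape_cancel by (simp add: inner_vec_def)
    finally show ?thesis
      by (simp only: distrib_left sum.distrib) (simp add: sum_distrib_left mult.left_commute)
  qed
  have 2: "(LINT x|lborel. (\<Sum>i\<in>UNIV. \<Sum>j\<in>UNIV. ?A $ i $ j * ?D i j x)) = 0"
  proof -
    have "(LINT x|lborel. (\<Sum>i\<in>UNIV. \<Sum>j\<in>UNIV. ?A $ i $ j * ?D i j x)) =
      (\<Sum>i\<in>UNIV. (LINT x|lborel. (\<Sum>j\<in>UNIV. ?A $ i $ j * ?D i j x)))"
      by (intro Bochner_Integration.integral_sum Bochner_Integration.integrable_sum integrable_mult_right Dint)
    also have "\<dots> = (\<Sum>i\<in>UNIV. \<Sum>j\<in>UNIV. (LINT x|lborel. ?A $ i $ j * ?D i j x))"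
      by (intro sum.cong refl Bochner_Integration.integral_sum integrable_mult_right Dint)
    also have "\<dots> = 0" by (simp only: integral_mult_right_zero zero mult_zero_right sum.neutral_const)
    finally show ?thesis .
  qed
  have Tv: "continuous_on UNIV T"
    using continuous_on_vec_lambda[of UNIV "\<lambda>i x. T x $ i", OF Tc] by simp
  have i1: "integrable lborel (\<lambda>x. ?\<eta> x * (\<Sum>i\<in>UNIV. \<Sum>j\<in>UNIV. ?A $ i $ j * T' i x (axis j 1)))"
    by (rule integrable_compact_support) (auto intro!: continuous_intros continuous_ell T' simp: bump_outside)
  have i2: "integrable lborel (\<lambda>x. ?w x * ((x - x0) \<bullet> T x))"
    by (rule integrable_compact_support) (auto intro!: continuous_intros continuous_ell Tv simp: weight_outside)
  show ?thesis using 2 unfolding 1 by (simp add: Bochner_Integration.integral_diff[OF i1 i2])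
qed

text \<open>In ball coordinates, let \<open>u\<close> be the direction of
  \<open>transpose L *v v\<close> and restrict to the ball of radius \<open>r/4\<close> about
  \<open>(r/2) u\<close>. There \<open>norm z \<le> 3/4 * r\<close>, so the weight is at least
  \<open>4 / r^2 * (1 - 9/16)\<close>, and \<open>z \<bullet> u \<ge> r/4\<close>; the product of
  the two bounds has the constant \<open>7/16\<close>.\<close>

lemma weight_abs_lower:
  "7/16 * norm (transpose L *v v) * (\<bar>det L\<bar> * ((r/4) ^ CARD('n) * measure lborel (ball (0::real^'n) 1))) / r
    \<le> (LINT x|lborel. ell_weight M x0 r x * \<bar>(x - x0) \<bullet> v\<bar>)"
proof -
  let ?\<nu> = "norm (transpose L *v v)" and ?w = "ell_weight M x0 r"
  have int: "integrable lborel (\<lambda>x. ?w x * \<bar>(x - x0) \<bullet> v\<bar>)"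
    by (rule integrable_compact_support) (auto intro!: continuous_intros continuous_ell simp: weight_outside)
  show ?thesis
  proof (cases "?\<nu> = 0")
    case True
    have "0 \<le> (LINT x|lborel. ?w x * \<bar>(x - x0) \<bullet> v\<bar>)"
      by (intro integral_nonneg_AE AE_I2 mult_nonneg_nonneg ell_weight_nonneg) auto
    then show ?thesis by (simp only: True mult_zero_right mult_zero_left div_0)
  next
    case False
    define u where "u = (transpose L *v v) /\<^sub>R ?\<nu>"
    have u: "norm u = 1" "transpose L *v v = ?\<nu> *\<^sub>R u" using False by (simp_all add: u_def)
    let ?B = "ball ((r/2) *\<^sub>R u) (r/4)"
    let ?F = "(\<lambda>x. x0 + x) ` ((*v) L ` ?B)"
    have "(*v) L ` ?B \<in> lmeasurable" by (rule matrix_image_measure) auto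
    then have F: "?F \<in> lmeasurable" by (rule measurable_translation)
    have mF: "measure lebesgue ?F = \<bar>det L\<bar> * ((r/4) ^ CARD('n) * measure lborel (ball (0::real^'n) 1))"
    proof -
      have "measure lebesgue ?F = measure lebesgue ((*v) L ` ?B)" by (rule measure_translation)
      also have "\<dots> = \<bar>det L\<bar> * measure lebesgue ?B"
        by (rule matrix_image_measure) auto
      also have "measure lebesgue ?B = (r/4) ^ CARD('n) * measure lborel (ball (0::real^'n) 1)"
        using content_ball_conv_unit_ball[of "r/4" "(r/2) *\<^sub>R u"] r by (simp add: measure_completion)
      finally show ?thesis .
    qed
    have low: "7/16 * ?\<nu> / r * indicator ?F x \<le> ?w x * \<bar>(x - x0) \<bullet> v\<bar>" for x
    proof (cases "x \<in> ?F")
      case True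
      then obtain z where z: "z \<in> ?B" "x = x0 + L *v z" by blast
      have dz: "norm ((r/2) *\<^sub>R u - z) < r/4" using z by (simp add: dist_norm)
      have nz: "norm z \<le> 3/4 * r"
        using norm_triangle_ineq4[of "(r/2) *\<^sub>R u" "(r/2) *\<^sub>R u - z"] dz u r by simp
      have Mz: "M *v (x - x0) = z" using z by (simp add: matrix_vector_mul_assoc M_L)
      have "(norm z)\<^sup>2 \<le> (3/4 * r)\<^sup>2" using nz by (intro power_mono) auto
      then have "ell_dist M x0 r x \<le> 9/16"
        unfolding ell_dist_def Mz using r by (simp add: power_mult_distrib power_divide divide_le_eq)
      then have wx: "4 / r\<^sup>2 * (7/16) \<le> ?w x" unfolding ell_weight_def
        using r by (intro mult_left_mono) auto
      have "(x - x0) \<bullet> v = v \<bullet> (L *v z)" using z by (simp add: inner_commute)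
      also have "\<dots> = (v v* L) \<bullet> z" by (rule dot_lmul_matrix[symmetric])
      also have "\<dots> = z \<bullet> (transpose L *v v)" by (simp only: transpose_matrix_vector inner_commute)
      also have "\<dots> = ?\<nu> * (z \<bullet> u)" by (subst u(2)) simp
      finally have xv: "(x - x0) \<bullet> v = ?\<nu> * (z \<bullet> u)" .
      have "((r/2) *\<^sub>R u - z) \<bullet> u \<le> r/4"
        using norm_cauchy_schwarz[of "(r/2) *\<^sub>R u - z" u] dz u by simp
      moreover have "u \<bullet> u = 1" using u by (simp add: norm_eq_1)
      ultimately have "r/4 \<le> z \<bullet> u" by (simp add: inner_diff_left)
      then have "?\<nu> * (r/4) \<le> \<bar>(x - x0) \<bullet> v\<bar>"
        unfolding xv using mult_left_mono[of "r/4" "z \<bullet> u" ?\<nu>] by (intro order.trans[OF _ abs_ge_self]) auto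
      then have "(4 / r\<^sup>2 * (7/16)) * (?\<nu> * (r/4)) \<le> ?w x * \<bar>(x - x0) \<bullet> v\<bar>"
        using wx r by (intro mult_mono) (auto intro: ell_weight_nonneg)
      moreover have "(4 / r\<^sup>2 * (7/16)) * (?\<nu> * (r/4)) = 7/16 * ?\<nu> / r"
        using r by (simp add: power2_eq_square field_simps)
      ultimately show ?thesis using True by simp
    qed (simp add: ell_weight_nonneg)
    have "7/16 * ?\<nu> / r * measure lebesgue ?F = (LINT x|lebesgue. 7/16 * ?\<nu> / r * indicator ?F x)"
      by simp
    also have "\<dots> \<le> (LINT x|lebesgue. ?w x * \<bar>(x - x0) \<bullet> v\<bar>)"
    proof (intro integral_mono integrable_mult_right low)
      show "integrable lebesgue (indicator ?F :: _ \<Rightarrow> real)"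
        using F by (intro integrable_real_indicator) (auto simp: fmeasurable_def)
      show "integrable lebesgue (\<lambda>x. ?w x * \<bar>(x - x0) \<bullet> v\<bar>)"
        using int by (simp add: integrable_completion)
    qed
    also have "\<dots> = (LINT x|lborel. ?w x * \<bar>(x - x0) \<bullet> v\<bar>)"
      using int by (intro integral_completion) auto
    finally show ?thesis unfolding mF by simp
  qed
qed

text \<open>Integration by parts turns the trace into the weighted integral of
  \<open>(x - x0) \<bullet> T x\<close>, with \<open>T\<close> the gradient. By convexity this
  product is at least the increase of the potential from \<open>x0\<close>, hence, up to
  \<open>2 * s\<close>, at least the larger of the increments of the affine functions with slopes
  \<open>p\<close> and \<open>q\<close>. That maximum is the increment of the mean slope plus half
  of \<open>\<bar>(x - x0) \<bullet> (p - q)\<bar>\<close>, which halves the constant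
  \<open>7/16\<close>.\<close>

lemma trace_lower_bound:
  assumes Y: "finite Y" "p \<in> Y" "q \<in> Y" and \<beta>: "0 < \<beta>"
    and W: "soft_max Y \<beta> c x0 \<le> W + s" "W - s \<le> x0 \<bullet> p - c p" "W - s \<le> x0 \<bullet> q - c q"
  shows "7/32 * norm (transpose L *v (p - q)) * (\<bar>det L\<bar> * ((r/4) ^ CARD('n) * measure lborel (ball (0::real^'n) 1))) / r
      - 2 * s * (LINT x|lborel. ell_weight M x0 r x)
    \<le> (LINT x|lborel. ell_bump M x0 r x * gibbs_trace Y \<beta> c x (L ** transpose L))"
proof -
  let ?w = "ell_weight M x0 r" and ?T = "gibbs_mean Y \<beta> c" and ?v = "(1/2) *\<^sub>R (p + q)"
  have Y0: "Y \<noteq> {}" using Y by blast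
  define T' where "T' i x h = (\<Sum>y\<in>Y. (\<beta> * gibbs Y \<beta> c x y * ((y - ?T x) \<bullet> h)) * (y - ?T x) $ i)" for i x h
  have T': "((\<lambda>x. ?T x $ i) has_derivative T' i x) (at x)" for i x
    using gibbs_mean_component_has_derivative[OF Y(1) Y0, of \<beta> c i x] unfolding T'_def[abs_def] .
  have pd: "partial_deriv j (\<lambda>x. ?T x $ i) x = T' i x (axis j 1)" for i j x
    by (rule partial_deriv_eq[OF T'])
  have T'c: "continuous_on UNIV (\<lambda>x. T' i x (axis j 1))" for i j
    using continuous_on_partial_deriv_gibbs_mean[OF Y(1) Y0, of UNIV j \<beta> c i] by (simp add: pd[abs_def])
  have eq: "(LINT x|lborel. ell_bump M x0 r x * gibbs_trace Y \<beta> c x (L ** transpose L)) =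
      (LINT x|lborel. ?w x * ((x - x0) \<bullet> ?T x))"
    unfolding gibbs_trace_eq[OF Y(1) Y0] pd by (rule integral_by_parts[OF T' T'c])
  \<comment> \<open>The mean slope contributes nothing: a constant vector field has derivative 0 in
    the integration by parts.\<close>
  have lin0: "(LINT x|lborel. ?w x * ((x - x0) \<bullet> ?v)) = 0"
    using integral_by_parts[of "\<lambda>x. ?v" "\<lambda>i x h. 0"] by simp
  have i1: "integrable lborel (\<lambda>x. ?w x * ((x - x0) \<bullet> ?v))"
    by (rule integrable_compact_support) (auto intro!: continuous_intros continuous_ell simp: weight_outside)
  have i2: "integrable lborel (\<lambda>x. ?w x * \<bar>(x - x0) \<bullet> (p - q)\<bar>)"
    by (rule integrable_compact_support) (auto intro!: continuous_intros continuous_ell simp: weight_outside)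
  have i3: "integrable lborel ?w"
    by (rule integrable_compact_support) (auto intro!: continuous_ell simp: weight_outside)
  have i4: "integrable lborel (\<lambda>x. ?w x * ((x - x0) \<bullet> ?T x))"
    by (rule integrable_compact_support)
       (auto intro!: continuous_intros continuous_ell continuous_on_gibbs_mean Y Y0 simp: weight_outside)
  have low: "1/2 * (?w x * \<bar>(x - x0) \<bullet> (p - q)\<bar>) + ?w x * ((x - x0) \<bullet> ?v) - 2 * s * ?w x \<le> ?w x * ((x - x0) \<bullet> ?T x)" for x
  proof -
    have grad: "soft_max Y \<beta> c x - soft_max Y \<beta> c x0 \<le> (x - x0) \<bullet> ?T x"
      by (rule soft_max_gradient_ineq[OF Y(1) Y0 \<beta>])
    have "(x - x0) \<bullet> p - 2 * s \<le> (x - x0) \<bullet> ?T x" "(x - x0) \<bullet> q - 2 * s \<le> (x - x0) \<bullet> ?T x"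
      using grad W soft_max_ge[OF Y(1,2) \<beta>, of x c] soft_max_ge[OF Y(1,3) \<beta>, of x c]
      by (simp_all add: inner_diff_left)
    then have "1/2 * \<bar>(x - x0) \<bullet> (p - q)\<bar> + (x - x0) \<bullet> ?v - 2 * s \<le> (x - x0) \<bullet> ?T x"
      by (simp add: inner_diff_right inner_add_right abs_if field_simps)
    from mult_left_mono[OF this ell_weight_nonneg[of M x0 r x]] show ?thesis
      by (simp add: algebra_simps)
  qed
  have "(LINT x|lborel. 1/2 * (?w x * \<bar>(x - x0) \<bullet> (p - q)\<bar>) + ?w x * ((x - x0) \<bullet> ?v) - 2 * s * ?w x)
      \<le> (LINT x|lborel. ?w x * ((x - x0) \<bullet> ?T x))"
    by (intro integral_mono Bochner_Integration.integrable_diff Bochner_Integration.integrable_add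
        integrable_mult_right i1 i2 i3 i4 low)
  also have "(LINT x|lborel. 1/2 * (?w x * \<bar>(x - x0) \<bullet> (p - q)\<bar>) + ?w x * ((x - x0) \<bullet> ?v) - 2 * s * ?w x)
     = 1/2 * (LINT x|lborel. ?w x * \<bar>(x - x0) \<bullet> (p - q)\<bar>) - 2 * s * (LINT x|lborel. ?w x)"
    by (subst Bochner_Integration.integral_diff)
       (auto simp only: Bochner_Integration.integral_add[OF integrable_mult_right[OF i2] i1] lin0 integral_mult_right_zero add_0_right
         intro!: Bochner_Integration.integrable_add integrable_mult_right i1 i2 i3)
  finally show ?thesis using weight_abs_lower[of "p - q"] unfolding eq by simp
qed

end

section \<open>Packing by ellipsoids\<close>

text \<open>Orthonormalisation for the inner product defined by \<open>A\<close>. Fewer than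
  \<open>d\<close> vectors \<open>A *v v j\<close> leave a nonzero vector orthogonal to all of them,
  and normalising it extends the family.\<close>

lemma conjugate_family_exists:
  fixes A :: "real^'n^'n" and I :: "'n set"
  assumes sym: "transpose A = A" and pos: "\<And>v. v \<noteq> 0 \<Longrightarrow> 0 < v \<bullet> (A *v v)"
  shows "\<exists>v. \<forall>i\<in>I. \<forall>j\<in>I. v i \<bullet> (A *v v j) = (if i = j then 1 else 0)"
  using finite[of I]
proof (induction I rule: finite_induct)
  case empty
  show ?case by simp
next
  case (insert k I)
  then obtain v where v: "\<And>i j. i \<in> I \<Longrightarrow> j \<in> I \<Longrightarrow> v i \<bullet> (A *v v j) = (if i = j then 1 else 0)" by blast
  have swap: "x \<bullet> (A *v y) = y \<bullet> (A *v x)" for x y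
    using dot_lmul_matrix[of x A y] sym by (metis inner_commute transpose_matrix_vector)
  let ?B = "(\<lambda>j. A *v v j) ` I"
  have "dim ?B \<le> card ?B" by (rule dim_le_card') simp
  also have "\<dots> \<le> card I" by (rule card_image_le) simp
  also have "\<dots> < card (insert k I)" using insert by simp
  also have "\<dots> \<le> CARD('n)" by (rule card_mono) auto
  finally have "dim ?B < DIM(real^'n)" by simp
  then obtain x where x: "x \<noteq> 0" "\<And>y. y \<in> span ?B \<Longrightarrow> orthogonal x y"
    by (rule orthogonal_to_subspace_exists) blast
  have xv: "x \<bullet> (A *v v j) = 0" if "j \<in> I" for j
    using x(2)[OF span_base, of "A *v v j"] that by (auto simp: orthogonal_def)
  define s where "s = sqrt (x \<bullet> (A *v x))"
  have s: "s * s = x \<bullet> (A *v x)" "0 < s" using pos[OF x(1)] by (auto simp: s_def)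
  define v' where "v' = v(k := x /\<^sub>R s)"
  have "v' i \<bullet> (A *v v' j) = (if i = j then 1 else 0)" if "i \<in> insert k I" "j \<in> insert k I" for i j
    using that v insert xv swap[of "v i" x] s
    by (auto simp: v'_def matrix_vector_mult_scaleR field_simps)
  then show ?case by blast
qed

text \<open>If the columns of \<open>V\<close> are orthonormal for \<open>A\<close>, then
  \<open>W = transpose V ** A\<close> is inverse to \<open>V\<close> and
  \<open>A = transpose W ** W\<close>; one takes \<open>L = transpose W\<close> and
  \<open>M = transpose V\<close>.\<close>

lemma spd_factorization:
  fixes A :: "real^'n^'n"
  assumes sym: "transpose A = A" and pos: "\<And>v. v \<noteq> 0 \<Longrightarrow> 0 < v \<bullet> (A *v v)"
  obtains L M :: "real^'n^'n" where "L ** M = mat 1" "M ** L = mat 1" "A = L ** transpose L"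
proof -
  obtain v where v: "\<And>i j::'n. v i \<bullet> (A *v v j) = (if i = j then 1 else 0)"
    using conjugate_family_exists[OF assms, of UNIV] by auto
  define V :: "real^'n^'n" where "V = (\<chi> a i. v i $ a)"
  define W where "W = transpose V ** A"
  have "(transpose V ** (A ** V)) $ i $ j = v i \<bullet> (A *v v j)" for i j
    by (simp add: matrix_matrix_mult_def transpose_def V_def inner_vec_def matrix_vector_mult_def)
  then have "W ** V = mat 1"
    by (simp add: W_def v vec_eq_iff mat_def matrix_mul_assoc[symmetric])
  moreover from this have VW: "V ** W = mat 1" by (simp add: matrix_left_right_inverse)
  moreover have "A = transpose W ** W"
  proof -
    have "transpose W ** W = (transpose W ** transpose V) ** A" by (simp only: W_def matrix_mul_assoc)
    also have "transpose W ** transpose V = mat 1"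
      by (simp only: matrix_transpose_mul[symmetric] VW transpose_mat)
    finally show ?thesis by simp
  qed
  ultimately show ?thesis
    by (intro that[of "transpose W" "transpose V"])
       (simp_all only: matrix_transpose_mul[symmetric] transpose_mat transpose_transpose)
qed

lemma spd_det_pos:
  fixes A :: "real^'n^'n"
  assumes "transpose A = A" "\<And>v. v \<noteq> 0 \<Longrightarrow> 0 < v \<bullet> (A *v v)"
  shows "0 < det A"
proof -
  obtain L M :: "real^'n^'n" where L: "L ** M = mat 1" "A = L ** transpose L" using spd_factorization[OF assms] by metis
  have "det L * det M = 1" using L(1) det_mul[of L M] by simp
  then have "det L \<noteq> 0" by auto
  moreover have "det A = det L * det L" unfolding L(2) by (simp add: det_mul)
  ultimately show ?thesis by (metis not_real_square_gt_zero)
qed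

lemma continuous_on_det:
  fixes f :: "'a::topological_space \<Rightarrow> real^'n^'n"
  assumes "continuous_on S f"
  shows "continuous_on S (\<lambda>x. det (f x))"
  unfolding det_def using assms by (intro continuous_intros)

text \<open>Adding a small positive multiple of the identity makes the matrix positive definite; the
  determinant is continuous in that multiple.\<close>

lemma psd_det_nonneg:
  fixes A :: "real^'n^'n"
  assumes "transpose A = A" "\<And>v. 0 \<le> v \<bullet> (A *v v)"
  shows "0 \<le> det A"
proof -
  let ?f = "\<lambda>t::real. A + t *\<^sub>R mat 1"
  have "0 < det (?f t)" if "0 < t" for t
  proof (rule spd_det_pos)
    show "transpose (?f t) = ?f t" using assms(1) by (simp add: transpose_def vec_eq_iff mat_def)
    show "0 < v \<bullet> (?f t *v v)" if "v \<noteq> 0" for v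
      using assms(2)[of v] \<open>0 < t\<close> that
      by (simp add: matrix_vector_mult_add_rdistrib scaleR_matrix_vector_assoc[symmetric] inner_add_right add_nonneg_pos)
  qed
  then have "eventually (\<lambda>t. 0 \<le> det (?f t)) (at_right 0)"
    by (auto simp: eventually_at_right_field intro!: exI[of _ 1] less_imp_le)
  moreover have "((\<lambda>t. det (?f t)) \<longlongrightarrow> det (?f 0)) (at_right 0)"
  proof -
    have "continuous_on UNIV (\<lambda>t. det (?f t))" by (intro continuous_on_det continuous_intros)
    then have "isCont (\<lambda>t. det (?f t)) 0" by (simp add: continuous_on_eq_continuous_at)
    then show ?thesis by (simp add: isCont_def filterlim_at_split)
  qed
  ultimately have "0 \<le> det (?f 0)" by (intro tendsto_lowerbound) auto
  then show ?thesis by simp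
qed

text \<open>A vector on which a semi-definite form vanishes lies in the kernel: otherwise a small
  step from \<open>v\<close> along \<open>- (A *v v)\<close> would make the form negative. A
  positive determinant excludes a kernel.\<close>

lemma psd_det_pos_imp_pos_def:
  fixes A :: "real^'n^'n"
  assumes sym: "transpose A = A" and psd: "\<And>v. 0 \<le> v \<bullet> (A *v v)" and "0 < det A" and "v \<noteq> 0"
  shows "0 < v \<bullet> (A *v v)"
proof (rule ccontr)
  assume "\<not> ?thesis"
  then have v0: "v \<bullet> (A *v v) = 0" using psd[of v] by simp
  let ?w = "A *v v"
  have sw: "v \<bullet> (A *v ?w) = ?w \<bullet> ?w"
    using dot_lmul_matrix[of v A ?w] sym by (metis transpose_matrix_vector)
  have q: "0 \<le> 2 * t * (?w \<bullet> ?w) + t\<^sup>2 * (?w \<bullet> (A *v ?w))" for t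
    using psd[of "v + t *\<^sub>R ?w"] v0 sw
    by (simp add: matrix_vector_right_distrib matrix_vector_mult_scaleR inner_add_left inner_add_right power2_eq_square algebra_simps)
  have "?w \<bullet> ?w = 0"
  proof (rule ccontr)
    assume "?w \<bullet> ?w \<noteq> 0"
    then have p: "0 < ?w \<bullet> ?w" by (simp add: less_le)
    define B where "B = ?w \<bullet> (A *v ?w)"
    have B: "0 \<le> B" using psd[of ?w] by (simp add: B_def)
    \<comment> \<open>The summand 1 covers \<open>B = 0\<close>; in every case
      \<open>s * B \<le> 1\<close>, so the linear term wins over the quadratic one.\<close>
    define s where "s = 1 / (B + 1)"
    define t where "t = - (?w \<bullet> ?w) * s"
    have s: "0 < s" "s * B \<le> 1" using B by (auto simp: s_def)
    have "2 * t * (?w \<bullet> ?w) + t\<^sup>2 * B = ((?w \<bullet> ?w) * (?w \<bullet> ?w) * s) * (s * B - 2)"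
      by (simp add: t_def power2_eq_square algebra_simps)
    also have "\<dots> < 0" using p s by (intro mult_pos_neg mult_pos_pos) auto
    finally show False using q[of t] by (simp add: B_def)
  qed
  then have "?w = 0" by simp
  moreover have "invertible A" using \<open>0 < det A\<close> by (simp add: invertible_det_nz)
  ultimately show False using \<open>v \<noteq> 0\<close> by (metis invertible_def matrix_vector_mul_assoc matrix_vector_mul_lid matrix_vector_mult_0_right)
qed

text \<open>The exponent \<open>1/(d-1)\<close> is the one for which the gain of \<open>trace_lower_bound\<close> is proportional to the mass.\<close>
lemma mass_scaling:
  fixes D r \<omega> m :: real
  assumes "2 \<le> (d::nat)" "0 < D" "0 < r" "0 < \<omega>"
    and m: "m = D powr (2 / (real d - 1)) * (D * r ^ d * \<omega>)"
  shows "(D * m / 4) powr (1 / real d) * (D * ((r/4) ^ d * \<omega>)) / r = (\<omega> / 4) powr (1 / real d) / 4 ^ d * m"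
proof -
  have d: "0 < real d" "0 < real d - 1" using assms by auto
  have eq: "D * m / 4 = D powr (2 * real d / (real d - 1)) * r powr real d * (\<omega> / 4)"
  proof -
    have "D * m / 4 = (D powr 2 * D powr (2 / (real d - 1))) * r powr real d * (\<omega> / 4)"
      using assms by (simp add: m powr_realpow power2_eq_square)
    also have "D powr 2 * D powr (2 / (real d - 1)) = D powr (2 * real d / (real d - 1))"
      using d by (subst powr_add[symmetric]) (simp add: field_simps)
    finally show ?thesis .
  qed
  have "(D * m / 4) powr (1 / real d) = D powr (2 / (real d - 1)) * r * (\<omega> / 4) powr (1 / real d)"
  proof -
    have split: "(x * y * z) powr a = x powr a * y powr a * z powr a" if "0 < x" "0 < y" "0 < z" for x y z a :: real
      using that by (simp add: powr_mult)
    have "(D powr (2 * real d / (real d - 1)) * r powr real d * (\<omega> / 4)) powr (1 / real d) =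
        (D powr (2 * real d / (real d - 1))) powr (1 / real d) * (r powr real d) powr (1 / real d) * (\<omega> / 4) powr (1 / real d)"
      using assms(2-4) by (intro split) auto
    then show ?thesis unfolding eq using d assms(2-4) by (simp only: powr_powr) simp
  qed
  then show ?thesis using assms by (simp add: m power_divide)
qed

section \<open>Masses of ellipsoids and the comparison of gain with total mass\<close>

definition ball_vol :: "'a::euclidean_space itself \<Rightarrow> real" where
  "ball_vol _ = measure lborel (ball (0::'a) 1)"

lemma ball_vol_pos: "0 < ball_vol TYPE('a::euclidean_space)"
  unfolding ball_vol_def using content_ball_pos[of 1 "0::'a"] by simp

text \<open>The \<open>7/64\<close> is the \<open>7/32\<close> of \<open>trace_lower_bound\<close>
  times the \<open>1/2\<close> in the distance \<open>\<nu>\<close> between two slopes of a cell;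
  the remaining factor is that of \<open>mass_scaling\<close>.\<close>

definition packing_const :: "'n::finite itself \<Rightarrow> real" where
  "packing_const _ = 7/64 * ((ball_vol TYPE(real^'n) / 4) powr (1 / real CARD('n)) / 4 ^ CARD('n))"

lemma packing_const_pos: "0 < packing_const TYPE('n::finite)"
  unfolding packing_const_def using ball_vol_pos[where 'a = "real^'n"] by simp

text \<open>\<open>\<bar>det L\<bar> * r ^ d\<close> times \<open>ball_vol\<close> is the volume of
  the ellipsoid, and the first factor is the power \<open>1 / (d - 1)\<close> of
  \<open>det (L ** transpose L)\<close>.\<close>

definition ell_mass :: "real^'n^'n \<Rightarrow> real \<Rightarrow> real" where
  "ell_mass L r = \<bar>det L\<bar> powr (2 / (real CARD('n) - 1)) * (\<bar>det L\<bar> * r ^ CARD('n) * ball_vol TYPE(real^'n))"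

text \<open>One potential is tested against all ellipsoids together. At each point at most one bump
  is nonzero, it is at most 1, and there \<open>b\<close> dominates the constant matrix; so the sum
  of the local gains is at most the global trace integral. The errors add up to
  \<open>4 * t * J\<close>, where \<open>J\<close> does not depend on the potential built for
  \<open>t\<close>, and \<open>t\<close> tends to 0.\<close>

lemma packing_estimate:
  fixes b :: "real^'n \<Rightarrow> real^'n^'n" and L M :: "'k \<Rightarrow> real^'n^'n"
  assumes d: "2 \<le> CARD('n)"
    and psd: "\<And>y v. 0 \<le> v \<bullet> (b y *v v)"
    and bound: "trace_bounded b C" and C: "0 \<le> C"
    and K: "finite K" "K \<noteq> {}" and ell: "\<And>k. k \<in> K \<Longrightarrow> ellipsoid (L k) (M k) (r k)"
    and disj: "disjoint_family_on (\<lambda>k. (\<lambda>z. x k + L k *v z) ` ball 0 (r k)) K"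
    and below: "\<And>k z v. k \<in> K \<Longrightarrow> z \<in> (\<lambda>z. x k + L k *v z) ` ball 0 (r k) \<Longrightarrow>
       v \<bullet> ((L k ** transpose (L k)) *v v) \<le> v \<bullet> (b z *v v)"
  shows "packing_const TYPE('n) * (\<Sum>k\<in>K. ell_mass (L k) (r k)) \<le> C * root CARD('n) (\<Sum>k\<in>K. ell_mass (L k) (r k))"
proof -
  let ?d = "CARD('n)" and ?\<omega> = "ball_vol TYPE(real^'n)"
  let ?m = "\<lambda>k. ell_mass (L k) (r k)" and ?S = "\<Sum>k\<in>K. ell_mass (L k) (r k)"
  let ?D = "\<lambda>k. \<bar>det (L k)\<bar>" and ?A = "\<lambda>k. L k ** transpose (L k)"
  let ?\<eta> = "\<lambda>k. ell_bump (M k) (x k) (r k)" and ?w = "\<lambda>k. ell_weight (M k) (x k) (r k)"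
  have r: "0 < r k" if "k \<in> K" for k using ell[OF that] by (simp add: ellipsoid_def)
  have D: "0 < ?D k" if "k \<in> K" for k
  proof -
    have "det (L k) * det (M k) = 1"
      using ell[OF that] det_mul[of "L k" "M k"] by (simp add: ellipsoid_def)
    then show ?thesis by auto
  qed
  have m: "0 < ?m k" if "k \<in> K" for k
    using D[OF that] r[OF that] ball_vol_pos[where 'a = "real^'n"] by (simp add: ell_mass_def)
  have S: "0 < ?S" using K m by (intro sum_pos) auto
  \<comment> \<open>The side of a cube of volume equal to the total mass, and at the same time the
    bound for the components of all slopes.\<close>
  define \<rho> where "\<rho> = root ?d ?S"
  have \<rho>: "0 < \<rho>" "\<rho> ^ ?d = ?S" using S by (auto simp: \<rho>_def real_root_pow_pos2)
  \<comment> \<open>The image of a cell under \<open>transpose (L k)\<close> has volume at least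
    \<open>?D k * ?m k / 2\<close>; solving the estimate of \<open>measure_le_diameter_power\<close>
    for the distance gives this value.\<close>
  define \<nu> where "\<nu> k = (?D k * ?m k / 4) powr (1 / real ?d) / 2" for k
  define gain where "gain k = 7/32 * \<nu> k * (?D k * ((r k / 4) ^ ?d * ?\<omega>)) / r k" for k
  have gain: "gain k = packing_const TYPE('n) * ?m k" if "k \<in> K" for k
  proof -
    have "gain k = 7/64 * ((?D k * ?m k / 4) powr (1 / real ?d) * (?D k * ((r k / 4) ^ ?d * ?\<omega>)) / r k)"
      by (simp add: gain_def \<nu>_def)
    also have "\<dots> = 7/64 * ((?\<omega> / 4) powr (1 / real ?d) / 4 ^ ?d * ?m k)"
      by (subst mass_scaling[OF d D[OF that] r[OF that] ball_vol_pos]) (simp_all add: ell_mass_def)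
    finally show ?thesis by (simp add: packing_const_def)
  qed
  define J where "J = (\<Sum>k\<in>K. LINT z|lborel. ?w k z)"
  \<comment> \<open>For \<open>t\<close> up to half of the smallest mass, every relaxed cell keeps
    at least half of its prescribed volume.\<close>
  define t0 where "t0 = Min (?m ` K) / 2"
  have t0: "0 < t0" "t0 \<le> ?m k / 2" if "k \<in> K" for k
    using K m that by (auto simp: t0_def)
  have main: "(\<Sum>k\<in>K. gain k) \<le> C * \<rho> + 4 * t * J" if t: "0 < t" "t \<le> t0" for t
  proof -
    let ?Q = "cbox (0::real^'n) (\<chi> i. \<rho>)"
    have "measure lborel ?Q = (\<Sum>k\<in>K. ?m k)"
      using \<rho> by (subst content_cbox_cart) (auto simp: interval_ne_empty_cart)
    from relaxed_cells[OF K m this t(1), of x]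
    obtain w where w: "\<And>k. k \<in> K \<Longrightarrow> ?m k - t \<le>
        measure lborel {y \<in> ?Q. \<forall>l\<in>K. x l \<bullet> y - w l \<le> x k \<bullet> y - w k + t}" by blast
    define V where "V k = {y \<in> ?Q. \<forall>l\<in>K. x l \<bullet> y - w l \<le> x k \<bullet> y - w k + t}" for k
    have "\<exists>p q. p \<in> V k \<and> q \<in> V k \<and> \<nu> k \<le> norm (transpose (L k) *v (p - q))" if k: "k \<in> K" for k
    proof -
      have Vm: "?m k / 2 \<le> measure lborel (V k)"
        using w[OF k] t t0(2)[OF k] by (simp add: V_def)
      have "V k = ?Q \<inter> (\<Inter>l\<in>K. {y. x l \<bullet> y - w l \<le> x k \<bullet> y - w k + t})" by (auto simp: V_def)
      moreover have "compact (?Q \<inter> (\<Inter>l\<in>K. {y. x l \<bullet> y - w l \<le> x k \<bullet> y - w k + t}))"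
        by (intro compact_Int_closed compact_cbox closed_INT ballI closed_Collect_le continuous_intros)
      ultimately have comp: "compact (V k)" by (simp only:)
      let ?T = "(*v) (transpose (L k)) ` V k"
      have mT: "?T \<in> lmeasurable" "measure lebesgue ?T = ?D k * measure lborel (V k)"
        using matrix_image_measure[OF lmeasurable_compact[OF comp], of "transpose (L k)"] lmeasurable_compact[OF comp]
          borel_compact[OF comp] by (simp_all add: measure_completion)
      have low: "?D k * ?m k / 2 \<le> measure lebesgue ?T"
        using mult_left_mono[OF Vm, of "?D k"] unfolding mT(2) by simp
      have pos: "0 < ?D k * ?m k / 2" using D[OF k] m[OF k] by simp
      then have "0 < measure lebesgue ?T" using low by linarith
      then obtain p' q' where pq: "p' \<in> ?T" "q' \<in> ?T" "measure lebesgue ?T \<le> 2 * (2 * norm (p' - q')) ^ ?d"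
        by (rule measure_le_diameter_power[OF mT(1)])
      then obtain p q where "p \<in> V k" "q \<in> V k" "p' = transpose (L k) *v p" "q' = transpose (L k) *v q" by blast
      moreover have "\<nu> k \<le> norm (p' - q')"
      proof -
        have "?D k * ?m k / 4 \<le> (2 * norm (p' - q')) ^ ?d" using low pq(3) by simp
        then have "(?D k * ?m k / 4) powr (1 / real ?d) \<le> ((2 * norm (p' - q')) ^ ?d) powr (1 / real ?d)"
          using pos by (intro powr_mono2) auto
        also have "\<dots> = 2 * norm (p' - q')"
        proof (cases "norm (p' - q') = 0")
          case False
          then have "(2 * norm (p' - q')) ^ ?d = (2 * norm (p' - q')) powr real ?d"
            by (intro powr_realpow[symmetric]) simp
          then show ?thesis using False by (simp only: powr_powr) simp
        qed simp
        finally show ?thesis by (simp add: \<nu>_def)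
      qed
      ultimately show ?thesis by (auto simp: matrix_vector_mult_diff_distrib)
    qed
    then obtain p q where pq: "\<And>k. k \<in> K \<Longrightarrow> p k \<in> V k \<and> q k \<in> V k \<and> \<nu> k \<le> norm (transpose (L k) *v (p k - q k))"
      by metis
    define Y where "Y = p ` K \<union> q ` K"
    have Y: "finite Y" "Y \<noteq> {}" using K by (auto simp: Y_def)
    \<comment> \<open>The discrete Legendre transform of \<open>w\<close>. At \<open>x k\<close> no
      affine function exceeds \<open>w k\<close>, and the slopes in the cell of \<open>k\<close>
      reach it up to \<open>t\<close>, so the potential has its kink there.\<close>
    define c where "c y = Max ((\<lambda>l. x l \<bullet> y - w l) ` K)" for y
    have c_ge: "x k \<bullet> y - w k \<le> c y" if "k \<in> K" for k y
      unfolding c_def using K that by (intro Max_ge) auto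
    \<comment> \<open>Chosen so that the smoothing error is at most \<open>t\<close>; the summand 1
      keeps \<open>\<beta>\<close> positive when \<open>Y\<close> has a single element.\<close>
    define \<beta> where "\<beta> = (ln (card Y) + 1) / t"
    have lnY: "0 \<le> ln (real (card Y))" using Y by (simp add: Suc_le_eq card_gt_0_iff)
    have \<beta>: "0 < \<beta>" using lnY t by (simp add: \<beta>_def add_nonneg_pos)
    have lnt: "ln (card Y) / \<beta> \<le> t"
    proof -
      have "ln (card Y) / \<beta> = t * (ln (card Y) / (ln (card Y) + 1))" using t by (simp add: \<beta>_def)
      also have "\<dots> \<le> t * 1" using lnY t by (intro mult_left_mono) auto
      finally show ?thesis by simp
    qed
    have each: "gain k - 4 * t * (LINT z|lborel. ?w k z) \<le> (LINT z|lborel. ?\<eta> k z * gibbs_trace Y \<beta> c z (?A k))"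
      if k: "k \<in> K" for k
    proof -
      interpret ellipsoid "L k" "M k" "x k" "r k" using ell[OF k] by (simp add: ellipsoid_def)
      have Vc: "c y \<le> x k \<bullet> y - w k + t" if "y \<in> V k" for y
        unfolding c_def using K that by (subst Max_le_iff) (auto simp: V_def)
      \<comment> \<open>The slack \<open>2 * t\<close> covers both the smoothing error and the
        relaxation of the cell; \<open>trace_lower_bound\<close> doubles it to the
        \<open>4 * t\<close> of the claim.\<close>
      have 1: "soft_max Y \<beta> c (x k) \<le> w k + 2 * t"
        using soft_max_le[OF Y \<beta>, of "x k" c "w k"] c_ge[OF k] lnt t by (auto simp: algebra_simps)
      have 2: "w k - 2 * t \<le> x k \<bullet> p k - c (p k)" "w k - 2 * t \<le> x k \<bullet> q k - c (q k)"
        using Vc[of "p k"] Vc[of "q k"] pq[OF k] t by auto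
      have "p k \<in> Y" "q k \<in> Y" using k by (auto simp: Y_def)
      from trace_lower_bound[OF Y(1) this \<beta> 1 2]
      have "7/32 * norm (transpose (L k) *v (p k - q k)) * (?D k * ((r k / 4) ^ ?d * ?\<omega>)) / r k
         - 2 * (2 * t) * (LINT z|lborel. ?w k z) \<le> (LINT z|lborel. ?\<eta> k z * gibbs_trace Y \<beta> c z (?A k))"
        by (simp only: ball_vol_def)
      moreover have "gain k \<le> 7/32 * norm (transpose (L k) *v (p k - q k)) * (?D k * ((r k / 4) ^ ?d * ?\<omega>)) / r k"
        unfolding gain_def using pq[OF k] r ball_vol_pos[where 'a = "real^'n"]
        by (intro divide_right_mono mult_right_mono mult_left_mono) auto
      ultimately show ?thesis by linarith
    qed
    have Anonneg: "0 \<le> v \<bullet> (?A k *v v)" for k v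
    proof -
      have "v \<bullet> (?A k *v v) = (v v* L k) \<bullet> (transpose (L k) *v v)"
        by (simp only: matrix_vector_mul_assoc[symmetric] dot_lmul_matrix)
      then show ?thesis by (simp add: transpose_matrix_vector)
    qed
    have nn: "0 \<le> gibbs_trace Y \<beta> c z (?A k)" for z k
      using \<beta> Anonneg by (intro gibbs_trace_nonneg) auto
    have \<eta>0: "0 \<le> ?\<eta> k z" for k z by (simp add: ell_bump_def)
    have trc: "continuous_on UNIV (\<lambda>z. gibbs_trace Y \<beta> c z N)" for N
      unfolding gibbs_trace_eq[OF Y]
      by (intro continuous_intros continuous_on_partial_deriv_gibbs_mean Y)
    have int: "integrable lborel (\<lambda>z. ?\<eta> k z * gibbs_trace Y \<beta> c z (?A k))" if k: "k \<in> K" for k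
    proof -
      interpret ellipsoid "L k" "M k" "x k" "r k" using ell[OF k] by (simp add: ellipsoid_def)
      show ?thesis
        by (rule integrable_compact_support) (auto intro!: continuous_intros continuous_ell trc simp: bump_outside)
    qed
    have pointwise: "(\<Sum>k\<in>K. ?\<eta> k z * gibbs_trace Y \<beta> c z (?A k)) \<le> gibbs_trace Y \<beta> c z (b z)" for z
    proof (cases "\<exists>k\<in>K. z \<in> (\<lambda>z. x k + L k *v z) ` ball 0 (r k)")
      case True
      then obtain k where k: "k \<in> K" and z: "z \<in> (\<lambda>z. x k + L k *v z) ` ball 0 (r k)" by blast
      have "?\<eta> l z = 0" if l: "l \<in> K" "l \<noteq> k" for l
      proof -
        interpret ellipsoid "L l" "M l" "x l" "r l" using ell[OF l(1)] by (simp add: ellipsoid_def)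
        have "z \<notin> (\<lambda>z. x l + L l *v z) ` ball 0 (r l)"
          using disj z k l by (auto simp: disjoint_family_on_def)
        then show ?thesis by (rule bump_outside)
      qed
      then have "(\<Sum>l\<in>K. ?\<eta> l z * gibbs_trace Y \<beta> c z (?A l)) = ?\<eta> k z * gibbs_trace Y \<beta> c z (?A k)"
        using K k by (subst sum.remove[of K k]) (auto intro!: sum.neutral)
      also have "\<dots> \<le> 1 * gibbs_trace Y \<beta> c z (b z)"
      proof -
        interpret ellipsoid "L k" "M k" "x k" "r k" using ell[OF k] by (simp add: ellipsoid_def)
        show ?thesis
          using \<beta> by (intro mult_mono bump_le_1 gibbs_trace_mono below[OF k z] nn) auto
      qed
      finally show ?thesis by simp
    next
      case False
      have "?\<eta> k z = 0" if k: "k \<in> K" for k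
      proof -
        interpret ellipsoid "L k" "M k" "x k" "r k" using ell[OF k] by (simp add: ellipsoid_def)
        show ?thesis using False k by (intro bump_outside) blast
      qed
      then show ?thesis using \<beta> psd by (simp add: gibbs_trace_nonneg)
    qed
    have "ennreal (LINT z|lborel. (\<Sum>k\<in>K. ?\<eta> k z * gibbs_trace Y \<beta> c z (?A k))) =
        (\<integral>\<^sup>+z. ennreal (\<Sum>k\<in>K. ?\<eta> k z * gibbs_trace Y \<beta> c z (?A k)) \<partial>lborel)"
      by (intro nn_integral_eq_integral[symmetric] Bochner_Integration.integrable_sum int AE_I2 sum_nonneg mult_nonneg_nonneg nn \<eta>0)
    also have "\<dots> \<le> (\<integral>\<^sup>+z. ennreal (gibbs_trace Y \<beta> c z (b z)) \<partial>lborel)"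
      by (intro nn_integral_mono ennreal_leI pointwise)
    also have "\<dots> \<le> ennreal (C * \<rho>)"
    proof -
      have "\<forall>y\<in>Y. \<forall>i. \<bar>y $ i\<bar> \<le> \<rho>"
        using pq by (auto simp: Y_def V_def mem_box_cart)
      with bound Y \<beta> show ?thesis by (simp add: trace_bounded_def)
    qed
    finally have "(LINT z|lborel. (\<Sum>k\<in>K. ?\<eta> k z * gibbs_trace Y \<beta> c z (?A k))) \<le> C * \<rho>"
      using C \<rho> by (simp add: ennreal_le_iff)
    also have "(LINT z|lborel. (\<Sum>k\<in>K. ?\<eta> k z * gibbs_trace Y \<beta> c z (?A k))) =
       (\<Sum>k\<in>K. LINT z|lborel. ?\<eta> k z * gibbs_trace Y \<beta> c z (?A k))"
      by (intro Bochner_Integration.integral_sum int)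
    finally have "(\<Sum>k\<in>K. LINT z|lborel. ?\<eta> k z * gibbs_trace Y \<beta> c z (?A k)) \<le> C * \<rho>" .
    moreover have "(\<Sum>k\<in>K. gain k - 4 * t * (LINT z|lborel. ?w k z)) \<le>
       (\<Sum>k\<in>K. LINT z|lborel. ?\<eta> k z * gibbs_trace Y \<beta> c z (?A k))"
      by (intro sum_mono each)
    ultimately have "(\<Sum>k\<in>K. gain k - 4 * t * (LINT z|lborel. ?w k z)) \<le> C * \<rho>" by linarith
    then show ?thesis by (simp add: J_def sum_subtractf sum_distrib_left)
  qed
  have J: "0 \<le> J" unfolding J_def by (intro sum_nonneg integral_nonneg_AE AE_I2 ell_weight_nonneg)
  have "(\<Sum>k\<in>K. gain k) \<le> C * \<rho>"
  proof (rule field_le_epsilon)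
    fix e :: real assume "0 < e"
    \<comment> \<open>The summand 1 keeps the denominator positive when
      \<open>J = 0\<close>.\<close>
    define t where "t = min t0 (e / (4 * (J + 1)))"
    have t: "0 < t" "t \<le> t0" using t0(1) K \<open>0 < e\<close> J by (auto simp: t_def)
    have "4 * t * J \<le> 4 * (e / (4 * (J + 1))) * J" using J by (intro mult_right_mono) (auto simp: t_def)
    also have "\<dots> \<le> e" using J \<open>0 < e\<close> by (simp add: field_simps)
    finally show "(\<Sum>k\<in>K. gain k) \<le> C * \<rho> + e" using main[OF t] by linarith
  qed
  then show ?thesis by (simp add: gain sum_distrib_left[symmetric] \<rho>_def)
qed

section \<open>Vitali packings and their finite subfamilies\<close>

lemma finite_subunion_measure:
  assumes C: "countable C" and B: "\<And>i. i \<in> C \<Longrightarrow> B i \<in> sets N" and a: "a < emeasure N (\<Union>i\<in>C. B i)"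
  obtains F where "finite F" "F \<subseteq> C" "a < emeasure N (\<Union>i\<in>F. B i)"
proof -
  have "C \<noteq> {}" using a by auto
  then have range: "range (from_nat_into C) = C" by (rule range_from_nat_into[OF _ C])
  define F where "F n = from_nat_into C ` {..n}" for n :: nat
  have F: "finite (F n)" "F n \<subseteq> C" for n using range by (auto simp: F_def)
  have "i \<in> (\<Union>n. F n)" if "i \<in> C" for i
  proof -
    have "i \<in> range (from_nat_into C)" using that by (simp only: range)
    then show ?thesis by (auto simp: F_def)
  qed
  then have "(\<Union>n. F n) = C" using F(2) by (intro equalityI UN_least subsetI) auto
  then have UF: "(\<Union>n. \<Union>i\<in>F n. B i) = (\<Union>i\<in>C. B i)" by (metis UN_UN_flatten)
  have "incseq (\<lambda>n. \<Union>i\<in>F n. B i)" by (intro incseq_SucI UN_mono) (auto simp: F_def)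
  moreover have "range (\<lambda>n. \<Union>i\<in>F n. B i) \<subseteq> sets N" using F B by (auto intro!: sets.finite_UN)
  ultimately have "(SUP n. emeasure N (\<Union>i\<in>F n. B i)) = emeasure N (\<Union>i\<in>C. B i)"
    using SUP_emeasure_incseq[of "\<lambda>n. \<Union>i\<in>F n. B i" N] UF by simp
  with a have "a < (SUP n. emeasure N (\<Union>i\<in>F n. B i))" by simp
  then obtain n where "a < emeasure N (\<Union>i\<in>F n. B i)" unfolding less_SUP_iff by blast
  with F show ?thesis by (intro that[of "F n"])
qed

text \<open>Vitali's theorem, applied to the fine cover by balls inside \<open>U\<close> with centre
  in \<open>U\<close>. The gauge \<open>\<delta>\<close> prescribes at each centre how small the
  ball must be for a local comparison to hold on it.\<close>

lemma ball_packing: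
  fixes U :: "'a::euclidean_space set"
  assumes "open U" and \<delta>: "\<And>x. x \<in> U \<Longrightarrow> 0 < \<delta> x"
  obtains C :: "('a \<times> real) set" where "countable C"
    "\<And>a s. (a, s) \<in> C \<Longrightarrow> a \<in> U \<and> 0 < s \<and> s < \<delta> a \<and> ball a s \<subseteq> U"
    "disjoint_family_on (\<lambda>(a, s). ball a s) C" "negligible (U - (\<Union>(a, s)\<in>C. ball a s))"
proof -
  let ?K = "{(a, s). a \<in> U \<and> 0 < s \<and> s < \<delta> a \<and> ball a s \<subseteq> U}"
  have cov: "\<exists>i. i \<in> ?K \<and> x \<in> ball (fst i) (snd i) \<and> snd i < d" if x: "x \<in> U" and "0 < d" for x d
  proof -
    obtain e where "0 < e" "ball x e \<subseteq> U" using \<open>open U\<close> x openE by blast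
    define s where "s = min e (min (d/2) (\<delta> x / 2))"
    have s: "0 < s" "s < d" "s < \<delta> x" "ball x s \<subseteq> ball x e"
      using \<open>0 < e\<close> \<open>0 < d\<close> \<delta>[OF x] by (auto simp: s_def intro!: subset_ball)
    then have "(x, s) \<in> ?K" using x \<open>ball x e \<subseteq> U\<close> by auto
    with s show ?thesis by (intro exI[of _ "(x, s)"]) auto
  qed
  obtain C where C: "countable C" "C \<subseteq> ?K"
     "pairwise (\<lambda>i j. disjnt (ball (fst i) (snd i)) (ball (fst j) (snd j))) C"
     "negligible (U - (\<Union>i\<in>C. ball (fst i) (snd i)))"
    by (rule Vitali_covering_theorem_balls[of U ?K fst snd, OF cov])
  show ?thesis
  proof (rule that[of C])
    show "a \<in> U \<and> 0 < s \<and> s < \<delta> a \<and> ball a s \<subseteq> U" if "(a, s) \<in> C" for a s using C(2) that by auto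
    show "disjoint_family_on (\<lambda>(a, s). ball a s) C"
      using C(3) by (auto simp: disjoint_family_on_def pairwise_def disjnt_def split_beta)
  qed (use C in \<open>auto simp: split_beta\<close>)
qed

text \<open>The regions on which the field is nearly constant are balls, but the gain is computed on
  ellipsoids of the shape of the field. Pulled back by \<open>M\<close>, the task is a packing of an
  open set by balls; a finite part covers more than half of it, whence the factor 2, and
  \<open>L\<close> maps this part forward.\<close>

lemma ellipsoid_packing:
  fixes L M :: "real^'n^'n"
  assumes L_M: "L ** M = mat 1" and M_L: "M ** L = mat 1" and s: "0 < s"
  obtains P :: "((real^'n) \<times> real) set" where "finite P" "\<And>a r. (a, r) \<in> P \<Longrightarrow> 0 < r"
    "\<And>a r. (a, r) \<in> P \<Longrightarrow> (\<lambda>z. a + L *v z) ` ball 0 r \<subseteq> ball x s"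
    "disjoint_family_on (\<lambda>(a, r). (\<lambda>z. a + L *v z) ` ball 0 r) P"
    "measure lborel (ball x s) \<le> 2 * (\<Sum>(a, r)\<in>P. \<bar>det L\<bar> * r ^ CARD('n) * ball_vol TYPE(real^'n))"
proof -
  have LMv: "L *v (M *v y) = y" and MLv: "M *v (L *v y) = y" for y
    by (simp_all add: matrix_vector_mul_assoc L_M M_L)
  let ?U = "(*v) M ` ball x s"
  have U_eq: "?U = (*v) L -` ball x s"
    using LMv MLv by (auto simp: image_iff) (metis mem_ball)
  have "open ?U" unfolding U_eq by (intro open_vimage matrix_vector_mult_linear_continuous_on) auto
  then obtain C where C: "countable C" "\<And>a r. (a, r) \<in> C \<Longrightarrow> a \<in> ?U \<and> 0 < r \<and> r < 1 \<and> ball a r \<subseteq> ?U"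
    "disjoint_family_on (\<lambda>(a, r). ball a r) C" "negligible (?U - (\<Union>(a, r)\<in>C. ball a r))"
    by (rule ball_packing[of _ "\<lambda>_. 1"]) auto
  have dL: "0 < \<bar>det L\<bar>" "\<bar>det L\<bar> * \<bar>det M\<bar> = 1"
    using det_mul[of L M] L_M by (auto simp: abs_mult[symmetric])
  have mU: "?U \<in> lmeasurable" "measure lebesgue ?U = \<bar>det M\<bar> * measure lborel (ball x s)"
    using matrix_image_measure[of "ball x s" M] by (simp_all add: measure_completion)
  have "0 < measure lebesgue ?U"
    using dL s content_ball_pos[of s x] mU(2) by (auto intro!: mult_pos_pos simp: zero_less_abs_iff)
  have Um: "?U \<in> sets borel" using \<open>open ?U\<close> by simp
  have "emeasure lborel ?U = emeasure lebesgue ?U" using Um by (simp add: emeasure_completion)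
  also have "\<dots> = ennreal (measure lebesgue ?U)" by (rule emeasure_eq_measure2[OF mU(1)])
  finally have eU: "emeasure lborel ?U = ennreal (measure lebesgue ?U)" .
  let ?B = "\<lambda>(a, r). ball a r :: (real^'n) set"
  have "emeasure lborel ?U \<le> emeasure lborel (\<Union>i\<in>C. ?B i)"
  proof -
    define V where "V = (\<Union>i\<in>C. ?B i)"
    have V: "V \<in> sets lborel" unfolding V_def by (auto intro!: borel_open open_UN)
    have null: "?U - V \<in> null_sets lborel"
      using C(4) Um V by (auto simp: V_def negligible_iff_null_sets null_sets_completion_iff)
    have "emeasure lborel ?U \<le> emeasure lborel (V \<union> (?U - V))"
      using Um V by (intro emeasure_mono) auto
    also have "\<dots> = emeasure lborel V" by (rule emeasure_Un_null_set[OF V null])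
    finally show ?thesis by (simp only: V_def)
  qed
  moreover have "ennreal (measure lebesgue ?U / 2) < emeasure lborel ?U"
    using \<open>0 < measure lebesgue ?U\<close> eU by (simp add: ennreal_less_iff)
  ultimately have "ennreal (measure lebesgue ?U / 2) < emeasure lborel (\<Union>i\<in>C. ?B i)" by (rule order.strict_trans2[rotated])
  then obtain F where F: "finite F" "F \<subseteq> C" "ennreal (measure lebesgue ?U / 2) < emeasure lborel (\<Union>i\<in>F. ?B i)"
    by (rule finite_subunion_measure[OF C(1), rotated]) auto
  have "emeasure lborel (\<Union>i\<in>F. ?B i) = (\<Sum>i\<in>F. emeasure lborel (?B i))"
    using F by (intro sum_emeasure[symmetric] disjoint_family_on_mono[OF F(2) C(3)]) auto
  also have "\<dots> = (\<Sum>i\<in>F. ennreal (snd i ^ CARD('n) * ball_vol TYPE(real^'n)))"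
  proof (intro sum.cong refl)
    fix i assume "i \<in> F"
    moreover obtain a r where i: "i = (a, r)" by force
    ultimately have "0 < r" using F C(2) by auto
    have "emeasure lborel (ball a r) = ennreal (measure lborel (ball a r))"
      by (intro emeasure_eq_ennreal_measure) (use emeasure_bounded_finite[OF bounded_ball[of a r]] in auto)
    also have "measure lborel (ball a r) = r ^ CARD('n) * ball_vol TYPE(real^'n)"
      using content_ball_conv_unit_ball[of r a] \<open>0 < r\<close> by (simp add: ball_vol_def)
    finally show "emeasure lborel (?B i) = ennreal (snd i ^ CARD('n) * ball_vol TYPE(real^'n))" by (simp add: i)
  qed
  also have "\<dots> = ennreal (\<Sum>i\<in>F. snd i ^ CARD('n) * ball_vol TYPE(real^'n))"
  proof (intro sum_ennreal mult_nonneg_nonneg zero_le_power)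
    fix i assume "i \<in> F"
    then show "0 \<le> snd i" using F(2) C(2)[of "fst i" "snd i"] by auto
  qed (rule less_imp_le[OF ball_vol_pos])
  finally have "ennreal (measure lebesgue ?U / 2) < ennreal (\<Sum>i\<in>F. snd i ^ CARD('n) * ball_vol TYPE(real^'n))"
    using F by simp
  then have sum: "measure lebesgue ?U / 2 < (\<Sum>i\<in>F. snd i ^ CARD('n) * ball_vol TYPE(real^'n))"
    by (subst (asm) ennreal_less_iff) auto
  define P where "P = (\<lambda>(a, r). (L *v a, r)) ` F"
  have inj: "inj_on (\<lambda>(a, r). (L *v a, r)) F" by (rule inj_onI) (metis (mono_tags, lifting) MLv Pair_inject case_prod_beta prod.expand)
  have im: "(\<lambda>z. L *v a + L *v z) ` ball 0 r = (*v) L ` ball a r" for a r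
  proof -
    have "(*v) L ` ((+) a ` ball 0 r) = (\<lambda>z. L *v a + L *v z) ` ball 0 r"
      by (simp only: image_image matrix_vector_right_distrib)
    moreover have "(+) a ` ball 0 r = ball a r" using ball_translation[of a 0 r] by simp
    ultimately show ?thesis by (simp only:)
  qed
  show ?thesis
  proof (rule that[of P])
    show "finite P" using F by (simp add: P_def)
    show "0 < r" if "(a, r) \<in> P" for a r using that F C(2) by (auto simp: P_def)
    show "(\<lambda>z. a + L *v z) ` ball 0 r \<subseteq> ball x s" if aP: "(a, r) \<in> P" for a r
    proof -
      obtain a' where a': "(a', r) \<in> F" "a = L *v a'" using aP by (auto simp: P_def)
      then have "ball a' r \<subseteq> (*v) L -` ball x s" using F C(2) U_eq by blast
      then show ?thesis unfolding a'(2) im by auto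
    qed
    show "disjoint_family_on (\<lambda>(a, r). (\<lambda>z. a + L *v z) ` ball 0 r) P"
    proof -
      have injL: "inj ((*v) L)" by (rule injI) (metis MLv)
      have disj: "((*v) L ` ball a r) \<inter> ((*v) L ` ball a' r') = {}"
        if "(a, r) \<in> F" "(a', r') \<in> F" "(a, r) \<noteq> (a', r')" for a r a' r'
      proof -
        have "ball a r \<inter> ball a' r' = {}"
          using disjoint_family_onD[OF C(3) subsetD[OF F(2) that(1)] subsetD[OF F(2) that(2)] that(3)] by simp
        then show ?thesis by (simp add: image_Int[OF injL, symmetric])
      qed
      show ?thesis
        unfolding disjoint_family_on_def
      proof (intro ballI impI)
        fix p p' assume "p \<in> P" "p' \<in> P" and ne: "p \<noteq> p'"
        then obtain a r a' r' where F: "(a, r) \<in> F" "(a', r') \<in> F" and p: "p = (L *v a, r)" "p' = (L *v a', r')"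
          unfolding P_def by auto
        have "(a, r) \<noteq> (a', r')" using ne p by auto
        from disj[OF F this] show "(case p of (a, r) \<Rightarrow> (\<lambda>z. a + L *v z) ` ball 0 r) \<inter>
            (case p' of (a, r) \<Rightarrow> (\<lambda>z. a + L *v z) ` ball 0 r) = {}"
          by (simp only: p prod.case im)
      qed
    qed
    have "measure lborel (ball x s) = \<bar>det L\<bar> * measure lebesgue ?U"
      unfolding mU(2) using dL(2) by (metis mult.assoc mult_1)
    also have "\<dots> \<le> \<bar>det L\<bar> * (2 * (\<Sum>i\<in>F. snd i ^ CARD('n) * ball_vol TYPE(real^'n)))"
      using sum dL(1) by (intro mult_left_mono) auto
    also have "\<dots> = 2 * (\<Sum>(a, r)\<in>P. \<bar>det L\<bar> * r ^ CARD('n) * ball_vol TYPE(real^'n))"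
      unfolding P_def by (subst sum.reindex[OF inj]) (simp add: split_beta sum_distrib_left mult_ac)
    finally show "measure lborel (ball x s) \<le> 2 * (\<Sum>(a, r)\<in>P. \<bar>det L\<bar> * r ^ CARD('n) * ball_vol TYPE(real^'n))" .
  qed
qed

section \<open>The determinant bound\<close>

lemma det_scaleR: "det (c *\<^sub>R A) = c ^ CARD('n) * det A" for A :: "real^'n^'n"
proof -
  have "c *\<^sub>R A = (c *\<^sub>R mat 1) ** A" by (simp add: scalar_matrix_assoc[symmetric])
  moreover have "det (c *\<^sub>R mat 1 :: real^'n^'n) = c ^ CARD('n)"
    by (subst det_diagonal) (auto simp: mat_def)
  ultimately show ?thesis by (simp add: det_mul)
qed

lemma quadratic_form_bound:
  fixes M :: "real^'n^'n"
  shows "\<bar>v \<bullet> (M *v v)\<bar> \<le> (\<Sum>i\<in>UNIV. \<Sum>j\<in>UNIV. \<bar>M $ i $ j\<bar>) * (norm v)\<^sup>2"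
proof -
  have "\<bar>v \<bullet> (M *v v)\<bar> \<le> (\<Sum>i\<in>UNIV. \<Sum>j\<in>UNIV. \<bar>M $ i $ j * (v $ i * v $ j)\<bar>)"
    unfolding quadratic_form_eq by (intro order.trans[OF sum_abs] sum_mono) auto
  also have "\<dots> \<le> (\<Sum>i\<in>UNIV. \<Sum>j\<in>UNIV. \<bar>M $ i $ j\<bar> * (norm v * norm v))"
    unfolding abs_mult by (intro sum_mono mult_left_mono mult_mono component_le_norm_cart) auto
  finally show ?thesis by (simp add: sum_distrib_right power2_eq_square)
qed

text \<open>The least value \<open>\<mu>\<close> of the form on the unit sphere is positive by
  compactness. Near \<open>y\<close> the entries change by less than \<open>\<mu> / 2\<close> in
  total, which cannot consume more than half of the form.\<close>

lemma pos_def_nearby: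
  fixes b :: "real^'n \<Rightarrow> real^'n^'n"
  assumes cont: "continuous_on UNIV b" and pos: "\<And>v. v \<noteq> 0 \<Longrightarrow> 0 < v \<bullet> (b y *v v)" and det: "0 < det (b y)"
  shows "\<exists>\<delta>>0. \<forall>z\<in>ball y \<delta>. (\<forall>v. v \<bullet> (((1/2) *\<^sub>R b y) *v v) \<le> v \<bullet> (b z *v v)) \<and> det (b z) \<le> 2 * det (b y)"
proof -
  have "continuous_on (sphere 0 1) (\<lambda>v. v \<bullet> (b y *v v))"
    by (intro continuous_intros continuous_on_compose2[OF matrix_vector_mult_linear_continuous_on, of UNIV])
  moreover have "sphere (0::real^'n) 1 \<noteq> {}" by simp
  ultimately obtain v0 where v0: "v0 \<in> sphere 0 1" "\<And>v. v \<in> sphere 0 1 \<Longrightarrow> v0 \<bullet> (b y *v v0) \<le> v \<bullet> (b y *v v)"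
    using continuous_attains_inf[OF compact_sphere] by blast
  define \<mu> where "\<mu> = v0 \<bullet> (b y *v v0)"
  have \<mu>: "0 < \<mu>" unfolding \<mu>_def using v0(1) by (intro pos) auto
  have low: "\<mu> * (norm v)\<^sup>2 \<le> v \<bullet> (b y *v v)" for v
  proof (cases "v = 0")
    case False
    let ?u = "v /\<^sub>R norm v"
    have "\<mu> \<le> ?u \<bullet> (b y *v ?u)" unfolding \<mu>_def using False by (intro v0) auto
    then have "\<mu> * (norm v)\<^sup>2 \<le> (?u \<bullet> (b y *v ?u)) * (norm v)\<^sup>2" by (rule mult_right_mono) simp
    also have "\<dots> = v \<bullet> (b y *v v)"
      using False by (simp add: matrix_vector_mult_scaleR power2_eq_square field_simps)
    finally show ?thesis .
  qed simp
  let ?e = "\<lambda>z. \<Sum>i\<in>UNIV. \<Sum>j\<in>UNIV. \<bar>(b z - b y) $ i $ j\<bar>"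
  have "isCont ?e y" "isCont (\<lambda>z. det (b z)) y"
    using cont continuous_on_det[OF cont]
    by (auto simp: continuous_on_eq_continuous_at intro!: continuous_intros)
  then have "(?e \<longlongrightarrow> ?e y) (nhds y)" "((\<lambda>z. det (b z)) \<longlongrightarrow> det (b y)) (nhds y)"
    using tendsto_at_iff_tendsto_nhds[of ?e y] tendsto_at_iff_tendsto_nhds[of "\<lambda>z. det (b z)" y]
    by (simp_all only: isCont_def)
  then have "eventually (\<lambda>z. ?e z < \<mu> / 2 \<and> det (b z) < 2 * det (b y)) (nhds y)"
    using \<mu> det order_tendstoD(2)[of ?e "?e y" "nhds y" "\<mu> / 2"]
      order_tendstoD(2)[of "\<lambda>z. det (b z)" "det (b y)" "nhds y" "2 * det (b y)"]
    by (auto intro: eventually_conj)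
  then obtain \<delta> where \<delta>: "0 < \<delta>" "\<And>z. z \<in> ball y \<delta> \<Longrightarrow> ?e z < \<mu> / 2 \<and> det (b z) < 2 * det (b y)"
    by (auto simp: eventually_nhds_metric dist_commute)
  show ?thesis
  proof (intro exI[of _ \<delta>] conjI ballI allI \<delta>(1))
    fix z v assume z: "z \<in> ball y \<delta>"
    have "\<bar>v \<bullet> ((b z - b y) *v v)\<bar> \<le> ?e z * (norm v)\<^sup>2" by (rule quadratic_form_bound)
    also have "\<dots> \<le> \<mu> / 2 * (norm v)\<^sup>2" using \<delta>(2)[OF z] by (intro mult_right_mono) auto
    also have "\<dots> \<le> 1/2 * (v \<bullet> (b y *v v))" using low[of v] by simp
    finally have "\<bar>v \<bullet> (b z *v v) - v \<bullet> (b y *v v)\<bar> \<le> 1/2 * (v \<bullet> (b y *v v))"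
      by (simp only: matrix_vector_mult_diff_rdistrib inner_diff_right)
    then have "1/2 * (v \<bullet> (b y *v v)) \<le> v \<bullet> (b z *v v)" by linarith
    then show "v \<bullet> (((1/2) *\<^sub>R b y) *v v) \<le> v \<bullet> (b z *v v)"
      by (simp add: scaleR_matrix_vector_assoc[symmetric])
  qed (use \<delta>(2) in \<open>blast intro: less_imp_le\<close>)
qed

text \<open>Division by \<open>S powr (1 / d)\<close> leaves the power \<open>(d - 1) / d\<close> of
  \<open>S\<close>, which is then inverted. The upper bound grows more slowly than the gain, and so
  the total mass is bounded.\<close>

lemma root_bound:
  fixes S c C :: real
  assumes d: "2 \<le> (d::nat)" and "0 < c" "0 \<le> C" "0 \<le> S" and le: "c * S \<le> C * root d S"
  shows "S \<le> (C / c) powr (real d / (real d - 1))"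
proof (cases "S = 0")
  case False
  then have S: "0 < S" using assms by simp
  have d': "0 < real d" "0 < real d - 1" using d by auto
  have "root d S = S powr (1 / real d)" using d S by (intro root_powr_inverse) auto
  then have "c * S \<le> C * S powr (1 / real d)" using le by simp
  moreover have "S = S powr ((real d - 1) / real d) * S powr (1 / real d)"
    using S d' by (subst powr_add[symmetric]) (simp add: diff_divide_distrib)
  ultimately have "(c * S powr ((real d - 1) / real d)) * S powr (1 / real d) \<le> C * S powr (1 / real d)"
    by (metis mult.assoc)
  then have "c * S powr ((real d - 1) / real d) \<le> C" using S by (simp add: mult_le_cancel_right)
  then have "S powr ((real d - 1) / real d) \<le> C / c" using \<open>0 < c\<close> by (simp add: field_simps)
  then have "(S powr ((real d - 1) / real d)) powr (real d / (real d - 1)) \<le> (C / c) powr (real d / (real d - 1))"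
    using d' by (intro powr_mono2) auto
  then show ?thesis using S d' by (simp add: powr_powr)
qed simp

text \<open>The leading 2 is the loss of volume in the packing by ellipsoids, the second factor
  compares \<open>det (b z)\<close> with the square of \<open>det L\<close>, and the last one comes
  from \<open>root_bound\<close>.\<close>

definition det_bound_const :: "'n::finite itself \<Rightarrow> real \<Rightarrow> real" where
  "det_bound_const _ C = 2 * (2 ^ (CARD('n) + 1)) powr (1 / (real CARD('n) - 1)) *
     (C / packing_const TYPE('n)) powr (real CARD('n) / (real CARD('n) - 1))"

text \<open>Negating the claim gives a strict inequality, which survives the passage from a
  countable packing to a finite one, and only finite families enter the transport construction. Two
  scales occur: small balls on which the field is comparable to a constant matrix, and in each ball
  a packing by ellipsoids of the shape of that matrix.\<close>

lemma continuous_det_bound: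
  fixes b :: "real^'n \<Rightarrow> real^'n^'n"
  assumes d: "2 \<le> CARD('n)" and cont: "continuous_on UNIV b"
    and sym: "\<And>y. transpose (b y) = b y" and psd: "\<And>y v. 0 \<le> v \<bullet> (b y *v v)"
    and bound: "trace_bounded b C" and C: "0 \<le> C"
  shows "(\<integral>\<^sup>+y. ennreal (det (b y) powr (1 / (real CARD('n) - 1))) \<partial>lborel) \<le> ennreal (det_bound_const TYPE('n) C)"
proof (rule ccontr)
  let ?d = "CARD('n)" and ?p = "1 / (real CARD('n) - 1)" and ?\<omega> = "ball_vol TYPE(real^'n)"
  let ?\<kappa> = "(2 ^ (CARD('n) + 1)) powr (1 / (real CARD('n) - 1)) :: real"
  define g where "g y = ennreal (det (b y) powr ?p)" for y
  assume neg: "\<not> ?thesis"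
  then have big: "ennreal (det_bound_const TYPE('n) C) < (\<integral>\<^sup>+y. g y \<partial>lborel)" by (simp add: g_def)
  have p: "0 < ?p" using d by simp
  have [measurable]: "(\<lambda>y. det (b y)) \<in> borel_measurable borel"
    by (intro borel_measurable_continuous_onI continuous_on_det cont)
  have gm[measurable]: "g \<in> borel_measurable borel" unfolding g_def by measurable
  define U where "U = {y. 0 < det (b y)}"
  have "open U" unfolding U_def by (intro open_Collect_less continuous_on_const continuous_on_det cont)
  have g0: "g y = 0" if "y \<notin> U" for y
    using that psd_det_nonneg[OF sym psd, of y] by (simp add: g_def U_def)
  \<comment> \<open>The shape is a factor of half of \<open>b y\<close>; the half is what keeps
    \<open>L ** transpose L\<close> below \<open>b z\<close> on the whole ball.\<close>
  have "\<exists>\<delta> L M. 0 < \<delta> \<and> L ** M = mat 1 \<and> M ** L = mat 1 \<and>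
      (\<forall>z\<in>ball y \<delta>. (\<forall>v. v \<bullet> ((L ** transpose L) *v v) \<le> v \<bullet> (b z *v v)) \<and>
        det (b z) powr ?p \<le> ?\<kappa> * \<bar>det L\<bar> powr (2 / (real ?d - 1)))" if "y \<in> U" for y
  proof -
    have dy: "0 < det (b y)" using that by (simp add: U_def)
    have pos: "0 < v \<bullet> (b y *v v)" if "v \<noteq> 0" for v
      by (rule psd_det_pos_imp_pos_def[OF sym psd dy that])
    obtain \<delta> where \<delta>: "0 < \<delta>" "\<And>z v. z \<in> ball y \<delta> \<Longrightarrow> v \<bullet> (((1/2) *\<^sub>R b y) *v v) \<le> v \<bullet> (b z *v v)"
       "\<And>z. z \<in> ball y \<delta> \<Longrightarrow> det (b z) \<le> 2 * det (b y)"
      using pos_def_nearby[OF cont pos dy] by blast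
    have "transpose ((1/2) *\<^sub>R b y) = (1/2) *\<^sub>R transpose (b y)"
      by (simp add: transpose_def vec_eq_iff)
    then have "transpose ((1/2) *\<^sub>R b y) = (1/2) *\<^sub>R b y" by (simp only: sym)
    moreover have "0 < v \<bullet> (((1/2) *\<^sub>R b y) *v v)" if "v \<noteq> 0" for v
      using pos[OF that] by (simp add: scaleR_matrix_vector_assoc[symmetric])
    ultimately obtain L M :: "real^'n^'n" where L: "L ** M = mat 1" "M ** L = mat 1" "(1/2) *\<^sub>R b y = L ** transpose L"
      by (rule spd_factorization)
    have "det L * det L = (1/2) ^ ?d * det (b y)"
      using arg_cong[OF L(3), of det] by (simp add: det_mul det_scaleR)
    \<comment> \<open>Halving the matrix costs \<open>2 ^ d\<close> in the determinant, and its
      variation over the ball costs one more factor 2.\<close>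
    then have dL: "2 * det (b y) = 2 ^ (?d + 1) * (\<bar>det L\<bar>)\<^sup>2"
      by (simp add: power2_eq_square power_divide)
    have "det (b z) powr ?p \<le> ?\<kappa> * \<bar>det L\<bar> powr (2 / (real ?d - 1))" if z: "z \<in> ball y \<delta>" for z
    proof -
      have "det (b z) powr ?p \<le> (2 ^ (?d + 1) * (\<bar>det L\<bar>)\<^sup>2) powr ?p"
        using p \<delta>(3)[OF z] dL psd_det_nonneg[OF sym psd, of z] by (intro powr_mono2) auto
      also have "\<dots> = ?\<kappa> * ((\<bar>det L\<bar>)\<^sup>2) powr ?p" by (intro powr_mult)
      also have "((\<bar>det L\<bar>)\<^sup>2) powr ?p = \<bar>det L\<bar> powr (2 / (real ?d - 1))"
      proof (cases "det L = 0")
        case False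
        then have "(\<bar>det L\<bar>)\<^sup>2 = \<bar>det L\<bar> powr 2" by simp
        then show ?thesis by (simp only: powr_powr) simp
      qed simp
      finally show ?thesis .
    qed
    then show ?thesis using \<delta>(1,2) L unfolding L(3) by blast
  qed
  then obtain \<delta> L M where loc: "\<And>y. y \<in> U \<Longrightarrow> 0 < \<delta> y \<and> L y ** M y = mat 1 \<and> M y ** L y = mat 1 \<and>
      (\<forall>z\<in>ball y (\<delta> y). (\<forall>v. v \<bullet> ((L y ** transpose (L y)) *v v) \<le> v \<bullet> (b z *v v)) \<and>
        det (b z) powr ?p \<le> ?\<kappa> * \<bar>det (L y)\<bar> powr (2 / (real ?d - 1)))"
    by metis
  obtain B where B: "countable B" "\<And>a s. (a, s) \<in> B \<Longrightarrow> a \<in> U \<and> 0 < s \<and> s < \<delta> a \<and> ball a s \<subseteq> U"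
     "disjoint_family_on (\<lambda>(a, s). ball a s) B" "negligible (U - (\<Union>(a, s)\<in>B. ball a s))"
    by (rule ball_packing[OF \<open>open U\<close>, of \<delta>]) (use loc in blast)+
  \<comment> \<open>With \<open>g\<close> as density the determinant integral becomes a measure, to
    which the exhaustion by finite subfamilies applies.\<close>
  let ?N = "density lborel g"
  define V where "V = (\<Union>(a, s)\<in>B. ball a s)"
  have V: "V \<in> sets borel" unfolding V_def by (auto intro!: borel_open open_UN)
  have "U \<in> sets borel" using \<open>open U\<close> by simp
  have "(\<integral>\<^sup>+y. g y \<partial>lborel) = (\<integral>\<^sup>+y. g y * indicator V y \<partial>lborel)"
  proof (rule nn_integral_cong_AE)
    have "U - V \<in> null_sets lborel"
      using B(4) V \<open>U \<in> sets borel\<close> by (auto simp: V_def negligible_iff_null_sets null_sets_completion_iff)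
    from AE_not_in[OF this] show "AE y in lborel. g y = g y * indicator V y"
      by eventually_elim (auto simp: indicator_def g0)
  qed
  also have "\<dots> = emeasure ?N V" using V gm by (simp add: emeasure_density)
  finally have "ennreal (det_bound_const TYPE('n) C) < emeasure ?N (\<Union>(a, s)\<in>B. ball a s)"
    using big by (simp add: V_def)
  then obtain F where F: "finite F" "F \<subseteq> B" "ennreal (det_bound_const TYPE('n) C) < emeasure ?N (\<Union>(a, s)\<in>F. ball a s)"
    by (rule finite_subunion_measure[OF B(1), rotated]) auto
  have FB: "fst i \<in> U" "0 < snd i" "snd i < \<delta> (fst i)" if "i \<in> F" for i
    using B(2)[of "fst i" "snd i"] F(2) that by auto
  have FL: "L (fst i) ** M (fst i) = mat 1" "M (fst i) ** L (fst i) = mat 1" if "i \<in> F" for i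
    using loc[OF FB(1)[OF that]] by auto
  define f where "f i = \<bar>det (L (fst i))\<bar> powr (2 / (real ?d - 1))" for i :: "(real^'n) \<times> real"
  define packs where "packs i P \<longleftrightarrow> finite P \<and>
      (\<forall>a r. (a, r) \<in> P \<longrightarrow> 0 < r \<and> (\<lambda>z. a + L (fst i) *v z) ` ball 0 r \<subseteq> ball (fst i) (snd i)) \<and>
      disjoint_family_on (\<lambda>(a, r). (\<lambda>z. a + L (fst i) *v z) ` ball 0 r) P \<and>
      measure lborel (ball (fst i) (snd i)) \<le> 2 * (\<Sum>(a, r)\<in>P. \<bar>det (L (fst i))\<bar> * r ^ ?d * ?\<omega>)"
    for i :: "(real^'n) \<times> real" and P
  have "\<exists>P. packs i P" if "i \<in> F" for i
  proof (rule ellipsoid_packing[OF FL[OF that] FB(2)[OF that], of "fst i"])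
    fix P :: "((real^'n) \<times> real) set"
    assume P: "finite P" "\<And>a r. (a, r) \<in> P \<Longrightarrow> 0 < r"
      "\<And>a r. (a, r) \<in> P \<Longrightarrow> (\<lambda>z. a + L (fst i) *v z) ` ball 0 r \<subseteq> ball (fst i) (snd i)"
      "disjoint_family_on (\<lambda>(a, r). (\<lambda>z. a + L (fst i) *v z) ` ball 0 r) P"
      "measure lborel (ball (fst i) (snd i)) \<le> 2 * (\<Sum>(a, r)\<in>P. \<bar>det (L (fst i))\<bar> * r ^ ?d * ?\<omega>)"
    show ?thesis
      unfolding packs_def by (intro exI[of _ P] conjI allI impI; (rule P | (drule P, assumption)); assumption?)
  qed
  then have "\<forall>i\<in>F. \<exists>P. packs i P" by (rule ballI)
  from bchoice[OF this] obtain P where packs: "\<forall>i\<in>F. packs i (P i)" by (rule exE)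
  have P: "finite (P i)"
      "\<And>a r. (a, r) \<in> P i \<Longrightarrow> 0 < r \<and> (\<lambda>z. a + L (fst i) *v z) ` ball 0 r \<subseteq> ball (fst i) (snd i)"
      "disjoint_family_on (\<lambda>(a, r). (\<lambda>z. a + L (fst i) *v z) ` ball 0 r) (P i)"
      "measure lborel (ball (fst i) (snd i)) \<le> 2 * (\<Sum>(a, r)\<in>P i. \<bar>det (L (fst i))\<bar> * r ^ ?d * ?\<omega>)"
    if "i \<in> F" for i
    using bspec[OF packs that, unfolded packs_def] by simp_all
  \<comment> \<open>An index is a ball together with one of its ellipsoids. Ellipsoids in the same
    ball are disjoint by its packing, and those in different balls because the balls are
    disjoint.\<close>
  define K where "K = Sigma F P"
  let ?S = "\<Sum>k\<in>K. ell_mass (L (fst (fst k))) (snd (snd k))"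
  have Kfin: "finite K" unfolding K_def using F P by (intro finite_SigmaI) auto
  have K_in: "fst k \<in> F" "snd k \<in> P (fst k)" if "k \<in> K" for k using that by (auto simp: K_def)
  have Sbound: "?S \<le> (C / packing_const TYPE('n)) powr (real ?d / (real ?d - 1))"
  proof (cases "K = {}")
    case False
    have sub: "(\<lambda>z. fst (snd k) + L (fst (fst k)) *v z) ` ball 0 (snd (snd k)) \<subseteq> ball (fst (fst k)) (snd (fst k))"
       and rpos: "0 < snd (snd k)" if "k \<in> K" for k
      using P(2)[OF K_in(1)[OF that], of "fst (snd k)" "snd (snd k)"] K_in(2)[OF that] by auto
    have "packing_const TYPE('n) * ?S \<le> C * root ?d ?S"
    proof (rule packing_estimate[OF d psd bound C Kfin False, where M = "\<lambda>k. M (fst (fst k))" and x = "\<lambda>k. fst (snd k)"])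
      show "ellipsoid (L (fst (fst k))) (M (fst (fst k))) (snd (snd k))" if "k \<in> K" for k
        using FL[OF K_in(1)[OF that]] rpos[OF that] by (simp add: ellipsoid_def)
      show "disjoint_family_on (\<lambda>k. (\<lambda>z. fst (snd k) + L (fst (fst k)) *v z) ` ball 0 (snd (snd k))) K"
        unfolding disjoint_family_on_def
      proof (intro ballI impI)
        fix k k' assume k: "k \<in> K" "k' \<in> K" "k \<noteq> k'"
        show "(\<lambda>z. fst (snd k) + L (fst (fst k)) *v z) ` ball 0 (snd (snd k)) \<inter>
            (\<lambda>z. fst (snd k') + L (fst (fst k')) *v z) ` ball 0 (snd (snd k')) = {}"
        proof (cases "fst k = fst k'")
          case True
          then have "snd k \<noteq> snd k'" using k(3) by (auto simp: prod_eq_iff)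
          then show ?thesis
            using disjoint_family_onD[OF P(3)[OF K_in(1)[OF k(1)]] K_in(2)[OF k(1)], of "snd k'"] K_in(2)[OF k(2)] True
            by (simp add: split_beta)
        next
          case False
          have "ball (fst (fst k)) (snd (fst k)) \<inter> ball (fst (fst k')) (snd (fst k')) = {}"
            using disjoint_family_onD[OF B(3), of "fst k" "fst k'"] F(2) K_in(1)[OF k(1)] K_in(1)[OF k(2)] False
            by (auto simp: split_beta)
          then show ?thesis using sub[OF k(1)] sub[OF k(2)] by blast
        qed
      qed
      show "v \<bullet> ((L (fst (fst k)) ** transpose (L (fst (fst k)))) *v v) \<le> v \<bullet> (b z *v v)"
        if k: "k \<in> K" and z: "z \<in> (\<lambda>z. fst (snd k) + L (fst (fst k)) *v z) ` ball 0 (snd (snd k))" for k z v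
      proof -
        have "z \<in> ball (fst (fst k)) (\<delta> (fst (fst k)))"
          using sub[OF k] z FB(3)[OF K_in(1)[OF k]] by auto
        then show ?thesis using loc[OF FB(1)[OF K_in(1)[OF k]]] by blast
      qed
    qed
    then show ?thesis
      using d packing_const_pos C ball_vol_pos[where 'a = "real^'n"] rpos
      by (intro root_bound sum_nonneg) (auto simp: ell_mass_def less_imp_le)
  next
    case True
    then show ?thesis by simp
  qed
  have "emeasure ?N (\<Union>(a, s)\<in>F. ball a s) \<le> (\<Sum>i\<in>F. emeasure ?N (case i of (a, s) \<Rightarrow> ball a s))"
    using F by (intro emeasure_subadditive_finite) auto
  also have "\<dots> \<le> (\<Sum>i\<in>F. ennreal (?\<kappa> * f i * measure lborel (ball (fst i) (snd i))))"
  proof (rule sum_mono)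
    fix i assume i: "i \<in> F"
    have "emeasure ?N (case i of (a, s) \<Rightarrow> ball a s) = (\<integral>\<^sup>+y. g y * indicator (ball (fst i) (snd i)) y \<partial>lborel)"
      using gm by (simp add: split_beta emeasure_density)
    also have "\<dots> \<le> (\<integral>\<^sup>+y. ennreal (?\<kappa> * f i) * indicator (ball (fst i) (snd i)) y \<partial>lborel)"
    proof (rule nn_integral_mono)
      fix y
      show "g y * indicator (ball (fst i) (snd i)) y \<le> ennreal (?\<kappa> * f i) * indicator (ball (fst i) (snd i)) y"
      proof (cases "y \<in> ball (fst i) (snd i)")
        case True
        then have "y \<in> ball (fst i) (\<delta> (fst i))" using FB(3)[OF i] by auto
        then have "det (b y) powr ?p \<le> ?\<kappa> * f i" using loc[OF FB(1)[OF i]] unfolding f_def by blast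
        then show ?thesis using True by (simp add: g_def ennreal_leI)
      qed simp
    qed
    also have "\<dots> = ennreal (?\<kappa> * f i) * emeasure lborel (ball (fst i) (snd i))"
      by (rule nn_integral_cmult_indicator) simp
    also have "emeasure lborel (ball (fst i) (snd i)) = ennreal (measure lborel (ball (fst i) (snd i)))"
      by (intro emeasure_eq_ennreal_measure) (use emeasure_bounded_finite[OF bounded_ball[of "fst i" "snd i"]] in auto)
    finally show "emeasure ?N (case i of (a, s) \<Rightarrow> ball a s) \<le> ennreal (?\<kappa> * f i * measure lborel (ball (fst i) (snd i)))"
      by (simp add: ennreal_mult f_def)
  qed
  also have "\<dots> = ennreal (\<Sum>i\<in>F. ?\<kappa> * f i * measure lborel (ball (fst i) (snd i)))"
    by (intro sum_ennreal) (simp add: f_def)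
  also have "\<dots> \<le> ennreal (2 * ?\<kappa> * ?S)"
  proof (rule ennreal_leI)
    have "(\<Sum>i\<in>F. ?\<kappa> * f i * measure lborel (ball (fst i) (snd i))) \<le>
        (\<Sum>i\<in>F. ?\<kappa> * f i * (2 * (\<Sum>(a, r)\<in>P i. \<bar>det (L (fst i))\<bar> * r ^ ?d * ?\<omega>)))"
      by (intro sum_mono mult_left_mono P(4)) (auto simp: f_def)
    also have "\<dots> = 2 * ?\<kappa> * (\<Sum>i\<in>F. \<Sum>(a, r)\<in>P i. ell_mass (L (fst i)) r)"
      by (simp add: ell_mass_def f_def sum_distrib_left split_beta mult_ac)
    also have "(\<Sum>i\<in>F. \<Sum>(a, r)\<in>P i. ell_mass (L (fst i)) r) = ?S"
      unfolding K_def using F P(1) by (subst sum.Sigma) (auto simp: split_beta)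
    finally show "(\<Sum>i\<in>F. ?\<kappa> * f i * measure lborel (ball (fst i) (snd i))) \<le> 2 * ?\<kappa> * ?S" .
  qed
  also have "\<dots> \<le> ennreal (det_bound_const TYPE('n) C)"
    unfolding det_bound_const_def by (intro ennreal_leI mult_left_mono Sbound) auto
  finally show False using F(3) by simp
qed

section \<open>From continuous fields back to the original one\<close>

lemma mollify_AE_convergent:
  fixes f :: "'a::euclidean_space \<Rightarrow> 'b::{banach, second_countable_topology}"
  assumes f: "integrable lborel f"
  obtains r :: "nat \<Rightarrow> real" where "\<And>n. 0 < r n" "AE x in lborel. (\<lambda>n. mollify (r n) f x) \<longlonglongrightarrow> f x"
proof -
  have [measurable]: "f \<in> borel_measurable borel" using f by auto
  have "\<forall>n. \<exists>r. 0 < r \<and> (\<integral>\<^sup>+y. norm (mollify r f y - f y) \<partial>lborel) \<le> ennreal (1 / real (Suc n))"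
  proof
    fix n
    show "\<exists>r. 0 < r \<and> (\<integral>\<^sup>+y. norm (mollify r f y - f y) \<partial>lborel) \<le> ennreal (1 / real (Suc n))"
      by (rule mollify_L1[OF f, of "1 / real (Suc n)"]) auto
  qed
  from choice[OF this] obtain r where r: "\<And>n. 0 < r n"
    "\<And>n. (\<integral>\<^sup>+y. norm (mollify (r n) f y - f y) \<partial>lborel) \<le> ennreal (1 / real (Suc n))" by auto
  define u where "u n x = mollify (r n) f x - f x" for n x
  have [measurable]: "mollify (r n) f \<in> borel_measurable borel" for n
    by (intro borel_measurable_continuous_onI continuous_mollify f r)
  have [measurable]: "u n \<in> borel_measurable borel" for n unfolding u_def[abs_def] by measurable
  have int: "integrable lborel (u n)" for n
  proof (rule integrableI_bounded)
    show "(\<integral>\<^sup>+x. ennreal (norm (u n x)) \<partial>lborel) < \<infinity>"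
      using r(2)[of n] by (simp add: u_def order.strict_trans1[OF _ ennreal_less_top])
  qed simp
  have "(LINT x|lborel. norm (u n x)) \<le> 1 / real (Suc n)" for n
  proof -
    have "ennreal (LINT x|lborel. norm (u n x)) = (\<integral>\<^sup>+x. norm (u n x) \<partial>lborel)"
      by (intro nn_integral_eq_integral[symmetric] integrable_norm int AE_I2) simp
    also note r(2)[of n, folded u_def]
    finally show ?thesis by (subst (asm) ennreal_le_iff) auto
  qed
  then have "(\<lambda>n. LINT x|lborel. norm (u n x)) \<longlonglongrightarrow> 0"
    by (intro tendsto_sandwich[OF always_eventually always_eventually tendsto_const
          LIMSEQ_inverse_real_of_nat[unfolded inverse_eq_divide]] allI integral_nonneg_AE AE_I2) simp_all
  from tendsto_L1_AE_subseq[OF int this]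
  obtain s :: "nat \<Rightarrow> nat" where "AE x in lborel. (\<lambda>n. u (s n) x) \<longlonglongrightarrow> 0" by blast
  then have "AE x in lborel. (\<lambda>n. mollify (r (s n)) f x) \<longlonglongrightarrow> f x"
    by eventually_elim (simp add: u_def LIM_zero_iff)
  then show ?thesis by (intro that[of "\<lambda>n. r (s n)"] r)
qed

text \<open>The bound for the mollified fields does not depend on the radius of mollification, so it
  passes to the limit by Fatou's lemma along radii with almost everywhere convergence.\<close>

lemma integrable_det_bound:
  fixes a :: "real^'n \<Rightarrow> real^'n^'n"
  assumes d: "2 \<le> CARD('n)" and a: "integrable lborel a"
    and sym: "\<And>x. transpose (a x) = a x" and psd: "\<And>x v. 0 \<le> v \<bullet> (a x *v v)" and C: "0 \<le> C"
    and bound: "trace_bounded a C"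
  shows "(\<integral>\<^sup>+x. ennreal (det (a x) powr (1 / (real CARD('n) - 1))) \<partial>lborel) \<le> ennreal (det_bound_const TYPE('n) C)"
proof -
  let ?p = "1 / (real CARD('n) - 1)"
  have p: "0 < ?p" using d by simp
  obtain r where r: "\<And>n. 0 < r n" and lim: "AE x in lborel. (\<lambda>n. mollify (r n) a x) \<longlonglongrightarrow> a x"
    using mollify_AE_convergent[OF a] by blast
  let ?b = "\<lambda>n. mollify (r n) a"
  have bs: "transpose (?b n x) = ?b n x" "0 \<le> v \<bullet> (?b n x *v v)" for n x v
    by (rule mollify_symmetric[OF a r sym], rule mollify_psd[OF a r psd])
  have bc: "continuous_on UNIV (?b n)" for n by (rule continuous_mollify[OF a r])
  have each: "(\<integral>\<^sup>+x. ennreal (det (?b n x) powr ?p) \<partial>lborel) \<le> ennreal (det_bound_const TYPE('n) C)" for n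
    by (rule continuous_det_bound[OF d bc bs mollify_trace_bounded[OF a r psd bound] C])
  have [measurable]: "(\<lambda>x. det (?b n x)) \<in> borel_measurable borel" for n
    by (intro borel_measurable_continuous_onI continuous_on_det bc)
  have "(\<integral>\<^sup>+x. ennreal (det (a x) powr ?p) \<partial>lborel) = (\<integral>\<^sup>+x. liminf (\<lambda>n. ennreal (det (?b n x) powr ?p)) \<partial>lborel)"
  proof (rule nn_integral_cong_AE)
    show "AE x in lborel. ennreal (det (a x) powr ?p) = liminf (\<lambda>n. ennreal (det (?b n x) powr ?p))"
      using lim
    proof eventually_elim
      fix x assume l: "(\<lambda>n. ?b n x) \<longlonglongrightarrow> a x"
      have "(\<lambda>n. det (?b n x)) \<longlonglongrightarrow> det (a x)"
        unfolding det_def by (intro tendsto_intros l)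
      \<comment> \<open>Where the limit determinant is 0, convergence of the powers rests on
        \<open>?p\<close> being positive and the determinants nonnegative.\<close>
      then have "(\<lambda>n. det (?b n x) powr ?p) \<longlonglongrightarrow> det (a x) powr ?p"
        using p psd_det_nonneg[OF bs] by (intro tendsto_powr') auto
      then show "ennreal (det (a x) powr ?p) = liminf (\<lambda>n. ennreal (det (?b n x) powr ?p))"
        by (intro lim_imp_Liminf[symmetric] tendsto_ennrealI) auto
    qed
  qed
  also have "\<dots> \<le> liminf (\<lambda>n. \<integral>\<^sup>+x. ennreal (det (?b n x) powr ?p) \<partial>lborel)"
    by (rule nn_integral_liminf) measurable
  also have "\<dots> \<le> liminf (\<lambda>n. ennreal (det_bound_const TYPE('n) C))"
    by (intro Liminf_mono always_eventually allI each)
  finally show ?thesis by (simp add: Liminf_const)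
qed

text \<open>On the ball of half the radius the cutoff is bounded below by a positive constant, and
  the determinant is homogeneous of degree \<open>d\<close>; so the cutoff can be divided out
  there.\<close>

lemma local_det_bound:
  fixes A :: "real^'n \<Rightarrow> real^'n^'n"
  assumes d: "2 \<le> CARD('n)"
    and A: "AE x in lebesgue. x \<in> \<Omega> \<longrightarrow> transpose (A x) = A x" "\<forall>i j. locally_L1 (\<lambda>x. A x $ i $ j) \<Omega>"
      "AE x in lebesgue. x \<in> \<Omega> \<longrightarrow> (\<forall>v. 0 \<le> v \<bullet> (A x *v v))" "div_locally_measure A \<Omega>"
    and r: "0 < r" "cball x0 r \<subseteq> \<Omega>"
  shows "(\<integral>\<^sup>+x. ennreal (det (A x) powr (1 / (real CARD('n) - 1))) * indicator (ball x0 (r/2)) x \<partial>lebesgue) < \<infinity>"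
proof (rule cutoff_borel_representative[OF A r])
  let ?p = "1 / (real CARD('n) - 1)"
  fix a :: "real^'n \<Rightarrow> real^'n^'n" and C
  assume a: "integrable lborel a" "\<And>x. transpose (a x) = a x" "\<And>x v. 0 \<le> v \<bullet> (a x *v v)"
    "AE x in lborel. a x = cutoff x0 r x *\<^sub>R A x" "0 \<le> C" and bound: "trace_bounded a C"
  have fin: "(\<integral>\<^sup>+x. ennreal (det (a x) powr ?p) \<partial>lborel) \<le> ennreal (det_bound_const TYPE('n) C)"
    by (rule integrable_det_bound[OF d a(1,2,3,5) bound])
  \<comment> \<open>The value of the cutoff at distance \<open>r/2\<close> from the centre, as
    \<open>r^2 - (r/2)^2\<close> is \<open>3/4 * r^2\<close>.\<close>
  define k where "k = bump (3/4 * r\<^sup>2)"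
  have k: "0 < k" using r by (simp add: k_def bump_bounds)
  define \<kappa> where "\<kappa> = (k ^ CARD('n)) powr ?p"
  have \<kappa>: "0 < \<kappa>" using k by (simp add: \<kappa>_def)
  have AEa: "AE x in lebesgue. a x = cutoff x0 r x *\<^sub>R A x"
    using a(4) by (simp only: AE_completion_iff)
  have "AE x in lebesgue. ennreal (det (A x) powr ?p) * indicator (ball x0 (r/2)) x \<le> ennreal (1/\<kappa>) * ennreal (det (a x) powr ?p)"
    using A(1) A(3) AEa
  proof eventually_elim
    fix x assume A: "x \<in> \<Omega> \<longrightarrow> transpose (A x) = A x" "x \<in> \<Omega> \<longrightarrow> (\<forall>v. 0 \<le> v \<bullet> (A x *v v))"
      and ax: "a x = cutoff x0 r x *\<^sub>R A x"
    show "ennreal (det (A x) powr ?p) * indicator (ball x0 (r/2)) x \<le> ennreal (1/\<kappa>) * ennreal (det (a x) powr ?p)"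
    proof (cases "x \<in> ball x0 (r/2)")
      case True
      then have "x \<in> \<Omega>" using r by auto
      then have dA: "0 \<le> det (A x)" using A by (intro psd_det_nonneg) auto
      have "(norm (x - x0))\<^sup>2 \<le> (r/2)\<^sup>2"
        using True by (intro power_mono) (auto simp: dist_norm norm_minus_commute)
      then have kx: "k \<le> cutoff x0 r x"
        unfolding k_def cutoff_def by (intro bump_mono) (simp add: power_divide)
      have "\<kappa> * det (A x) powr ?p = (k ^ CARD('n) * det (A x)) powr ?p"
        using k dA by (simp add: \<kappa>_def powr_mult)
      also have "\<dots> \<le> det (a x) powr ?p"
        unfolding ax det_scaleR using k kx dA d by (intro powr_mono2 mult_right_mono power_mono) auto
      finally have "det (A x) powr ?p \<le> 1/\<kappa> * det (a x) powr ?p" using \<kappa> by (simp add: field_simps)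
      then show ?thesis using True \<kappa> by (simp add: ennreal_mult[symmetric] ennreal_leI)
    qed simp
  qed
  then have "(\<integral>\<^sup>+x. ennreal (det (A x) powr ?p) * indicator (ball x0 (r/2)) x \<partial>lebesgue) \<le>
      (\<integral>\<^sup>+x. ennreal (1/\<kappa>) * ennreal (det (a x) powr ?p) \<partial>lebesgue)"
    by (rule nn_integral_mono_AE)
  also have "\<dots> = (\<integral>\<^sup>+x. ennreal (1/\<kappa>) * ennreal (det (a x) powr ?p) \<partial>lborel)"
    by (rule nn_integral_completion)
  also have "\<dots> = ennreal (1/\<kappa>) * (\<integral>\<^sup>+x. ennreal (det (a x) powr ?p) \<partial>lborel)"
  proof (rule nn_integral_cmult)
    have "a \<in> borel_measurable borel" using a(1) by auto
    then have "(\<lambda>x. det (a x)) \<in> borel_measurable borel"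
      by (rule measurable_compose[OF _ borel_measurable_continuous_onI[OF continuous_on_det[OF continuous_on_id]]])
    then show "(\<lambda>x. ennreal (det (a x) powr ?p)) \<in> borel_measurable lborel" by measurable
  qed
  also have "\<dots> \<le> ennreal (1/\<kappa>) * ennreal (det_bound_const TYPE('n) C)"
    by (intro mult_left_mono fin) auto
  also have "\<dots> < \<infinity>" by (simp add: ennreal_mult_less_top)
  finally show ?thesis .
qed

theorem theorem2p4:
  fixes A :: "real^'n \<Rightarrow> real^'n^'n" and \<Omega> :: "(real^'n) set"
  assumes "CARD('n) \<ge> 2"
    and "open \<Omega>"
    and "AE x in lebesgue. x \<in> \<Omega> \<longrightarrow> transpose (A x) = A x"
    and "\<forall>i j. locally_L1 (\<lambda>x. A x $ i $ j) \<Omega>"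
    and "AE x in lebesgue. x \<in> \<Omega> \<longrightarrow> (\<forall>v. 0 \<le> v \<bullet> (A x *v v))"
    and "div_locally_measure A \<Omega>"
  shows "locally_L1 (\<lambda>x. det (A x) powr (1 / (real CARD('n) - 1))) \<Omega>"
  unfolding locally_L1_def
proof (intro allI impI, elim conjE)
  fix K assume K: "compact K" "K \<subseteq> \<Omega>"
  let ?p = "1 / (real CARD('n) - 1)"
  let ?f = "\<lambda>x. det (A x) powr ?p"
  have "\<exists>r>0. cball x r \<subseteq> \<Omega>" if "x \<in> K" for x
    using that K(2) \<open>open \<Omega>\<close> open_contains_cball by blast
  then obtain r where r: "\<And>x. x \<in> K \<Longrightarrow> 0 < r x \<and> cball x (r x) \<subseteq> \<Omega>" by metis
  have "K \<subseteq> (\<Union>x\<in>K. ball x (r x / 2))" using r by force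
  then obtain F where F: "F \<subseteq> K" "finite F" "K \<subseteq> (\<Union>x\<in>F. ball x (r x / 2))"
    using compactE_image[OF K(1), of K "\<lambda>x. ball x (r x / 2)"] by auto
  \<comment> \<open>Measurability is known only for the entries restricted to \<open>K\<close>. The
    indicator is therefore put inside the determinant, and homogeneity together with
    \<open>0 powr ?p = 0\<close> takes it out again.\<close>
  have meas: "(\<lambda>x. indicator K x * ?f x) \<in> borel_measurable lebesgue"
  proof -
    have AK: "(\<lambda>x. indicator K x * A x $ i $ j) \<in> borel_measurable lebesgue" for i j
      using assms(4) K by (auto simp: locally_L1_def set_integrable_def intro: borel_measurable_integrable)
    have "(\<lambda>x. det (\<chi> i j. indicator K x * A x $ i $ j)) \<in> borel_measurable lebesgue"
      unfolding det_def vec_lambda_beta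
      by (intro borel_measurable_sum borel_measurable_times borel_measurable_prod borel_measurable_const AK)
    then have "(\<lambda>x. det (\<chi> i j. indicator K x * A x $ i $ j) powr ?p) \<in> borel_measurable lebesgue"
      by (rule powr_real_measurable) simp
    moreover have "(\<lambda>x. det (\<chi> i j. indicator K x * A x $ i $ j) powr ?p) = (\<lambda>x. indicator K x * ?f x)"
    proof
      fix x
      have "(\<chi> i j. indicator K x * A x $ i $ j) = indicator K x *\<^sub>R A x" by (simp add: vec_eq_iff)
      then have "det (\<chi> i j. indicator K x * A x $ i $ j) = indicator K x ^ CARD('n) * det (A x)"
        by (simp only: det_scaleR)
      then show "det (\<chi> i j. indicator K x * A x $ i $ j) powr ?p = indicator K x * ?f x"
        by (cases "x \<in> K") simp_all
    qed
    ultimately show ?thesis by (simp only:)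
  qed
  let ?g = "\<lambda>x. ennreal (indicator K x * ?f x)"
  have "(\<integral>\<^sup>+x. ?g x \<partial>lebesgue) \<le> (\<integral>\<^sup>+x. (\<Sum>y\<in>F. ?g x * indicator (ball y (r y / 2)) x) \<partial>lebesgue)"
  proof (rule nn_integral_mono)
    fix x
    show "?g x \<le> (\<Sum>y\<in>F. ?g x * indicator (ball y (r y / 2)) x)"
    proof (cases "x \<in> K")
      case True
      then obtain y where y: "y \<in> F" "x \<in> ball y (r y / 2)" using F(3) by blast
      have "?g x = ?g x * indicator (ball y (r y / 2)) x" using y by simp
      also have "\<dots> \<le> (\<Sum>y\<in>F. ?g x * indicator (ball y (r y / 2)) x)"
        using F(2) y(1) by (intro member_le_sum) auto
      finally show ?thesis .
    qed simp
  qed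
  also have "\<dots> = (\<Sum>y\<in>F. \<integral>\<^sup>+x. ?g x * indicator (ball y (r y / 2)) x \<partial>lebesgue)"
    by (intro nn_integral_sum borel_measurable_times_ennreal measurable_compose[OF meas measurable_ennreal]
        borel_measurable_indicator) simp
  also have "\<dots> < \<infinity>"
  proof -
    have "(\<integral>\<^sup>+x. ?g x * indicator (ball y (r y / 2)) x \<partial>lebesgue) < \<infinity>" if "y \<in> F" for y
    proof -
      have "(\<integral>\<^sup>+x. ?g x * indicator (ball y (r y / 2)) x \<partial>lebesgue) \<le>
          (\<integral>\<^sup>+x. ennreal (?f x) * indicator (ball y (r y / 2)) x \<partial>lebesgue)"
        by (intro nn_integral_mono mult_right_mono) (auto simp: indicator_def)
      also have "\<dots> < \<infinity>"
        using r[of y] that F(1) by (intro local_det_bound[OF assms(1,3-6)]) auto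
      finally show ?thesis .
    qed
    then show ?thesis using F(2) by (simp add: less_top[symmetric] ennreal_sum_eq_top)
  qed
  finally have "integrable lebesgue (\<lambda>x. indicator K x * ?f x)"
    by (intro integrableI_nonneg meas) (auto intro!: AE_I2)
  then show "?f absolutely_integrable_on K" by (simp add: set_integrable_def)
qed

end
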